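(* Let $\Omega\subset\mathbb{R}^2$ be a bounded smooth domain and let $\mathcal M$ be the space of smooth Riemannian metrics on $\Omega$. Fix one metric $g_0\in\mathcal M$ and the associated Laplacian $\Delta_{g_0}$ with its (Dirichlet) spectrum $\sigma(\Delta_{g_0})$. Then the set $$\mathcal G_{uc}=\{g\in\mathcal M:\sigma(\Delta_g)\cap\sigma(\Delta_{g_0})=\emptyset\}$$ is residual in $\mathcal M$.
   Context: $\mathcal M=\{g\in C^\infty(\Omega,T^*\Omega\otimes T^*\Omega): g \text{ symmetric},\ g(x)(v_x,v_x)>0 \text{ for } 0\ne v_x\in T_x\Omega\}$ (metrics smooth and positive definite up to the boundary), with the $C^\infty$ topology. $\Delta_g$ is the Laplace–Beltrami operator of $g$, and $\sigma(\Delta_g)$ denotes the set of eigenvalues $\mu$ of $-\Delta_gu=\mu u$ with Dirichlet condition $u\in H^1_0(\Omega)$, $u\ne0$. A set is residual if it contains a countable intersection of open dense sets. *)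

theory Defs
  imports "HOL-Analysis.Analysis" "HOL-Library.FuncSet"
begin

section \<open>Smooth functions and smooth domains\<close>

definition partial_deriv ::
  "'n \<Rightarrow> (real^'n \<Rightarrow> 'b::real_normed_vector) \<Rightarrow> real^'n \<Rightarrow> 'b" where
  "partial_deriv i f x = frechet_derivative f (at x) (axis i 1)"

text \<open>Iterated partial derivatives, indexed by a list of directions rather than by a multi-index.\<close>

primrec partial_derivs ::
  "'n list \<Rightarrow> (real^'n \<Rightarrow> 'b::real_normed_vector) \<Rightarrow> real^'n \<Rightarrow> 'b" where
  "partial_derivs [] f = f"
| "partial_derivs (i # is) f = partial_deriv i (partial_derivs is f)"

text \<open>Only meaningful for open \<open>S\<close>: every iterated partial derivative is again (Frechet)
  differentiable, which is equivalent to existence and continuity of all partial derivatives.\<close>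

definition smooth_on :: "(real^'n) set \<Rightarrow> (real^'n \<Rightarrow> 'b::real_normed_vector) \<Rightarrow> bool" where
  "smooth_on S f \<longleftrightarrow> (\<forall>is. partial_derivs is f differentiable_on S)"

text \<open>Smoothness up to the boundary: all derivatives on the open set \<open>\<Omega>\<close> extend
  continuously to its closure. Only values of \<open>f\<close> on the closure matter.\<close>

definition smooth_upto_boundary ::
  "(real^'n) set \<Rightarrow> (real^'n \<Rightarrow> 'b::real_normed_vector) \<Rightarrow> bool" where
  "smooth_upto_boundary \<Omega> f \<longleftrightarrow>
     continuous_on (closure \<Omega>) f \<and> smooth_on \<Omega> f \<and>
     (\<forall>is. \<exists>h. continuous_on (closure \<Omega>) h \<and> (\<forall>x\<in>\<Omega>. h x = partial_derivs is f x))"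

definition gradient :: "(real^'n \<Rightarrow> real) \<Rightarrow> real^'n \<Rightarrow> real^'n" where
  "gradient f x = (\<chi> i. partial_deriv i f x)"

text \<open>The boundary is smooth: near each of its points, \<open>\<Omega>\<close> is the sublevel set of a smooth
  local defining function with nonvanishing gradient.\<close>

definition smooth_boundary :: "(real^'n) set \<Rightarrow> bool" where
  "smooth_boundary \<Omega> \<longleftrightarrow>
     (\<forall>p\<in>frontier \<Omega>. \<exists>U \<rho>. open U \<and> p \<in> U \<and> smooth_on U \<rho> \<and>
        (\<forall>x\<in>U. gradient \<rho> x \<noteq> 0) \<and> \<Omega> \<inter> U = {x\<in>U. \<rho> x < 0})"

definition bounded_smooth_domain :: "(real^'n) set \<Rightarrow> bool" where
  "bounded_smooth_domain \<Omega> \<longleftrightarrow>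
     \<Omega> \<noteq> {} \<and> open \<Omega> \<and> connected \<Omega> \<and> bounded \<Omega> \<and> smooth_boundary \<Omega>"

definition test_functions :: "(real^'n) set \<Rightarrow> (real^'n \<Rightarrow> real) set" where
  "test_functions \<Omega> =
     {\<phi>. smooth_on UNIV \<phi> \<and> compact (closure {x. \<phi> x \<noteq> 0}) \<and> closure {x. \<phi> x \<noteq> 0} \<subseteq> \<Omega>}"

section \<open>The space of Riemannian metrics with the smooth topology\<close>

text \<open>A metric on \<open>\<Omega>\<close> is represented by its coefficient matrix on the closure of \<open>\<Omega>\<close>;
  \<open>extensional\<close> makes the representing function unique.\<close>

definition riemannian_metrics :: "(real^'n) set \<Rightarrow> (real^'n \<Rightarrow> real^'n^'n) set" where
  "riemannian_metrics \<Omega> =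
     {g \<in> extensional (closure \<Omega>).
        smooth_upto_boundary \<Omega> g \<and>
        (\<forall>x\<in>closure \<Omega>. transpose (g x) = g x \<and> (\<forall>v. v \<noteq> 0 \<longrightarrow> v \<bullet> (g x *v v) > 0))}"

text \<open>Uniform closeness on \<open>\<Omega>\<close> of all derivatives of order at most \<open>k\<close>. By continuous extension
  this is the same as uniform closeness on the closure.\<close>

definition Ck_close ::
  "(real^'n) set \<Rightarrow> nat \<Rightarrow> real \<Rightarrow> (real^'n \<Rightarrow> 'b::real_normed_vector) \<Rightarrow> (real^'n \<Rightarrow> 'b) \<Rightarrow> bool" where
  "Ck_close \<Omega> k \<epsilon> f h \<longleftrightarrow>
     (\<forall>is. length is \<le> k \<longrightarrow>
        (\<forall>x\<in>\<Omega>. norm (partial_derivs is h x - partial_derivs is f x) < \<epsilon>))"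

definition metrics_topology :: "(real^'n) set \<Rightarrow> (real^'n \<Rightarrow> real^'n^'n) topology" where
  "metrics_topology \<Omega> = topology (\<lambda>U. U \<subseteq> riemannian_metrics \<Omega> \<and>
     (\<forall>g\<in>U. \<exists>k. \<exists>\<epsilon>>0. \<forall>h\<in>riemannian_metrics \<Omega>. Ck_close \<Omega> k \<epsilon> g h \<longrightarrow> h \<in> U))"

lemma Ck_close_mono:
  assumes "Ck_close \<Omega> k \<epsilon> f h" "k' \<le> k" "\<epsilon> \<le> \<epsilon>'"
  shows "Ck_close \<Omega> k' \<epsilon>' f h"
  using assms unfolding Ck_close_def by (meson le_trans less_le_trans)

lemma openin_metrics_topology:
  "openin (metrics_topology \<Omega>) U \<longleftrightarrow> U \<subseteq> riemannian_metrics \<Omega> \<and>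
     (\<forall>g\<in>U. \<exists>k. \<exists>\<epsilon>>0. \<forall>h\<in>riemannian_metrics \<Omega>. Ck_close \<Omega> k \<epsilon> g h \<longrightarrow> h \<in> U)"
proof -
  let ?M = "riemannian_metrics \<Omega>"
  let ?P = "\<lambda>U. U \<subseteq> ?M \<and> (\<forall>g\<in>U. \<exists>k. \<exists>\<epsilon>>0. \<forall>h\<in>?M. Ck_close \<Omega> k \<epsilon> g h \<longrightarrow> h \<in> U)"
  have int: "?P (S \<inter> T)" if S: "?P S" and T: "?P T" for S T
  proof (intro conjI ballI)
    show "S \<inter> T \<subseteq> ?M" using S by blast
    fix g assume g: "g \<in> S \<inter> T"
    obtain k \<epsilon> where 1: "\<epsilon> > 0" "\<And>h. h \<in> ?M \<Longrightarrow> Ck_close \<Omega> k \<epsilon> g h \<Longrightarrow> h \<in> S"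
      using S g by blast
    obtain l \<delta> where 2: "\<delta> > 0" "\<And>h. h \<in> ?M \<Longrightarrow> Ck_close \<Omega> l \<delta> g h \<Longrightarrow> h \<in> T"
      using T g by blast
    have "h \<in> S \<inter> T" if "h \<in> ?M" "Ck_close \<Omega> (max k l) (min \<epsilon> \<delta>) g h" for h
      using 1(2) 2(2) that Ck_close_mono[OF that(2), of k \<epsilon>] Ck_close_mono[OF that(2), of l \<delta>]
      by simp
    then show "\<exists>k. \<exists>\<epsilon>>0. \<forall>h\<in>?M. Ck_close \<Omega> k \<epsilon> g h \<longrightarrow> h \<in> S \<inter> T"
      using 1(1) 2(1) by (intro exI[of _ "max k l"] exI[of _ "min \<epsilon> \<delta>"]) auto
  qed
  have un: "?P (\<Union>\<K>)" if "\<forall>K\<in>\<K>. ?P K" for \<K>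
  proof (intro conjI ballI)
    show "\<Union>\<K> \<subseteq> ?M" using that by blast
    fix g assume "g \<in> \<Union>\<K>"
    then obtain K where K: "K \<in> \<K>" "g \<in> K" by blast
    have "\<exists>k. \<exists>\<epsilon>>0. \<forall>h\<in>?M. Ck_close \<Omega> k \<epsilon> g h \<longrightarrow> h \<in> K"
      using that[rule_format, OF K(1)] K(2) by simp
    then obtain k \<epsilon> where "\<epsilon> > 0" "\<forall>h\<in>?M. Ck_close \<Omega> k \<epsilon> g h \<longrightarrow> h \<in> K"
      by blast
    then show "\<exists>k. \<exists>\<epsilon>>0. \<forall>h\<in>?M. Ck_close \<Omega> k \<epsilon> g h \<longrightarrow> h \<in> \<Union>\<K>"
      using K(1) by blast
  qed
  have "istopology ?P"
    unfolding istopology_def using int un by presburger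
  then show ?thesis
    unfolding metrics_topology_def by (simp add: topology_inverse')
qed

lemma topspace_metrics_topology: "topspace (metrics_topology \<Omega>) = riemannian_metrics \<Omega>"
proof (rule subset_antisym)
  show "topspace (metrics_topology \<Omega>) \<subseteq> riemannian_metrics \<Omega>"
    using openin_metrics_topology[of \<Omega> "topspace (metrics_topology \<Omega>)"] by simp
  have "openin (metrics_topology \<Omega>) (riemannian_metrics \<Omega>)"
    unfolding openin_metrics_topology by (auto intro: exI[of _ "1::real"])
  then show "riemannian_metrics \<Omega> \<subseteq> topspace (metrics_topology \<Omega>)"
    by (rule openin_subset)
qed

definition residual_in :: "'a topology \<Rightarrow> 'a set \<Rightarrow> bool" where
  "residual_in X A \<longleftrightarrow> A \<subseteq> topspace X \<and>
     (\<exists>\<U>. countable \<U> \<and> (\<forall>U\<in>\<U>. openin X U \<and> X closure_of U = topspace X) \<and>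
        topspace X \<inter> \<Inter>\<U> \<subseteq> A)"

section \<open>Sobolev functions and the Laplace-Beltrami operator\<close>

definition locally_integrable_on ::
  "(real^'n \<Rightarrow> 'b::euclidean_space) \<Rightarrow> (real^'n) set \<Rightarrow> bool" (infixr "locally'_integrable'_on" 46) where
  "f locally_integrable_on \<Omega> \<longleftrightarrow> (\<forall>K. compact K \<and> K \<subseteq> \<Omega> \<longrightarrow> f absolutely_integrable_on K)"

definition has_weak_gradient ::
  "(real^'n) set \<Rightarrow> (real^'n \<Rightarrow> real) \<Rightarrow> (real^'n \<Rightarrow> real^'n) \<Rightarrow> bool" where
  "has_weak_gradient \<Omega> u w \<longleftrightarrow>
     u locally_integrable_on \<Omega> \<and> w locally_integrable_on \<Omega> \<and>
     (\<forall>\<phi>\<in>test_functions \<Omega>. \<forall>i.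
        (LINT x:\<Omega>|lebesgue. u x * partial_deriv i \<phi> x) = - (LINT x:\<Omega>|lebesgue. w x $ i * \<phi> x))"

definition square_integrable_on ::
  "(real^'n \<Rightarrow> 'b::euclidean_space) \<Rightarrow> (real^'n) set \<Rightarrow> bool" (infixr "square'_integrable'_on" 46) where
  "f square_integrable_on \<Omega> \<longleftrightarrow>
     f \<in> borel_measurable (lebesgue_on \<Omega>) \<and> integrable (lebesgue_on \<Omega>) (\<lambda>x. (norm (f x))\<^sup>2)"

text \<open>The closure of the test functions in the Sobolev space of square integrable functions with
  square integrable weak gradient. Elements are functions, not classes modulo null sets.\<close>

definition H10 :: "(real^'n) set \<Rightarrow> (real^'n \<Rightarrow> real) set" where
  "H10 \<Omega> = {u. \<exists>w. u square_integrable_on \<Omega> \<and> w square_integrable_on \<Omega> \<and>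
     has_weak_gradient \<Omega> u w \<and>
     (\<forall>\<epsilon>>0. \<exists>\<phi>\<in>test_functions \<Omega>.
        (LINT x:\<Omega>|lebesgue. (\<phi> x - u x)\<^sup>2 + (norm (gradient \<phi> x - w x))\<^sup>2) < \<epsilon>)}"

definition vol_density :: "(real^'n \<Rightarrow> real^'n^'n) \<Rightarrow> real^'n \<Rightarrow> real" where
  "vol_density g x = sqrt (det (g x))"

text \<open>The weak form of \<open>div\<^sub>g X = f\<close>, where
  \<open>div\<^sub>g X = (1 / sqrt (det g)) * (\<Sum>i. \<partial>\<^sub>i (sqrt (det g) * X\<^sup>i))\<close>.\<close>

definition has_weak_divergence ::
  "(real^'n) set \<Rightarrow> (real^'n \<Rightarrow> real^'n^'n) \<Rightarrow> (real^'n \<Rightarrow> real^'n) \<Rightarrow> (real^'n \<Rightarrow> real) \<Rightarrow> bool" where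
  "has_weak_divergence \<Omega> g X f \<longleftrightarrow>
     X locally_integrable_on \<Omega> \<and> f locally_integrable_on \<Omega> \<and>
     (\<forall>\<phi>\<in>test_functions \<Omega>.
        (LINT x:\<Omega>|lebesgue. (X x \<bullet> gradient \<phi> x) * vol_density g x) =
        - (LINT x:\<Omega>|lebesgue. f x * \<phi> x * vol_density g x))"

text \<open>\<open>\<Delta>\<^sub>g u = f\<close> weakly, with \<open>\<Delta>\<^sub>g = div\<^sub>g grad\<^sub>g\<close> and \<open>grad\<^sub>g u\<close> obtained from the differential
  of \<open>u\<close> by raising the index with the inverse of \<open>g\<close>.\<close>

definition has_weak_laplacian ::
  "(real^'n) set \<Rightarrow> (real^'n \<Rightarrow> real^'n^'n) \<Rightarrow> (real^'n \<Rightarrow> real) \<Rightarrow> (real^'n \<Rightarrow> real) \<Rightarrow> bool" where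
  "has_weak_laplacian \<Omega> g u f \<longleftrightarrow>
     (\<exists>w. has_weak_gradient \<Omega> u w \<and>
          has_weak_divergence \<Omega> g (\<lambda>x. matrix_inv (g x) *v w x) f)"

text \<open>The eigenvalues of \<open>-\<Delta>\<^sub>g\<close> with Dirichlet boundary condition, i.e. \<open>\<Delta>\<^sub>g u = - \<mu> u\<close>.\<close>

definition dirichlet_spectrum :: "(real^'n) set \<Rightarrow> (real^'n \<Rightarrow> real^'n^'n) \<Rightarrow> real set" where
  "dirichlet_spectrum \<Omega> g =
     {\<mu>. \<exists>u\<in>H10 \<Omega>. \<not> (AE x in lebesgue_on \<Omega>. u x = 0) \<and>
          has_weak_laplacian \<Omega> g u (\<lambda>x. - \<mu> * u x)}"

end

theory Submission
  imports Defs
begin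

text \<open>Let \<open>\<mu>\<^sub>0\<close> be an eigenvalue of \<open>g\<^sub>0\<close>. The metrics with eigenvalue \<open>\<mu>\<^sub>0\<close> form a countable union of sets
  \<open>F\<close> on which an eigenfunction can be chosen with integral one over a fixed set from a countable separating
  family and with Sobolev norm below a fixed bound. Both normalizations survive weak limits and the
  eigenvalue equation is linear, so \<open>F\<close> is closed; no compact embedding is needed. Replacing \<open>g\<close> by \<open>c g\<close> for a
  constant \<open>c\<close> divides the spectrum by \<open>c\<close>. As \<open>0\<close> is not an eigenvalue and eigenfunctions to
  distinct eigenvalues are orthogonal, only finitely many \<open>c\<close> keep \<open>c g\<close> in \<open>F\<close>, so \<open>F\<close> has empty
  interior. The same decomposition shows that the spectrum of \<open>g\<^sub>0\<close> is countable.\<close>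

section \<open>Square integrable functions\<close>

text \<open>No eigenvalue is followed along a perturbation, so multiplicities never enter.
  Closedness comes from approximate eigenfunctions: an eigenfunction of a metric near
  \<open>g\<close> solves the weak equation of \<open>g\<close> up to a small error. For each error
  bound the normalized approximate solutions form a midpoint convex set, and these sets shrink with
  the bound. If none of them is empty, elements of almost minimal norm converge in norm to an exact
  normalized solution; this replaces extracting a weak limit. In weak form the equation contains no
  derivative of the metric, so the perturbation is controlled by uniform closeness alone. Scaling is
  transparent in dimension two: \<open>sqrt (det g)\<close> times the inverse metric does not change
  under a constant factor, so only the volume density feels it. Finiteness of the bad factors is a
  Bessel type inequality: orthogonal functions of bounded norm that all pair to one with a fixed
  function are few. The eigenvalue 0 is the one value that scaling cannot move, hence its separate
  exclusion.\<close>

definition L2 :: "'a measure \<Rightarrow> ('a \<Rightarrow> 'b::euclidean_space) set" where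
  "L2 M = {f \<in> borel_measurable M. integrable M (\<lambda>x. (norm (f x))\<^sup>2)}"

text \<open>Values in an arbitrary Euclidean space let the same lemmas serve scalar functions,
  gradients and pairs of both. The squared norm is written \<open>ip M f f\<close>
  throughout.\<close>

definition ip :: "'a measure \<Rightarrow> ('a \<Rightarrow> 'b::euclidean_space) \<Rightarrow> ('a \<Rightarrow> 'b) \<Rightarrow> real" where
  "ip M f g = (\<integral>x. f x \<bullet> g x \<partial>M)"

lemma L2_measurable: "f \<in> L2 M \<Longrightarrow> f \<in> borel_measurable M"
  by (simp add: L2_def)

lemma abs_inner_le_sum_squares: "\<bar>a \<bullet> b\<bar> \<le> (norm a)\<^sup>2 + (norm b)\<^sup>2"
proof -
  have "\<bar>a \<bullet> b\<bar> \<le> norm a * norm b" by (rule Cauchy_Schwarz_ineq2)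
  moreover have "2 * norm a * norm b \<le> (norm a)\<^sup>2 + (norm b)\<^sup>2" by (rule sum_squares_bound)
  moreover have "0 \<le> norm a * norm b" by simp
  ultimately show ?thesis by linarith
qed

lemma L2_inner_integrable:
  assumes f: "f \<in> L2 M" and g: "g \<in> L2 M"
  shows "integrable M (\<lambda>x. f x \<bullet> g x)"
proof (rule Bochner_Integration.integrable_bound)
  show "integrable M (\<lambda>x. (norm (f x))\<^sup>2 + (norm (g x))\<^sup>2)"
    using assms by (simp add: L2_def)
  show "(\<lambda>x. f x \<bullet> g x) \<in> borel_measurable M"
    using f g by (intro borel_measurable_inner) (auto simp: L2_def)
  show "AE x in M. norm (f x \<bullet> g x) \<le> norm ((norm (f x))\<^sup>2 + (norm (g x))\<^sup>2)"
    using abs_inner_le_sum_squares by (auto intro!: AE_I2)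
qed

lemma L2_bound:
  assumes f: "f \<in> L2 M" and g: "g \<in> borel_measurable M"
    and le: "\<And>x. x \<in> space M \<Longrightarrow> norm (g x) \<le> C * norm (f x)"
  shows "g \<in> L2 M"
proof -
  have "integrable M (\<lambda>x. (norm (g x))\<^sup>2)"
  proof (rule Bochner_Integration.integrable_bound)
    show "integrable M (\<lambda>x. C\<^sup>2 * (norm (f x))\<^sup>2)"
      using f by (simp add: L2_def)
    show "(\<lambda>x. (norm (g x))\<^sup>2) \<in> borel_measurable M" using g by measurable
    show "AE x in M. norm ((norm (g x))\<^sup>2) \<le> norm (C\<^sup>2 * (norm (f x))\<^sup>2)"
      using power_mono[OF le norm_ge_zero, of _ 2] by (auto simp: power_mult_distrib intro!: AE_I2)
  qed
  then show ?thesis using g by (simp add: L2_def)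
qed

lemma L2_scaleR: "f \<in> L2 M \<Longrightarrow> (\<lambda>x. c *\<^sub>R f x) \<in> L2 M"
  by (rule L2_bound[of f _ _ "\<bar>c\<bar>"]) (auto intro: borel_measurable_scaleR dest: L2_measurable)

lemma L2_add:
  assumes "f \<in> L2 M" "g \<in> L2 M"
  shows "(\<lambda>x. f x + g x) \<in> L2 M"
proof -
  have "integrable M (\<lambda>x. (norm (f x))\<^sup>2 + 2 * (f x \<bullet> g x) + (norm (g x))\<^sup>2)"
    using assms L2_inner_integrable[OF assms] by (simp add: L2_def)
  moreover have "(\<lambda>x. (norm (f x + g x))\<^sup>2) = (\<lambda>x. (norm (f x))\<^sup>2 + 2 * (f x \<bullet> g x) + (norm (g x))\<^sup>2)"
    by (simp add: power2_norm_eq_inner inner_add_left inner_add_right inner_commute algebra_simps)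
  ultimately show ?thesis using assms by (simp add: L2_def borel_measurable_add)
qed

lemma L2_minus: "f \<in> L2 M \<Longrightarrow> (\<lambda>x. - f x) \<in> L2 M"
  using L2_scaleR[of f M "-1"] by simp

lemma L2_diff: "f \<in> L2 M \<Longrightarrow> g \<in> L2 M \<Longrightarrow> (\<lambda>x. f x - g x) \<in> L2 M"
  using L2_add[OF _ L2_minus, of f M g] by simp

lemma L2_zero: "(\<lambda>x. 0) \<in> L2 M"
  by (simp add: L2_def)

lemma L2_sum: "(\<And>i. i \<in> I \<Longrightarrow> f i \<in> L2 M) \<Longrightarrow> (\<lambda>x. \<Sum>i\<in>I. f i x) \<in> L2 M"
  by (induction I rule: infinite_finite_induct) (auto simp: L2_zero intro!: L2_add)

lemma ip_commute: "ip M f g = ip M g f"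
  by (simp add: ip_def inner_commute)

lemma ip_add_left: "\<lbrakk>f \<in> L2 M; g \<in> L2 M; h \<in> L2 M\<rbrakk> \<Longrightarrow> ip M (\<lambda>x. f x + g x) h = ip M f h + ip M g h"
  by (simp add: ip_def inner_add_left L2_inner_integrable)

lemma ip_diff_left: "\<lbrakk>f \<in> L2 M; g \<in> L2 M; h \<in> L2 M\<rbrakk> \<Longrightarrow> ip M (\<lambda>x. f x - g x) h = ip M f h - ip M g h"
  by (simp add: ip_def inner_diff_left L2_inner_integrable)

lemma ip_scaleR_left: "ip M (\<lambda>x. c *\<^sub>R f x) g = c * ip M f g"
  by (simp add: ip_def)

lemma ip_add_right: "\<lbrakk>f \<in> L2 M; g \<in> L2 M; h \<in> L2 M\<rbrakk> \<Longrightarrow> ip M h (\<lambda>x. f x + g x) = ip M h f + ip M h g"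
  by (simp add: ip_add_left ip_commute[of M h])

lemma ip_diff_right: "\<lbrakk>f \<in> L2 M; g \<in> L2 M; h \<in> L2 M\<rbrakk> \<Longrightarrow> ip M h (\<lambda>x. f x - g x) = ip M h f - ip M h g"
  by (simp add: ip_diff_left ip_commute[of M h])

lemma ip_scaleR_right: "ip M g (\<lambda>x. c *\<^sub>R f x) = c * ip M g f"
  by (simp add: ip_def)

lemma ip_sum_left:
  "(\<And>i. i \<in> I \<Longrightarrow> f i \<in> L2 M) \<Longrightarrow> h \<in> L2 M \<Longrightarrow> ip M (\<lambda>x. \<Sum>i\<in>I. f i x) h = (\<Sum>i\<in>I. ip M (f i) h)"
  by (simp add: ip_def inner_sum_left L2_inner_integrable)

lemma ip_sum_right:
  "(\<And>i. i \<in> I \<Longrightarrow> f i \<in> L2 M) \<Longrightarrow> h \<in> L2 M \<Longrightarrow> ip M h (\<lambda>x. \<Sum>i\<in>I. f i x) = (\<Sum>i\<in>I. ip M h (f i))"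
  by (simp add: ip_sum_left ip_commute[of M h])

lemma ip_nonneg: "0 \<le> ip M f f"
  by (simp add: ip_def)

lemma ip_self: "ip M f f = (\<integral>x. (norm (f x))\<^sup>2 \<partial>M)"
  by (simp add: ip_def power2_norm_eq_inner)

lemma ip_Cauchy_Schwarz:
  assumes f: "f \<in> L2 M" and g: "g \<in> L2 M"
  shows "(ip M f g)\<^sup>2 \<le> ip M f f * ip M g g"
proof -
  have *: "0 \<le> a\<^sup>2 * ip M f f - 2 * a * b * ip M f g + b\<^sup>2 * ip M g g" for a b
    using ip_nonneg[of M "\<lambda>x. a *\<^sub>R f x - b *\<^sub>R g x"]
    by (simp add: f g ip_diff_left ip_diff_right L2_diff L2_scaleR ip_scaleR_left ip_scaleR_right
        ip_commute[of M g f] algebra_simps power2_eq_square)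
  show ?thesis
  proof (cases "ip M g g = 0")
    case True
    have "ip M f g = 0"
    proof (rule ccontr)
      assume n: "ip M f g \<noteq> 0"
      \<comment> \<open>With a zero coefficient of \<open>b\<^sup>2\<close> the quadratic form is
        affine in \<open>b\<close>; this choice of \<open>b\<close> gives it the value -1.\<close>
      show False
        using *[of 1 "(ip M f f + 1) / (2 * ip M f g)"] n True by (simp add: field_simps)
    qed
    then show ?thesis using True by simp
  next
    case False
    then have pos: "0 < ip M g g" using ip_nonneg[of M g] by simp
    \<comment> \<open>The minimizing ratio of \<open>a\<close> to \<open>b\<close>, cleared of
      denominators.\<close>
    have "0 \<le> ip M g g * (ip M f f * ip M g g - (ip M f g)\<^sup>2)"
      using *[of "ip M g g" "ip M f g"] by (simp add: algebra_simps power2_eq_square)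
    then show ?thesis using pos by (simp add: zero_le_mult_iff)
  qed
qed

lemma ip_abs_le:
  assumes "f \<in> L2 M" "g \<in> L2 M"
  shows "\<bar>ip M f g\<bar> \<le> sqrt (ip M f f) * sqrt (ip M g g)"
  using real_sqrt_le_mono[OF ip_Cauchy_Schwarz[OF assms]] by (simp add: real_sqrt_mult)

lemma ip_bound_pointwise:
  assumes "f \<in> L2 M" "g \<in> L2 M" "0 \<le> C" "\<And>x. x \<in> space M \<Longrightarrow> norm (f x) \<le> C * norm (g x)"
  shows "ip M f f \<le> C\<^sup>2 * ip M g g"
proof -
  have "(\<integral>x. (norm (f x))\<^sup>2 \<partial>M) \<le> (\<integral>x. C\<^sup>2 * (norm (g x))\<^sup>2 \<partial>M)"
  proof (rule integral_mono)
    show "(norm (f x))\<^sup>2 \<le> C\<^sup>2 * (norm (g x))\<^sup>2" if "x \<in> space M" for x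
      using power_mono[OF assms(4)[OF that] norm_ge_zero, of 2] by (simp add: power_mult_distrib)
  qed (use assms in \<open>auto simp: L2_def\<close>)
  then show ?thesis by (simp add: ip_self)
qed

section \<open>Norm limits and completeness\<close>

definition L2_lim :: "'a measure \<Rightarrow> (nat \<Rightarrow> 'a \<Rightarrow> 'b::euclidean_space) \<Rightarrow> ('a \<Rightarrow> 'b) \<Rightarrow> bool" where
  "L2_lim M X f \<longleftrightarrow> (\<lambda>n. ip M (\<lambda>x. X n x - f x) (\<lambda>x. X n x - f x)) \<longlonglongrightarrow> 0"

lemma L2_lim_ip:
  assumes lim: "L2_lim M X f" and X: "\<And>n. X n \<in> L2 M" and f: "f \<in> L2 M" and g: "g \<in> L2 M"
  shows "(\<lambda>n. ip M (X n) g) \<longlonglongrightarrow> ip M f g"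
proof -
  let ?d = "\<lambda>n x. X n x - f x"
  have "(\<lambda>n. sqrt (ip M (?d n) (?d n)) * sqrt (ip M g g)) \<longlonglongrightarrow> sqrt 0 * sqrt (ip M g g)"
    using lim unfolding L2_lim_def by (intro tendsto_mult tendsto_real_sqrt tendsto_const)
  then have "(\<lambda>n. sqrt (ip M (?d n) (?d n)) * sqrt (ip M g g)) \<longlonglongrightarrow> 0" by simp
  then have "(\<lambda>n. ip M (?d n) g) \<longlonglongrightarrow> 0"
    by (rule Lim_null_comparison[rotated]) (simp add: ip_abs_le[OF L2_diff[OF X f] g])
  then have "(\<lambda>n. ip M (X n) g - ip M f g) \<longlonglongrightarrow> 0"
    by (simp add: ip_diff_left X f g)
  then show ?thesis by (rule Lim_null[THEN iffD2])
qed

text \<open>Expanding the squared norm of \<open>X n - f\<close>, which is nonnegative, bounds an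
  expression linear in \<open>X n\<close> by \<open>K\<close>; linear expressions pass to the limit
  by \<open>L2_lim_ip\<close>.\<close>

lemma L2_lim_ip_self_le:
  assumes lim: "L2_lim M X f" and X: "\<And>n. X n \<in> L2 M" and f: "f \<in> L2 M"
    and K: "\<And>n. ip M (X n) (X n) \<le> K"
  shows "ip M f f \<le> K"
proof -
  have "2 * ip M (X n) f - ip M f f \<le> K" for n
    using ip_nonneg[of M "\<lambda>x. X n x - f x"] K[of n]
    by (simp add: ip_diff_left ip_diff_right X f L2_diff ip_commute[of M f "X n"])
  moreover have "(\<lambda>n. 2 * ip M (X n) f - ip M f f) \<longlonglongrightarrow> 2 * ip M f f - ip M f f"
    by (intro tendsto_intros L2_lim_ip assms)
  ultimately have "2 * ip M f f - ip M f f \<le> K"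
    by (intro LIMSEQ_le_const2) auto
  then show ?thesis by simp
qed

lemma (in finite_measure) L2_integrable:
  assumes "f \<in> L2 M"
  shows "integrable M f"
proof (rule Bochner_Integration.integrable_bound)
  show "integrable M (\<lambda>x. 1 + (norm (f x))\<^sup>2)" using assms by (simp add: L2_def)
  have "norm (f x) \<le> 1 + (norm (f x))\<^sup>2" for x
  proof -
    have "2 * norm (f x) \<le> 1 + (norm (f x))\<^sup>2" using sum_squares_bound[of 1 "norm (f x)"] by simp
    then show ?thesis using norm_ge_zero[of "f x"] by linarith
  qed
  then show "AE x in M. norm (f x) \<le> norm (1 + (norm (f x))\<^sup>2)" by (auto intro!: AE_I2)
qed (use assms in \<open>simp add: L2_def\<close>)

lemma (in finite_measure) L2_bounded:
  assumes "f \<in> borel_measurable M" "\<And>x. x \<in> space M \<Longrightarrow> norm (f x) \<le> C"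
  shows "f \<in> L2 M"
  by (rule L2_bound[of "\<lambda>x. 1::real" _ _ C]) (use assms in \<open>auto simp: L2_def\<close>)

lemma (in finite_measure) L2_norm_integral_le:
  assumes f: "f \<in> L2 M"
  shows "(\<integral>x. norm (f x) \<partial>M) \<le> sqrt (ip M f f) * sqrt (measure M (space M))"
proof -
  have n: "(\<lambda>x. norm (f x)) \<in> L2 M" using f by (auto simp: L2_def)
  have o: "(\<lambda>x. 1::real) \<in> L2 M" by (simp add: L2_def)
  have "ip M (\<lambda>x. norm (f x)) (\<lambda>x. 1) \<le> sqrt (ip M f f) * sqrt (measure M (space M))"
    using ip_abs_le[OF n o] by (simp add: ip_self)
  then show ?thesis by (simp add: ip_def)
qed

text \<open>Square integrability on a finite measure space controls the \<open>L\<^sup>1\<close> norm, so a sequence whose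
  consecutive distances are summable converges almost everywhere; Fatou's lemma identifies the limit.\<close>

lemma (in finite_measure) L2_complete_fast:
  fixes X :: "nat \<Rightarrow> 'a \<Rightarrow> 'b::euclidean_space"
  assumes X: "\<And>n. X n \<in> L2 M"
    and fast: "\<And>m n. n \<le> m \<Longrightarrow> ip M (\<lambda>x. X m x - X n x) (\<lambda>x. X m x - X n x) \<le> ((1/2)^n)\<^sup>2"
  shows "\<exists>f\<in>L2 M. L2_lim M X f"
proof -
  let ?s = "sqrt (measure M (space M))"
  have [measurable]: "X n \<in> borel_measurable M" for n using X by (rule L2_measurable)
  let ?D = "\<lambda>n x. norm (X (Suc n) x - X n x)"
  have int: "(\<integral>x. ?D n x \<partial>M) \<le> (1/2)^n * ?s" for n
  proof -
    have "(\<integral>x. ?D n x \<partial>M) \<le> sqrt (((1/2)^n)\<^sup>2) * ?s"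
      using L2_norm_integral_le[OF L2_diff[OF X X], of "Suc n" n]
        mult_right_mono[OF real_sqrt_le_mono[OF fast[of n "Suc n"]], of ?s] by simp
    then show ?thesis by (simp add: real_sqrt_abs)
  qed
  have Dint: "integrable M (?D n)" for n
    using L2_integrable[OF L2_diff[OF X X]] by (rule integrable_norm)
  have "(\<integral>\<^sup>+x. (\<Sum>n. ennreal (?D n x)) \<partial>M) = (\<Sum>n. \<integral>\<^sup>+x. ennreal (?D n x) \<partial>M)"
    by (rule nn_integral_suminf) measurable
  also have "\<dots> = (\<Sum>n. ennreal (\<integral>x. ?D n x \<partial>M))"
    using Dint by (simp add: nn_integral_eq_integral)
  also have "\<dots> < \<infinity>"
  proof -
    have "summable (\<lambda>n. (1/2::real)^n * ?s)"
      by (intro summable_mult2 summable_geometric) simp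
    then have "summable (\<lambda>n. \<integral>x. ?D n x \<partial>M)"
      by (rule summable_comparison_test'[of _ 0]) (use int in auto)
    then show ?thesis
      by (simp add: suminf_ennreal2)
  qed
  finally have "AE x in M. (\<Sum>n. ennreal (?D n x)) \<noteq> \<infinity>"
    by (intro nn_integral_PInf_AE) auto
  then have ae: "AE x in M. convergent (\<lambda>n. X n x)"
  proof eventually_elim
    case (elim x)
    then have "summable (\<lambda>n. ?D n x)"
      by (intro summable_suminf_not_top) auto
    then have "summable (\<lambda>n. X (Suc n) x - X n x)" by (rule summable_norm_cancel)
    then have "convergent (\<lambda>n. \<Sum>i<n. X (Suc i) x - X i x)" by (simp only: summable_iff_convergent)
    then have "convergent (\<lambda>n. X n x - X 0 x)"
      unfolding sum_lessThan_telescope[of "\<lambda>n. X n x"] .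
    then show ?case by (simp add: convergent_diff_const_right_iff)
  qed
  define f where "f x = lim (\<lambda>n. X n x)" for x
  have fm[measurable]: "f \<in> borel_measurable M"
    unfolding f_def by (rule borel_measurable_lim_metric) measurable
  have conv: "AE x in M. (\<lambda>n. X n x) \<longlonglongrightarrow> f x"
    using ae by eventually_elim (simp add: f_def convergent_LIMSEQ_iff)
  \<comment> \<open>With \<open>n\<close> fixed, Fatou's lemma in \<open>m\<close> carries the bound
    from \<open>X n - X m\<close> over to \<open>X n - f\<close>. Nonnegative integrals are used
    because square integrability of \<open>f\<close> is not yet known.\<close>
  have fatou: "(\<integral>\<^sup>+x. ennreal ((norm (X n x - f x))\<^sup>2) \<partial>M) \<le> ennreal (((1/2)^n)\<^sup>2)" for n
  proof -
    have "(\<integral>\<^sup>+x. ennreal ((norm (X n x - f x))\<^sup>2) \<partial>M)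
        = (\<integral>\<^sup>+x. liminf (\<lambda>m. ennreal ((norm (X n x - X m x))\<^sup>2)) \<partial>M)"
    proof (rule nn_integral_cong_AE)
      show "AE x in M. ennreal ((norm (X n x - f x))\<^sup>2) = liminf (\<lambda>m. ennreal ((norm (X n x - X m x))\<^sup>2))"
        using conv
      proof eventually_elim
        case (elim x)
        have "(\<lambda>m. ennreal ((norm (X n x - X m x))\<^sup>2)) \<longlonglongrightarrow> ennreal ((norm (X n x - f x))\<^sup>2)"
          by (intro tendsto_ennrealI tendsto_intros elim)
        then show ?case by (rule lim_imp_Liminf[OF trivial_limit_sequentially, symmetric])
      qed
    qed
    also have "\<dots> \<le> liminf (\<lambda>m. \<integral>\<^sup>+x. ennreal ((norm (X n x - X m x))\<^sup>2) \<partial>M)"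
      by (rule nn_integral_liminf) measurable
    also have "\<dots> \<le> ennreal (((1/2)^n)\<^sup>2)"
    proof (rule Liminf_le)
      show "\<forall>\<^sub>F m in sequentially. (\<integral>\<^sup>+x. ennreal ((norm (X n x - X m x))\<^sup>2) \<partial>M) \<le> ennreal (((1/2)^n)\<^sup>2)"
      proof (intro eventually_sequentiallyI[of n])
        fix m assume m: "n \<le> m"
        have "(\<integral>\<^sup>+x. ennreal ((norm (X n x - X m x))\<^sup>2) \<partial>M) = ennreal (\<integral>x. (norm (X n x - X m x))\<^sup>2 \<partial>M)"
          using L2_diff[OF X X] by (intro nn_integral_eq_integral) (auto simp: L2_def)
        also have "(\<integral>x. (norm (X n x - X m x))\<^sup>2 \<partial>M) \<le> ((1/2)^n)\<^sup>2"
          using fast[OF m] by (simp add: ip_self norm_minus_commute)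
        finally show "(\<integral>\<^sup>+x. ennreal ((norm (X n x - X m x))\<^sup>2) \<partial>M) \<le> ennreal (((1/2)^n)\<^sup>2)"
          by (simp add: ennreal_leI)
      qed
    qed simp
    finally show ?thesis .
  qed
  have dL2: "(\<lambda>x. X n x - f x) \<in> L2 M" for n
  proof -
    have "(\<integral>\<^sup>+x. ennreal (norm ((norm (X n x - f x))\<^sup>2)) \<partial>M) < \<infinity>"
      using le_less_trans[OF fatou[of n] ennreal_less_top] by simp
    then have "integrable M (\<lambda>x. (norm (X n x - f x))\<^sup>2)"
      by (intro integrableI_bounded) auto
    then show ?thesis by (simp add: L2_def)
  qed
  have "f \<in> L2 M" using L2_diff[OF X dL2, of 0 0] by simp
  moreover have "L2_lim M X f"
    unfolding L2_lim_def
  proof (rule Lim_null_comparison)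
    have "ip M (\<lambda>x. X n x - f x) (\<lambda>x. X n x - f x) \<le> ((1/2)^n)\<^sup>2" for n
    proof -
      have "ennreal (\<integral>x. (norm (X n x - f x))\<^sup>2 \<partial>M) \<le> ennreal (((1/2)^n)\<^sup>2)"
        using fatou[of n] dL2[of n] by (subst (asm) nn_integral_eq_integral) (auto simp: L2_def)
      then show ?thesis by (simp add: ip_self)
    qed
    then show "\<forall>\<^sub>F n in sequentially. norm (ip M (\<lambda>x. X n x - f x) (\<lambda>x. X n x - f x)) \<le> ((1/2)^n)\<^sup>2"
      by (simp add: ip_nonneg)
    have "(\<lambda>n. ((1/2::real)^n)\<^sup>2) \<longlonglongrightarrow> 0\<^sup>2"
      by (intro tendsto_intros LIMSEQ_power_zero) simp
    then show "(\<lambda>n. ((1/2::real)^n)\<^sup>2) \<longlonglongrightarrow> 0" by simp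
  qed
  ultimately show ?thesis by blast
qed

text \<open>A substitute for weak sequential compactness: approximate minimizers of the norm on the
  sets \<open>C n\<close> form a Cauchy sequence by the parallelogram law.\<close>

lemma (in finite_measure) L2_nested_convex:
  fixes C :: "nat \<Rightarrow> ('a \<Rightarrow> 'b::euclidean_space) set"
  assumes sub: "\<And>n. C n \<subseteq> L2 M" and ne: "\<And>n. C n \<noteq> {}"
    and dec: "\<And>n. C (Suc n) \<subseteq> C n"
    and mid: "\<And>n f g. f \<in> C n \<Longrightarrow> g \<in> C n \<Longrightarrow> (\<lambda>x. (1/2) *\<^sub>R (f x + g x)) \<in> C n"
    and bdd: "\<And>n f. f \<in> C n \<Longrightarrow> ip M f f \<le> K"
  shows "\<exists>X. \<exists>f\<in>L2 M. (\<forall>n. X n \<in> C n) \<and> L2_lim M X f"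
proof -
  define d where "d n = (INF f\<in>C n. ip M f f)" for n
  have bb: "bdd_below ((\<lambda>f. ip M f f) ` C n)" for n
    by (rule bdd_belowI[of _ 0]) (auto simp: ip_nonneg)
  have dle: "d n \<le> ip M f f" if "f \<in> C n" for n f
    unfolding d_def by (rule cINF_lower[OF bb that])
  have antimono: "C m \<subseteq> C n" if "n \<le> m" for m n
    using that dec by (rule lift_Suc_antimono_le[rotated])
  have dmono: "d n \<le> d m" if "n \<le> m" for m n
    unfolding d_def using that by (intro cINF_superset_mono ne bb antimono) auto
  have dK: "d n \<le> K" for n
    using ne[of n] dle bdd by (meson ex_in_conv order_trans)
  have "incseq d" using dmono by (simp add: incseq_def)
  then obtain L where "d \<longlonglongrightarrow> L" using incseq_convergent[of d K] dK by blast
  then have Cd: "Cauchy d" by (rule LIMSEQ_imp_Cauchy)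
  \<comment> \<open>The factor 1/8 is budgeted for the estimate below: the gap of the infima and the
    two approximation errors each contribute at most a quarter of \<open>(1/4)^n\<close>.\<close>
  have "\<exists>N. \<forall>n\<ge>N. \<forall>m\<ge>N. \<bar>d m - d n\<bar> < (1/4)^k/8" for k :: nat
    using Cd[unfolded Cauchy_def, rule_format, of "(1/4)^k/8"] by (auto simp: dist_real_def)
  then obtain N0 where N0: "\<And>k n m. n \<ge> N0 k \<Longrightarrow> m \<ge> N0 k \<Longrightarrow> \<bar>d m - d n\<bar> < (1/4)^k/8"
    by metis
  \<comment> \<open>The sum makes \<open>N\<close> monotone and at least \<open>N0 k\<close>; the
    summand \<open>k\<close> puts \<open>X k\<close> into \<open>C k\<close>.\<close>
  define N where "N k = k + (\<Sum>j\<le>k. N0 j)" for k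
  have NN0: "N0 k \<le> N k" and Nk: "k \<le> N k" for k
    unfolding N_def using member_le_sum[of k "{..k}" N0] by (auto intro: trans_le_add2)
  have Nmono: "N k \<le> N l" if "k \<le> l" for k l
    unfolding N_def using that by (intro add_mono sum_mono2) auto
  have "\<exists>f\<in>C (N k). ip M f f < d (N k) + (1/4)^k/8" for k :: nat
    using cINF_less_iff[OF ne bb, of "N k" "d (N k) + (1/4)^k/8"] by (simp add: d_def)
  then obtain X where XC: "\<And>k. X k \<in> C (N k)" and Xd: "\<And>k. ip M (X k) (X k) < d (N k) + (1/4)^k/8"
    by metis
  have X: "X k \<in> L2 M" for k using XC sub by blast
  have "ip M (\<lambda>x. X m x - X n x) (\<lambda>x. X m x - X n x) \<le> ((1/2)^n)\<^sup>2" if nm: "n \<le> m" for m n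
  proof -
    \<comment> \<open>Both functions lie in \<open>C (N n)\<close>, hence so does their midpoint,
      whose squared norm is therefore at least \<open>d (N n)\<close>. As both squared norms barely
      exceed the infima, the parallelogram law leaves little room for the difference.\<close>
    let ?h = "\<lambda>x. (1/2) *\<^sub>R (X m x + X n x)"
    have "?h \<in> C (N n)"
      using XC antimono[OF Nmono[OF nm]] by (intro mid) auto
    then have "d (N n) \<le> ip M ?h ?h" by (rule dle)
    also have "4 * ip M ?h ?h = 2 * ip M (X m) (X m) + 2 * ip M (X n) (X n)
        - ip M (\<lambda>x. X m x - X n x) (\<lambda>x. X m x - X n x)"
      by (simp add: ip_scaleR_left ip_scaleR_right ip_add_left ip_add_right ip_diff_left ip_diff_right
          X L2_add L2_diff ip_commute[of M "X m" "X n"])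
    finally have "ip M (\<lambda>x. X m x - X n x) (\<lambda>x. X m x - X n x)
        \<le> 2 * ip M (X m) (X m) + 2 * ip M (X n) (X n) - 4 * d (N n)" by simp
    also have "\<dots> \<le> 2 * (d (N m) - d (N n)) + (1/4)^m/4 + (1/4)^n/4"
      using Xd[of m] Xd[of n] by simp
    also have "\<dots> \<le> (1/4)^n"
    proof -
      have "\<bar>d (N m) - d (N n)\<bar> < (1/4)^n/8"
        using NN0[of n] order_trans[OF NN0[of n] Nmono[OF nm]] by (rule N0)
      moreover have "(1/4::real)^m \<le> (1/4)^n" using nm by (intro power_decreasing) auto
      moreover have "0 \<le> (1/4::real)^n" by simp
      moreover have "2 * (x - y) + q/4 + p/4 \<le> p" if "\<bar>x - y\<bar> < p/8" "q \<le> p" "0 \<le> p"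
        for x y p q :: real
        using that by argo
      ultimately show ?thesis by blast
    qed
    also have "\<dots> = ((1/2)^n)\<^sup>2"
      by (simp add: power2_eq_square flip: power_mult_distrib)
    finally show ?thesis .
  qed
  then obtain f where "f \<in> L2 M" "L2_lim M X f"
    using L2_complete_fast[of X] X by blast
  moreover have "X n \<in> C n" for n using XC antimono[OF Nk] by blast
  ultimately show ?thesis by blast
qed

section \<open>A counting bound for orthogonal families\<close>

lemma ip_sum_le:
  assumes "f \<in> L2 M" "g \<in> L2 M"
  shows "ip M (\<lambda>x. f x + g x) (\<lambda>x. f x + g x) \<le> 2 * ip M f f + 2 * ip M g g"
proof -
  have "ip M (\<lambda>x. f x + g x) (\<lambda>x. f x + g x) + ip M (\<lambda>x. f x - g x) (\<lambda>x. f x - g x)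
      = 2 * ip M f f + 2 * ip M g g"
    using assms by (simp add: ip_add_left ip_add_right ip_diff_left ip_diff_right L2_add L2_diff)
  then show ?thesis using ip_nonneg[of M "\<lambda>x. f x - g x"] by linarith
qed

text \<open>Apply Cauchy-Schwarz to the sum of the family and \<open>z\<close>: the pairing equals
  the cardinality, while by orthogonality the squared norm of the sum is at most the cardinality
  times \<open>K\<close>. One factor of the cardinality cancels.\<close>

lemma orthogonal_card_le:
  assumes I: "finite I" and y: "\<And>i. i \<in> I \<Longrightarrow> y i \<in> L2 M" and z: "z \<in> L2 M"
    and orth: "\<And>i j. i \<in> I \<Longrightarrow> j \<in> I \<Longrightarrow> i \<noteq> j \<Longrightarrow> ip M (y i) (y j) = 0"
    and K: "0 \<le> K" "\<And>i. i \<in> I \<Longrightarrow> ip M (y i) (y i) \<le> K" and pair: "\<And>i. i \<in> I \<Longrightarrow> ip M (y i) z = 1"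
  shows "real (card I) \<le> K * ip M z z"
proof -
  define s where "s x = (\<Sum>i\<in>I. y i x)" for x
  have s: "s \<in> L2 M" unfolding s_def using y by (rule L2_sum)
  have sz: "ip M s z = real (card I)"
    unfolding s_def using y z pair by (simp add: ip_sum_left)
  have "ip M s s = (\<Sum>i\<in>I. ip M (y i) s)"
    unfolding s_def using y s[unfolded s_def] by (rule ip_sum_left)
  also have "\<dots> = (\<Sum>i\<in>I. ip M (y i) (y i))"
  proof (rule sum.cong[OF refl])
    fix i assume i: "i \<in> I"
    have "ip M (y i) s = (\<Sum>j\<in>I. ip M (y i) (y j))"
      unfolding s_def by (rule ip_sum_right) (use y i in auto)
    also have "\<dots> = (\<Sum>j\<in>I. if j = i then ip M (y i) (y i) else 0)"
      using orth i by (intro sum.cong) auto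
    finally show "ip M (y i) s = ip M (y i) (y i)" using I i by simp
  qed
  also have "\<dots> \<le> real (card I) * K" using sum_bounded_above[of I "\<lambda>i. ip M (y i) (y i)" K] K by simp
  finally have ss: "ip M s s \<le> real (card I) * K" .
  have "(real (card I))\<^sup>2 \<le> ip M s s * ip M z z"
    using ip_Cauchy_Schwarz[OF s z] sz by simp
  also have "\<dots> \<le> real (card I) * K * ip M z z" by (rule mult_right_mono[OF ss ip_nonneg])
  finally have *: "real (card I) * real (card I) \<le> real (card I) * (K * ip M z z)"
    by (simp add: power2_eq_square mult.assoc)
  show ?thesis
  proof (cases "I = {}")
    case True
    then show ?thesis using ip_nonneg[of M z] K(1) by simp
  next
    case False
    then have "0 < real (card I)" using I by (simp add: card_gt_0_iff)
    then show ?thesis using * by simp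
  qed
qed

subsection \<open>A countable family of sets separating integrable functions\<close>

text \<open>The set where \<open>v\<close> is positive is only Lebesgue measurable. Replacing it by
  a Borel set that differs by a null set shows that the positive part of \<open>v\<close> has
  integral zero.\<close>

lemma AE_nonpos_of_borel_integrals:
  fixes v :: "'a::euclidean_space \<Rightarrow> real"
  assumes v: "integrable lebesgue v"
    and zero: "\<And>A. A \<in> sets borel \<Longrightarrow> (LINT x:A|lebesgue. v x) = 0"
  shows "AE x in lebesgue. v x \<le> 0"
proof -
  have vm: "v \<in> borel_measurable lebesgue" using v by (rule borel_measurable_integrable)
  define A where "A = {x. 0 < v x}"
  have A: "A \<in> sets lebesgue"
    using borel_measurable_less[OF borel_measurable_const vm, of 0] by (simp add: A_def)
  obtain S N N' where S: "A = S \<union> N" "N \<subseteq> N'" "N' \<in> null_sets lborel" "S \<in> sets lborel"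
    using A by (rule sets_completionE)
  have SL: "S \<in> sets lebesgue" using S(4) by (rule sets_completionI_sets)
  have "N' \<in> null_sets lebesgue" using S(3) by (rule null_sets_completionI)
  then have "AE x in lebesgue. x \<notin> N'" by (rule AE_not_in)
  then have "AE x in lebesgue. indicator A x *\<^sub>R v x = indicator S x *\<^sub>R v x"
    by eventually_elim (use S(1,2) in \<open>auto simp: indicator_def\<close>)
  then have "(\<integral>x. indicator A x *\<^sub>R v x \<partial>lebesgue) = (\<integral>x. indicator S x *\<^sub>R v x \<partial>lebesgue)"
    using vm A SL by (intro integral_cong_AE) (auto intro!: borel_measurable_scaleR borel_measurable_indicator)
  also have "\<dots> = 0" using zero[of S] S(4) by (simp add: set_lebesgue_integral_def)
  finally have 0: "(\<integral>x. indicator A x *\<^sub>R v x \<partial>lebesgue) = 0" .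
  have int: "integrable lebesgue (\<lambda>x. indicator A x *\<^sub>R v x)"
    using integrable_mult_indicator[OF A v] .
  have nn: "AE x in lebesgue. 0 \<le> indicator A x *\<^sub>R v x"
    by (rule AE_I2) (auto simp: A_def indicator_def)
  have "AE x in lebesgue. indicator A x *\<^sub>R v x = 0"
    using integral_nonneg_eq_0_iff_AE[OF int nn] 0 by blast
  then show ?thesis
    by eventually_elim (auto simp: A_def indicator_def split: if_splits)
qed

text \<open>The sets over which \<open>v\<close> integrates to zero form a Dynkin system:
  \<open>UNIV \<in> \<B>\<close> makes the total integral vanish, which handles complements, and
  countable additivity handles disjoint unions. Stability of the generator under intersections then
  extends the hypothesis to all Borel sets.\<close>

lemma AE_zero_of_generator_integrals:
  fixes v :: "'a::euclidean_space \<Rightarrow> real"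
  assumes v: "integrable lebesgue v" and B: "Int_stable \<B>" "UNIV \<in> \<B>" "sets borel = sigma_sets UNIV \<B>"
    and zero: "\<And>A. A \<in> \<B> \<Longrightarrow> (LINT x:A|lebesgue. v x) = 0"
  shows "AE x in lebesgue. v x = 0"
proof -
  have L: "A \<in> sets lebesgue" if "A \<in> sigma_sets UNIV \<B>" for A
    using that B(3) by (metis sets_completionI_sets sets_lborel)
  have si: "set_integrable lebesgue A v" if "A \<in> sigma_sets UNIV \<B>" for A
    unfolding set_integrable_def by (rule integrable_mult_indicator[OF L[OF that] v])
  have total: "(LINT x|lebesgue. v x) = 0"
    using zero[OF B(2)] by (simp add: set_lebesgue_integral_def)
  have borel0: "(LINT x:A|lebesgue. v x) = 0" if "A \<in> sets borel" for A
  proof -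
    have A: "A \<in> sigma_sets UNIV \<B>" using that B(3) by simp
    have sub: "\<B> \<subseteq> Pow UNIV" by simp
    from B(1) sub A show ?thesis
    proof (induct A rule: sigma_sets_induct_disjoint)
      case (basic A)
      then show ?case by (rule zero)
    next
      case empty
      show ?case by (simp add: set_lebesgue_integral_def)
    next
      case (compl A)
      have "UNIV - A \<in> sigma_sets UNIV \<B>" using compl.hyps(1) by (rule sigma_sets.Compl)
      then have "set_integrable lebesgue (UNIV - A) v" "set_integrable lebesgue A v"
        using compl.hyps(1) by (auto intro: si)
      then have "(LINT x:A \<union> (UNIV - A)|lebesgue. v x) = (LINT x:A|lebesgue. v x) + (LINT x:UNIV - A|lebesgue. v x)"
        by (intro set_integral_Un) auto
      then show ?case using compl.hyps(2) total by (simp add: set_lebesgue_integral_def)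
    next
      case (union A)
      have "(\<Union>i. A i) \<in> sigma_sets UNIV \<B>" using union.hyps(1,2) by (intro sigma_sets.Union) auto
      then have "(LINT x:(\<Union>i. A i)|lebesgue. v x) = (\<Sum>i. (LINT x:(A i)|lebesgue. v x))"
        using union.hyps(1,2) by (intro lebesgue_integral_countable_add si L) (auto simp: disjoint_family_on_def)
      then show ?case using union.hyps(3) by simp
    qed
  qed
  have "AE x in lebesgue. v x \<le> 0"
    using v borel0 by (rule AE_nonpos_of_borel_integrals)
  moreover have "AE x in lebesgue. - v x \<le> 0"
    using v borel0
    by (intro AE_nonpos_of_borel_integrals) (auto simp: set_lebesgue_integral_def)
  ultimately show ?thesis by eventually_elim simp
qed

text \<open>Closing a countable basis under finite intersections keeps it countable and provides the
  stability that the Dynkin argument requires.\<close>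

lemma countable_generator_exists:
  "\<exists>\<B> :: 'a::second_countable_topology set set. countable \<B> \<and> Int_stable \<B> \<and> UNIV \<in> \<B> \<and> sets borel = sigma_sets UNIV \<B>"
proof -
  obtain B :: "'a set set" where B: "countable B" "topological_basis B"
    using ex_countable_basis by blast
  define \<B> where "\<B> = Inter ` {F. F \<subseteq> B \<and> finite F}"
  have "countable \<B>"
    unfolding \<B>_def using countable_Collect_finite_subset[OF B(1)] by (simp add: conj_commute)
  moreover have "Int_stable \<B>"
  proof (rule Int_stableI)
    fix a b assume "a \<in> \<B>" "b \<in> \<B>"
    then obtain F G where "F \<subseteq> B" "finite F" "a = \<Inter>F" "G \<subseteq> B" "finite G" "b = \<Inter>G"
      unfolding \<B>_def by auto
    then have "F \<union> G \<subseteq> B" "finite (F \<union> G)" "a \<inter> b = \<Inter>(F \<union> G)" by auto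
    then show "a \<inter> b \<in> \<B>" unfolding \<B>_def by blast
  qed
  \<comment> \<open>The empty family of basis sets has intersection \<open>UNIV\<close>.\<close>
  moreover have "UNIV \<in> \<B>" unfolding \<B>_def by (rule image_eqI[of _ _ "{}"]) auto
  moreover have "sets borel = sigma_sets UNIV \<B>"
  proof
    have "sets borel = sigma_sets UNIV B"
      unfolding borel_eq_countable_basis[OF B] by (rule sets_measure_of) simp
    also have "B \<subseteq> \<B>"
    proof
      fix b assume "b \<in> B"
      then show "b \<in> \<B>" unfolding \<B>_def by (intro image_eqI[of _ _ "{b}"]) auto
    qed
    then have "sigma_sets UNIV B \<subseteq> sigma_sets UNIV \<B>" by (rule sigma_sets_mono')
    finally show "sets borel \<subseteq> sigma_sets UNIV \<B>" .
    have "\<B> \<subseteq> sets borel"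
    proof
      fix a assume "a \<in> \<B>"
      then obtain F where F: "F \<subseteq> B" "finite F" "a = \<Inter>F" unfolding \<B>_def by blast
      have "open a" unfolding F(3) using F(1,2) topological_basis_open[OF B(2)] by (intro open_Inter) auto
      then show "a \<in> sets borel" by (rule borel_open)
    qed
    then show "sigma_sets UNIV \<B> \<subseteq> sets borel"
      using sets.sigma_sets_subset[of \<B> borel] by simp
  qed
  ultimately show ?thesis by blast
qed

section \<open>Smooth functions and metrics\<close>

lemma partial_deriv_eq:
  "(f has_derivative f') (at x) \<Longrightarrow> partial_deriv i f x = f' (axis i 1)"
  unfolding partial_deriv_def using frechet_derivative_at by metis

text \<open>\<open>frechet_derivative\<close> is a choice among the derivatives. The two functions
  have the same ones, so the choices coincide even where neither function is differentiable.\<close>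

lemma frechet_derivative_cong_open:
  assumes "open S" "x \<in> S" "\<And>y. y \<in> S \<Longrightarrow> f y = g y"
  shows "frechet_derivative f (at x) = frechet_derivative g (at x)"
proof -
  have "(f has_derivative D) (at x) \<longleftrightarrow> (g has_derivative D) (at x)" for D
    using assms has_derivative_transform_within_open[of f D x UNIV S g]
      has_derivative_transform_within_open[of g D x UNIV S f] by auto
  then show ?thesis by (simp add: frechet_derivative_def)
qed

lemma partial_derivs_cong_open:
  assumes "open S" "\<And>y. y \<in> S \<Longrightarrow> f y = g y" "x \<in> S"
  shows "partial_derivs is f x = partial_derivs is g x"
  using assms(3)
proof (induction "is" arbitrary: x)
  case (Cons i "is")
  then show ?case
    using frechet_derivative_cong_open[OF assms(1), of x "partial_derivs is f" "partial_derivs is g"]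
    by (simp add: partial_deriv_def)
qed (simp add: assms)

lemma partial_derivs_append: "partial_derivs (is @ js) f = partial_derivs is (partial_derivs js f)"
  by (induction "is") auto

lemma smooth_on_partial_derivs: "smooth_on S f \<Longrightarrow> smooth_on S (partial_derivs is f)"
  unfolding smooth_on_def by (metis partial_derivs_append)

lemma smooth_on_partial_deriv: "smooth_on S f \<Longrightarrow> smooth_on S (partial_deriv i f)"
  using smooth_on_partial_derivs[of S f "[i]"] by simp

lemma smooth_on_differentiable: "smooth_on S f \<Longrightarrow> open S \<Longrightarrow> x \<in> S \<Longrightarrow> f differentiable (at x)"
  unfolding smooth_on_def
  by (metis partial_derivs.simps(1) differentiable_on_eq_differentiable_at)

lemma smooth_on_continuous: "smooth_on S f \<Longrightarrow> continuous_on S f"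
  unfolding smooth_on_def by (metis partial_derivs.simps(1) differentiable_imp_continuous_on)

lemma smooth_on_subset: "smooth_on S f \<Longrightarrow> T \<subseteq> S \<Longrightarrow> smooth_on T f"
  unfolding smooth_on_def by (meson differentiable_on_subset)

lemma smooth_on_cong:
  assumes "open S" "\<And>x. x \<in> S \<Longrightarrow> f x = g x" "smooth_on S g"
  shows "smooth_on S f"
  unfolding smooth_on_def
proof
  fix "is"
  have "partial_derivs is g differentiable_on S" using assms(3) by (simp add: smooth_on_def)
  moreover have "partial_derivs is f x = partial_derivs is g x" if "x \<in> S" for x
    using partial_derivs_cong_open[of S f g x "is"] assms(1,2) that by blast
  ultimately show "partial_derivs is f differentiable_on S"
    unfolding differentiable_on_def by (metis differentiable_transform_within zero_less_one)
qed

lemma smooth_on_Un: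
  assumes "smooth_on S f" "smooth_on T f" "open S" "open T"
  shows "smooth_on (S \<union> T) f"
  using assms unfolding smooth_on_def
  by (simp add: differentiable_on_eq_differentiable_at open_Un) blast

text \<open>The product rule turns one product into a sum of two, so natural classes of products are
  stable under differentiation only up to finite sums.\<close>

inductive_set sum_closure :: "('a \<Rightarrow> 'b::real_normed_vector) set \<Rightarrow> ('a \<Rightarrow> 'b) set" for G where
  base: "f \<in> G \<Longrightarrow> f \<in> sum_closure G"
| add: "f \<in> sum_closure G \<Longrightarrow> g \<in> sum_closure G \<Longrightarrow> (\<lambda>x. f x + g x) \<in> sum_closure G"

text \<open>Coinduction principle for smoothness: it suffices to exhibit a class of differentiable
  functions that is stable under partial derivatives up to finite sums.\<close>

lemma smooth_on_sum_closure:
  fixes G :: "(real^'n \<Rightarrow> 'b::real_normed_vector) set"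
  assumes S: "open S" and diff: "\<And>f x. f \<in> G \<Longrightarrow> x \<in> S \<Longrightarrow> f differentiable (at x)"
    and step: "\<And>f i. f \<in> G \<Longrightarrow> \<exists>g\<in>sum_closure G. \<forall>x\<in>S. partial_deriv i f x = g x"
    and f: "f \<in> sum_closure G"
  shows "smooth_on S f"
proof -
  have diff': "h differentiable (at x)" if "h \<in> sum_closure G" "x \<in> S" for h x
    using that by (induction rule: sum_closure.induct) (auto intro: diff)
  have step': "\<exists>g\<in>sum_closure G. \<forall>x\<in>S. partial_deriv i h x = g x" if "h \<in> sum_closure G" for h i
    using that
  proof (induction rule: sum_closure.induct)
    case (base h)
    then show ?case by (rule step)
  next
    case (add p q)
    obtain p' q' where "p' \<in> sum_closure G" "q' \<in> sum_closure G"
      and pq: "\<forall>x\<in>S. partial_deriv i p x = p' x" "\<forall>x\<in>S. partial_deriv i q x = q' x"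
      using add by blast
    moreover have "partial_deriv i (\<lambda>x. p x + q x) x = p' x + q' x" if x: "x \<in> S" for x
    proof -
      obtain dp dq where d: "(p has_derivative dp) (at x)" "(q has_derivative dq) (at x)"
        using diff'[OF add.hyps(1) x] diff'[OF add.hyps(2) x] by (auto simp: differentiable_def)
      then show ?thesis
        using pq x partial_deriv_eq[OF has_derivative_add[OF d], of i] d[THEN partial_deriv_eq, of i] by simp
    qed
    ultimately show ?case
      by (intro bexI[of _ "\<lambda>x. p' x + q' x"]) (auto intro: sum_closure.add)
  qed
  have *: "\<exists>g\<in>sum_closure G. \<forall>x\<in>S. partial_derivs is f x = g x" for "is"
  proof (induction "is")
    case Nil
    then show ?case using f by auto
  next
    case (Cons i "is")
    then obtain g where g: "g \<in> sum_closure G" "\<forall>x\<in>S. partial_derivs is f x = g x" by blast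
    have "partial_derivs (i # is) f x = partial_deriv i g x" if "x \<in> S" for x
      using partial_derivs_cong_open[of S "partial_derivs is f" g x "[i]"] S g that by simp
    then show ?case using step'[OF g(1), of i] by auto
  qed
  show ?thesis
    unfolding smooth_on_def differentiable_on_def
  proof (intro allI ballI)
    fix "is" x assume x: "x \<in> S"
    obtain g where g: "g \<in> sum_closure G" "\<forall>x\<in>S. partial_derivs is f x = g x" using * by blast
    have "g differentiable (at x within S)"
      using diff'[OF g(1) x] by (rule differentiable_at_withinI)
    then show "partial_derivs is f differentiable (at x within S)"
      by (rule differentiable_transform_within[OF _ zero_less_one x]) (use g in auto)
  qed
qed

lemma smooth_on_const:
  fixes S :: "(real^'n) set" and c :: "'b::real_normed_vector"
  assumes S: "open S"
  shows "smooth_on S (\<lambda>x. c)"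
proof (rule smooth_on_sum_closure[OF S, where G = "range (\<lambda>c x. c)"])
  fix f :: "real^'n \<Rightarrow> 'b" and i
  assume "f \<in> range (\<lambda>c x. c)"
  then obtain c where f: "f = (\<lambda>x. c)" by blast
  have "partial_deriv i f x = 0" for x
    unfolding f using partial_deriv_eq[OF has_derivative_const] .
  then show "\<exists>g\<in>sum_closure (range (\<lambda>c x. c)). \<forall>x\<in>S. partial_deriv i f x = g x"
    by (intro bexI[of _ "\<lambda>x. 0"]) (auto intro: sum_closure.base)
qed (auto intro: sum_closure.base)

lemma smooth_on_add:
  fixes f g :: "real^'n \<Rightarrow> 'b::real_normed_vector"
  assumes S: "open S" and f: "smooth_on S f" and g: "smooth_on S g"
  shows "smooth_on S (\<lambda>x. f x + g x)"
proof (rule smooth_on_sum_closure[OF S, where G = "{f. smooth_on S f}"])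
  fix f :: "real^'n \<Rightarrow> 'b" and i
  assume "f \<in> {f. smooth_on S f}"
  then show "\<exists>g\<in>sum_closure {f. smooth_on S f}. \<forall>x\<in>S. partial_deriv i f x = g x"
    by (intro bexI[of _ "partial_deriv i f"]) (auto intro: sum_closure.base smooth_on_partial_deriv)
qed (use assms in \<open>auto intro: sum_closure.intros smooth_on_differentiable\<close>)

lemma smooth_on_bounded_linear:
  fixes T :: "real^'n \<Rightarrow> 'b::real_normed_vector"
  assumes S: "open S" and T: "bounded_linear T"
  shows "smooth_on S T"
proof -
  let ?G = "insert T (range (\<lambda>c x. c))"
  show ?thesis
  proof (rule smooth_on_sum_closure[OF S, where G = ?G])
    fix f :: "real^'n \<Rightarrow> 'b" and x assume "f \<in> ?G"
    then show "f differentiable (at x)"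
      using bounded_linear_imp_differentiable[OF T] by auto
  next
    fix f :: "real^'n \<Rightarrow> 'b" and i
    assume "f \<in> ?G"
    then obtain d where "\<forall>x. partial_deriv i f x = d"
      using partial_deriv_eq[OF bounded_linear_imp_has_derivative[OF T]]
        partial_deriv_eq[OF has_derivative_const] by blast
    then show "\<exists>g\<in>sum_closure ?G. \<forall>x\<in>S. partial_deriv i f x = g x"
      by (intro bexI[of _ "\<lambda>x. d"]) (auto intro: sum_closure.base)
  qed (auto intro: sum_closure.base)
qed

lemma partial_deriv_bounded_linear:
  assumes "f differentiable (at x)" "bounded_linear T"
  shows "partial_deriv i (\<lambda>x. T (f x)) x = T (partial_deriv i f x)"
proof -
  obtain f' where d: "(f has_derivative f') (at x)"
    using assms by (auto simp: differentiable_def)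
  show ?thesis
    using partial_deriv_eq[OF bounded_linear.has_derivative[OF assms(2) d], of i] partial_deriv_eq[OF d, of i]
    by simp
qed

lemma smooth_on_bounded_linear_compose:
  assumes S: "open S" and f: "smooth_on S f" and T: "bounded_linear T"
  shows "smooth_on S (\<lambda>x. T (f x))"
proof -
  let ?G = "{\<lambda>x. T (f x) | f. smooth_on S f}"
  show ?thesis
  proof (rule smooth_on_sum_closure[OF S, where G = ?G])
    fix h x assume "h \<in> ?G" "x \<in> S"
    then obtain f where h: "h = (\<lambda>x. T (f x))" "f differentiable (at x)"
      using smooth_on_differentiable S by blast
    then show "h differentiable (at x)"
      unfolding differentiable_def using bounded_linear.has_derivative[OF T] by blast
  next
    fix h i assume "h \<in> ?G"
    then obtain f where h: "h = (\<lambda>x. T (f x))" "smooth_on S f" by blast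
    then show "\<exists>g\<in>sum_closure ?G. \<forall>x\<in>S. partial_deriv i h x = g x"
      using partial_deriv_bounded_linear[OF smooth_on_differentiable[OF h(2) S] T] smooth_on_partial_deriv
      by (intro bexI[of _ "\<lambda>x. T (partial_deriv i f x)"]) (auto intro!: sum_closure.base exI[of _ "partial_deriv i f"])
  qed (use f in \<open>auto intro: sum_closure.base\<close>)
qed

lemma partial_derivs_bounded_linear:
  assumes S: "open S" and f: "smooth_on S f" and T: "bounded_linear T" and x: "x \<in> S"
  shows "partial_derivs is (\<lambda>x. T (f x)) x = T (partial_derivs is f x)"
  using x
proof (induction "is" arbitrary: x)
  case (Cons i "is")
  have "partial_derivs (i # is) (\<lambda>x. T (f x)) x = partial_deriv i (\<lambda>x. T (partial_derivs is f x)) x"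
    using partial_derivs_cong_open[of S _ _ x "[i]", OF S Cons.IH] Cons.prems by simp
  then show ?case
    using partial_deriv_bounded_linear[OF smooth_on_differentiable[OF smooth_on_partial_derivs[OF f] S Cons.prems] T]
    by simp
qed simp

lemma partial_deriv_mult:
  fixes f g :: "real^'n \<Rightarrow> real"
  assumes "f differentiable (at x)" "g differentiable (at x)"
  shows "partial_deriv i (\<lambda>x. f x * g x) x = f x * partial_deriv i g x + partial_deriv i f x * g x"
proof -
  obtain f' g' where d: "(f has_derivative f') (at x)" "(g has_derivative g') (at x)"
    using assms by (auto simp: differentiable_def)
  show ?thesis
    using partial_deriv_eq[OF has_derivative_mult[OF d], of i] d[THEN partial_deriv_eq, of i] by simp
qed

lemma smooth_on_mult:
  fixes f g :: "real^'n \<Rightarrow> real"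
  assumes S: "open S" and f: "smooth_on S f" and g: "smooth_on S g"
  shows "smooth_on S (\<lambda>x. f x * g x)"
proof -
  let ?G = "{\<lambda>x. p x * q x | p q. smooth_on S p \<and> smooth_on S q}"
  show ?thesis
  proof (rule smooth_on_sum_closure[OF S, where G = ?G])
    fix h :: "real^'n \<Rightarrow> real" and x assume "h \<in> ?G" "x \<in> S"
    then show "h differentiable (at x)"
      using smooth_on_differentiable S by (auto intro!: differentiable_mult)
  next
    fix h :: "real^'n \<Rightarrow> real" and i assume "h \<in> ?G"
    then obtain p q where h: "h = (\<lambda>x. p x * q x)" "smooth_on S p" "smooth_on S q" by blast
    show "\<exists>g\<in>sum_closure ?G. \<forall>x\<in>S. partial_deriv i h x = g x"
    proof
      show "(\<lambda>x. p x * partial_deriv i q x + partial_deriv i p x * q x) \<in> sum_closure ?G"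
        using h by (intro sum_closure.add sum_closure.base) (auto intro: smooth_on_partial_deriv)
    qed (use h partial_deriv_mult smooth_on_differentiable[OF _ S] in blast)
  qed (use f g in \<open>auto intro: sum_closure.base\<close>)
qed

text \<open>Each derivative of the power lowers its exponent by one, so the class used for the
  coinduction admits all real exponents and all smooth prefactors at once.\<close>

lemma smooth_on_mult_powr:
  fixes f d :: "real^'n \<Rightarrow> real"
  assumes S: "open S" and f: "smooth_on S f" and d: "smooth_on S d" and pos: "\<And>x. x \<in> S \<Longrightarrow> 0 < d x"
  shows "smooth_on S (\<lambda>x. f x * d x powr a)"
proof -
  let ?G = "{\<lambda>x. p x * d x powr b | p b. smooth_on S p}"
  have G: "(\<lambda>x. p x * d x powr b) \<in> sum_closure ?G" if "smooth_on S p" for p b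
    using that by (intro sum_closure.base) blast
  have dp: "((\<lambda>x. d x powr b) has_derivative (\<lambda>h. d' h * (b * d x powr (b - 1)))) (at x)"
    if "x \<in> S" "(d has_derivative d') (at x)" for b x d'
    using has_derivative_compose[OF that(2), of "\<lambda>y. y powr b" "\<lambda>y. y * (b * d x powr (b - 1))"]
      has_real_derivative_powr[OF pos[OF that(1)], of b]
    by (simp add: has_field_derivative_def mult.commute[of _ "b * d x powr (b - 1)"])
  have ddiff: "(\<lambda>x. d x powr b) differentiable (at x)" if "x \<in> S" for b x
    using dp[OF that] smooth_on_differentiable[OF d S that] unfolding differentiable_def by blast
  have pdp: "partial_deriv i (\<lambda>x. d x powr b) x = partial_deriv i d x * (b * d x powr (b - 1))"
    if x: "x \<in> S" for b x i
  proof -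
    obtain d' where d': "(d has_derivative d') (at x)"
      using smooth_on_differentiable[OF d S x] by (auto simp: differentiable_def)
    show ?thesis
      using partial_deriv_eq[OF dp[OF x d'], of i] partial_deriv_eq[OF d', of i] by simp
  qed
  show ?thesis
  proof (rule smooth_on_sum_closure[OF S, where G = ?G])
    fix h :: "real^'n \<Rightarrow> real" and x assume "h \<in> ?G" "x \<in> S"
    then show "h differentiable (at x)"
      using smooth_on_differentiable S ddiff by (auto intro!: differentiable_mult)
  next
    fix h :: "real^'n \<Rightarrow> real" and i assume "h \<in> ?G"
    then obtain p b where h: "h = (\<lambda>x. p x * d x powr b)" "smooth_on S p" by blast
    show "\<exists>g\<in>sum_closure ?G. \<forall>x\<in>S. partial_deriv i h x = g x"
    proof
      have "smooth_on S (\<lambda>x. p x * (partial_deriv i d x * b))"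
        using h(2) S d by (intro smooth_on_mult smooth_on_partial_deriv smooth_on_const) auto
      then show "(\<lambda>x. (p x * (partial_deriv i d x * b)) * d x powr (b - 1)
          + partial_deriv i p x * d x powr b) \<in> sum_closure ?G"
        using smooth_on_partial_deriv[OF h(2)] by (intro sum_closure.add G)
      show "\<forall>x\<in>S. partial_deriv i h x = (p x * (partial_deriv i d x * b)) * d x powr (b - 1)
          + partial_deriv i p x * d x powr b"
        unfolding h(1)
        using partial_deriv_mult[OF smooth_on_differentiable[OF h(2) S] ddiff] pdp by simp
    qed
  qed (use f in \<open>auto intro: sum_closure.base\<close>)
qed

subsection \<open>Test functions\<close>

lemma test_functions_outside:
  assumes "\<phi> \<in> test_functions \<Omega>" "x \<notin> closure {x. \<phi> x \<noteq> 0}"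
  shows "partial_derivs is \<phi> x = 0"
proof -
  have "partial_derivs is \<phi> x = partial_derivs is (\<lambda>x. 0) x"
    using assms closure_subset[of "{x. \<phi> x \<noteq> 0}"]
    by (intro partial_derivs_cong_open[of "- closure {x. \<phi> x \<noteq> 0}"]) auto
  also have "partial_derivs is (\<lambda>x. 0::real) = (\<lambda>x. 0)"
  proof (induction "is")
    case (Cons i "is")
    then show ?case using partial_deriv_eq[OF has_derivative_const] by auto
  qed simp
  finally show ?thesis by simp
qed

lemma test_functionsI:
  assumes "smooth_on UNIV \<psi>" and \<phi>: "\<phi> \<in> test_functions \<Omega>" 
    and 0: "\<And>x. x \<notin> closure {x. \<phi> x \<noteq> 0} \<Longrightarrow> \<psi> x = 0"
  shows "\<psi> \<in> test_functions \<Omega>"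
proof -
  let ?K = "closure {x. \<phi> x \<noteq> 0}"
  have K: "compact ?K" "?K \<subseteq> \<Omega>" using \<phi> by (auto simp: test_functions_def)
  have "closure {x. \<psi> x \<noteq> 0} \<subseteq> ?K"
    using 0 by (intro closure_minimal) auto
  then show ?thesis
    using K assms(1) closed_Int_compact[OF closed_closure K(1), of "{x. \<psi> x \<noteq> 0}"]
    by (auto simp: test_functions_def Int_absorb2)
qed

lemma test_functions_partial_deriv:
  assumes "\<phi> \<in> test_functions \<Omega>"
  shows "partial_deriv i \<phi> \<in> test_functions \<Omega>"
  using test_functions_outside[OF assms, of _ "[i]"] assms
  by (intro test_functionsI[OF _ assms]) (auto simp: test_functions_def smooth_on_partial_deriv)

text \<open>The factor \<open>a\<close> may be arbitrary outside the domain. The domain and the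
  complement of the support of \<open>\<phi>\<close> are two open sets covering the space; the
  product is smooth on the first and identically zero on the second.\<close>

lemma test_functions_mult:
  assumes \<Omega>: "open \<Omega>" and \<phi>: "\<phi> \<in> test_functions \<Omega>" and a: "smooth_on \<Omega> a"
  shows "(\<lambda>x. a x * \<phi> x) \<in> test_functions \<Omega>"
proof -
  define K where "K = closure {x. \<phi> x \<noteq> 0}"
  have 0: "\<phi> x = 0" if "x \<notin> K" for x
    using test_functions_outside[OF \<phi>, of x "[]"] that by (simp add: K_def)
  have K: "K \<subseteq> \<Omega>" "closed K" using \<phi> by (auto simp: test_functions_def K_def)
  have "smooth_on (\<Omega> \<union> - K) (\<lambda>x. a x * \<phi> x)"
  proof (rule smooth_on_Un)
    show "smooth_on \<Omega> (\<lambda>x. a x * \<phi> x)"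
      using \<phi> by (intro smooth_on_mult \<Omega> a) (auto simp: test_functions_def intro: smooth_on_subset)
    show "smooth_on (- K) (\<lambda>x. a x * \<phi> x)"
      by (rule smooth_on_cong[OF _ _ smooth_on_const[of _ 0]]) (use K 0 in auto)
  qed (use K \<Omega> in auto)
  moreover have "\<Omega> \<union> - K = UNIV" using K by auto
  ultimately have "smooth_on UNIV (\<lambda>x. a x * \<phi> x)" by simp
  then show ?thesis
  proof (rule test_functionsI[OF _ \<phi>])
    fix x assume "x \<notin> closure {x. \<phi> x \<noteq> 0}"
    then have "\<phi> x = 0" by (intro 0) (simp only: K_def not_False_eq_True)
    then show "a x * \<phi> x = 0" by simp
  qed
qed

lemma test_functions_zero: "(\<lambda>x. 0) \<in> test_functions \<Omega>"
  by (simp add: test_functions_def smooth_on_const)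

lemma test_functions_add:
  assumes "\<phi> \<in> test_functions \<Omega>" "\<psi> \<in> test_functions \<Omega>"
  shows "(\<lambda>x. \<phi> x + \<psi> x) \<in> test_functions \<Omega>"
proof -
  have c: "compact (closure {x. \<phi> x \<noteq> 0} \<union> closure {x. \<psi> x \<noteq> 0})"
    using assms by (auto simp: test_functions_def)
  have sub: "closure {x. \<phi> x + \<psi> x \<noteq> 0} \<subseteq> closure {x. \<phi> x \<noteq> 0} \<union> closure {x. \<psi> x \<noteq> 0}"
    unfolding closure_Un[symmetric] by (intro closure_mono) auto
  have "compact (closure {x. \<phi> x + \<psi> x \<noteq> 0})"
    using closed_Int_compact[OF closed_closure c, of "{x. \<phi> x + \<psi> x \<noteq> 0}"] sub
    by (simp add: Int_absorb2)
  then show ?thesis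
    using assms sub unfolding test_functions_def
    by (auto intro!: smooth_on_add)
qed

lemma test_functions_sum:
  "(\<And>j. j \<in> J \<Longrightarrow> f j \<in> test_functions \<Omega>) \<Longrightarrow> (\<lambda>x. \<Sum>j\<in>J. f j x) \<in> test_functions \<Omega>"
  by (induction J rule: infinite_finite_induct) (auto simp: test_functions_zero intro!: test_functions_add)

lemma test_functions_scale: "\<phi> \<in> test_functions \<Omega> \<Longrightarrow> (\<lambda>x. c * \<phi> x) \<in> test_functions \<Omega>" for c :: real
  by (rule test_functionsI[of _ \<phi>])
    (auto simp: test_functions_def intro!: smooth_on_mult smooth_on_const dest: contra_subsetD[OF closure_subset])

lemma test_functions_continuous: "\<phi> \<in> test_functions \<Omega> \<Longrightarrow> continuous_on UNIV \<phi>"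
  by (simp add: test_functions_def smooth_on_continuous)

lemma test_functions_bounded:
  assumes \<phi>: "\<phi> \<in> test_functions \<Omega>"
  shows "\<exists>B. \<forall>x. \<bar>\<phi> x\<bar> \<le> B"
proof -
  define K where "K = closure {x. \<phi> x \<noteq> 0}"
  have "bounded (\<phi> ` K)"
    using \<phi> test_functions_continuous[OF \<phi>]
    by (auto intro!: compact_imp_bounded compact_continuous_image continuous_on_subset[of UNIV]
        simp: test_functions_def K_def)
  then obtain B where B: "\<forall>x\<in>K. \<bar>\<phi> x\<bar> \<le> B" by (auto simp: bounded_iff)
  have "\<bar>\<phi> x\<bar> \<le> max B 0" for x
    using B test_functions_outside[OF \<phi>, of x "[]"] by (cases "x \<in> K") (auto simp: K_def max_def)
  then show ?thesis by blast
qed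

subsection \<open>Metrics in dimension two\<close>

text \<open>The adjugate in dimension two, written by Cayley-Hamilton so that its linearity is
  visible.\<close>

definition adj2 :: "real^2^2 \<Rightarrow> real^2^2" where
  "adj2 G = mat (trace G) - G"

lemma adj2_components:
  "adj2 G $ 1 $ 1 = G $ 2 $ 2" "adj2 G $ 2 $ 2 = G $ 1 $ 1"
  "adj2 G $ 1 $ 2 = - (G $ 1 $ 2)" "adj2 G $ 2 $ 1 = - (G $ 2 $ 1)"
  by (simp_all add: adj2_def mat_def trace_def sum_2)

lemma vec2_eq_iff: "v = w \<longleftrightarrow> v $ 1 = w $ 1 \<and> v $ 2 = w $ 2" for v w :: "'a^2"
  by (simp add: vec_eq_iff forall_2)

lemma matrix_inv_adj2:
  fixes G :: "real^2^2"
  assumes "det G \<noteq> 0"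
  shows "matrix_inv G = (1 / det G) *\<^sub>R adj2 G"
proof -
  let ?B = "(1 / det G) *\<^sub>R adj2 G"
  have B: "G ** ?B = mat 1" "?B ** G = mat 1"
    using assms
    by (simp_all add: vec2_eq_iff matrix_matrix_mult_def sum_2 adj2_components mat_def field_simps)
       (simp_all add: det_2 field_simps)
  \<comment> \<open>\<open>matrix_inv\<close> is a choice of inverse: \<open>?B\<close> shows that
    one exists, and associativity then forces equality with \<open>?B\<close>.\<close>
  have "matrix_inv G ** G = mat 1"
    unfolding matrix_inv_def by (rule someI2[of _ ?B]) (use B in auto)
  then have "(matrix_inv G ** G) ** ?B = ?B" by (simp only: matrix_mul_lid)
  then show ?thesis by (simp only: matrix_mul_assoc[symmetric] B(1) matrix_mul_rid)
qed

lemma det_scaleR_2: "det (c *\<^sub>R G) = c\<^sup>2 * det G" for G :: "real^2^2"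
  unfolding det_2 vector_scaleR_component real_scaleR_def by algebra

lemma inner_matrix_vector_2:
  "v \<bullet> (A *v w) = v$1 * (A$1$1 * w$1 + A$1$2 * w$2) + v$2 * (A$2$1 * w$1 + A$2$2 * w$2)"
  for v w :: "real^2"
  unfolding inner_vec_def matrix_vector_mult_def sum_2 vec_lambda_beta inner_real_def by (rule refl)

lemma symmetric_2:
  fixes A :: "real^2^2"
  assumes "transpose A = A"
  shows "A$2$1 = A$1$2"
proof -
  have "transpose A $ 2 $ 1 = A $ 1 $ 2" by (simp add: transpose_def)
  then show ?thesis by (simp only: assms)
qed

lemma det_pos:
  fixes G :: "real^2^2"
  assumes sym: "transpose G = G" and pos: "\<And>v. v \<noteq> 0 \<Longrightarrow> v \<bullet> (G *v v) > 0"
  shows "0 < det G"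
proof -
  have a: "0 < G$1$1"
    using pos[of "\<chi> i. if i = 1 then 1 else 0"]
    unfolding inner_matrix_vector_2 by (simp add: vec2_eq_iff)
  \<comment> \<open>On this vector the quadratic form equals the upper left entry times the
    determinant.\<close>
  define v :: "real^2" where "v = (\<chi> i. if i = 1 then - (G$1$2) else G$1$1)"
  have v: "v$1 = - (G$1$2)" "v$2 = G$1$1" by (simp_all add: v_def)
  have "v \<noteq> 0" using a v(2) by auto
  then have "0 < v \<bullet> (G *v v)" by (rule pos)
  also have "v \<bullet> (G *v v) = G$1$1 * det G"
    unfolding inner_matrix_vector_2 v det_2 symmetric_2[OF sym] by algebra
  finally show ?thesis using a by (simp only: zero_less_mult_iff) linarith
qed

text \<open>On a metric this is \<open>sqrt (det g)\<close> times the inverse of \<open>g\<close>,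
  the coefficient matrix of the Laplacian in divergence form, written without a matrix
  inverse.\<close>

definition flux :: "(real^2 \<Rightarrow> real^2^2) \<Rightarrow> real^2 \<Rightarrow> real^2^2" where
  "flux g x = (1 / sqrt (det (g x))) *\<^sub>R adj2 (g x)"

lemma riemannian_metricsD:
  assumes "g \<in> riemannian_metrics \<Omega>"
  shows "x \<in> closure \<Omega> \<Longrightarrow> transpose (g x) = g x"
    and "x \<in> closure \<Omega> \<Longrightarrow> v \<noteq> 0 \<Longrightarrow> 0 < v \<bullet> (g x *v v)"
    and "smooth_upto_boundary \<Omega> g"
  using assms unfolding riemannian_metrics_def by blast+

lemma riemannian_metrics_det_pos:
  fixes g :: "real^2 \<Rightarrow> real^2^2"
  assumes "g \<in> riemannian_metrics \<Omega>" "x \<in> closure \<Omega>"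
  shows "0 < det (g x)"
  using riemannian_metricsD(1,2)[OF assms] by (rule det_pos)

lemma vol_density_pos:
  fixes g :: "real^2 \<Rightarrow> real^2^2"
  assumes "g \<in> riemannian_metrics \<Omega>" "x \<in> closure \<Omega>"
  shows "0 < vol_density g x"
  using riemannian_metrics_det_pos[OF assms] by (simp add: vol_density_def)

lemma flux_eq:
  fixes g :: "real^2 \<Rightarrow> real^2^2"
  assumes "g \<in> riemannian_metrics \<Omega>" "x \<in> closure \<Omega>"
  shows "flux g x *v v = vol_density g x *\<^sub>R (matrix_inv (g x) *v v)"
proof -
  have d: "0 < det (g x)" using assms by (rule riemannian_metrics_det_pos)
  have "vol_density g x *\<^sub>R (matrix_inv (g x) *v v) = (sqrt (det (g x)) / det (g x)) *\<^sub>R (adj2 (g x) *v v)"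
    unfolding matrix_inv_adj2[OF less_imp_neq[OF d, symmetric]] scaleR_matrix_vector_assoc[symmetric]
    by (simp add: vol_density_def)
  also have "\<dots> = flux g x *v v"
    unfolding flux_def scaleR_matrix_vector_assoc[symmetric] sqrt_divide_self_eq[OF less_imp_le[OF d]]
    by (simp add: inverse_eq_divide)
  finally show ?thesis ..
qed

lemma flux_mult: "flux g x *v v = (1 / sqrt (det (g x))) *\<^sub>R (adj2 (g x) *v v)"
  by (simp only: flux_def scaleR_matrix_vector_assoc)

lemma flux_symmetric:
  fixes g :: "real^2 \<Rightarrow> real^2^2"
  assumes "g \<in> riemannian_metrics \<Omega>" "x \<in> closure \<Omega>"
  shows "v \<bullet> (flux g x *v w) = (flux g x *v v) \<bullet> w"
proof -
  have "v \<bullet> (adj2 (g x) *v w) = w \<bullet> (adj2 (g x) *v v)"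
    unfolding inner_matrix_vector_2 adj2_components symmetric_2[OF riemannian_metricsD(1)[OF assms]]
    by algebra
  then show ?thesis
    by (simp only: flux_mult inner_scaleR_right inner_scaleR_left inner_commute)
qed

lemma flux_pos:
  fixes g :: "real^2 \<Rightarrow> real^2^2"
  assumes g: "g \<in> riemannian_metrics \<Omega>" and x: "x \<in> closure \<Omega>" and v: "v \<noteq> 0"
  shows "0 < v \<bullet> (flux g x *v v)"
proof -
  \<comment> \<open>A quarter turn of \<open>v\<close> converts the quadratic form of the adjugate
    into that of the metric.\<close>
  define w :: "real^2" where "w = (\<chi> i. if i = 1 then v $ 2 else - (v $ 1))"
  have w: "w$1 = v$2" "w$2 = - (v$1)" by (simp_all add: w_def)
  have "w \<noteq> 0" using v unfolding vec2_eq_iff w by auto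
  then have "0 < w \<bullet> (g x *v w)" by (rule riemannian_metricsD(2)[OF g x])
  also have "w \<bullet> (g x *v w) = v \<bullet> (adj2 (g x) *v v)"
    unfolding inner_matrix_vector_2 adj2_components symmetric_2[OF riemannian_metricsD(1)[OF g x]] w
    by algebra
  finally show ?thesis
    using riemannian_metrics_det_pos[OF g x] by (simp only: flux_mult inner_scaleR_right) simp
qed

section \<open>Continuity and uniform bounds for the coefficients of the operator\<close>

lemma norm_matrix_vector_le:
  fixes A :: "real^'n^'m"
  shows "norm (A *v v) \<le> real CARD('m) * norm A * norm v"
proof -
  have "norm (A *v v) \<le> (\<Sum>i\<in>UNIV. \<bar>(A *v v) $ i\<bar>)" by (rule norm_le_l1_cart)
  also have "\<dots> \<le> (\<Sum>i\<in>(UNIV::'m set). norm A * norm v)"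
  proof (rule sum_mono)
    fix i
    have "\<bar>(A *v v) $ i\<bar> = \<bar>A $ i \<bullet> v\<bar>" by (simp add: matrix_vector_mul_component)
    also have "\<dots> \<le> norm (A $ i) * norm v" by (rule Cauchy_Schwarz_ineq2)
    also have "\<dots> \<le> norm A * norm v" by (intro mult_right_mono Finite_Cartesian_Product.norm_nth_le norm_ge_zero)
    finally show "\<bar>(A *v v) $ i\<bar> \<le> norm A * norm v" .
  qed
  finally show ?thesis by simp
qed

lemma continuous_on_det_real2: "continuous_on S (det :: real^2^2 \<Rightarrow> real)"
  unfolding det_2 by (intro continuous_intros)

lemma linear_adj2: "linear adj2"
  by (rule linearI) (simp_all add: vec2_eq_iff adj2_components)

lemma continuous_on_adj2: "continuous_on S adj2"
  by (rule linear_continuous_on) (simp add: linear_adj2 linear_conv_bounded_linear[symmetric])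

text \<open>Volume density and flux as one continuous function of the matrix, so that a single
  uniform continuity argument covers both.\<close>

definition coeffs :: "real^2^2 \<Rightarrow> real \<times> (real^2^2)" where
  "coeffs G = (sqrt (det G), (1 / sqrt (det G)) *\<^sub>R adj2 G)"

lemma continuous_on_coeffs: "continuous_on {G. 0 < det G} coeffs"
  unfolding coeffs_def
  by (intro continuous_intros continuous_on_det_real2 continuous_on_adj2) auto

lemma coeffs_metric: "coeffs (g x) = (vol_density g x, flux g x)"
  by (simp add: coeffs_def vol_density_def flux_def)

text \<open>Uniform continuity in which only \<open>x\<close> is confined to the compact set. The
  values of a nearby metric need not lie in the compact image of \<open>g\<close>, so
  \<open>y\<close> must be allowed to leave it.\<close>

lemma compact_continuous_near:
  fixes f :: "'a::metric_space \<Rightarrow> 'b::metric_space"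
  assumes K: "compact K" "K \<subseteq> S" and S: "open S" and f: "continuous_on S f" and e: "0 < e"
  shows "\<exists>d>0. \<forall>x\<in>K. \<forall>y. dist y x < d \<longrightarrow> y \<in> S \<and> dist (f y) (f x) < e"
proof -
  let ?U = "\<lambda>y. S \<inter> f -` ball (f y) (e/2)"
  have op: "open (?U y)" for y
    using f S by (intro continuous_open_preimage) auto
  have "K \<subseteq> \<Union>(?U ` K)" using K e by auto
  then have "\<exists>d>0. \<forall>x\<in>K. \<exists>G\<in>?U ` K. ball x d \<subseteq> G"
    by (rule Heine_Borel_lemma[OF K(1)]) (use op in auto)
  then obtain d where d: "0 < d" "\<forall>x\<in>K. \<exists>G\<in>?U ` K. ball x d \<subseteq> G"
    by (elim exE conjE)
  have "y \<in> S \<and> dist (f y) (f x) < e" if x: "x \<in> K" and y: "dist y x < d" for x y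
  proof -
    obtain z where z: "ball x d \<subseteq> ?U z" using d(2) x by blast
    have "y \<in> ?U z" "x \<in> ?U z" using z y d(1) by (auto simp: dist_commute subset_iff)
    then show ?thesis
      using dist_triangle_half_r[of "f z" "f y" e "f x"] by (auto simp: dist_commute)
  qed
  then show ?thesis using d(1) by blast
qed

lemma metric_continuous: "g \<in> riemannian_metrics \<Omega> \<Longrightarrow> continuous_on (closure \<Omega>) g"
  by (drule riemannian_metricsD(3)) (simp add: smooth_upto_boundary_def)

lemma metric_image_compact:
  "g \<in> riemannian_metrics \<Omega> \<Longrightarrow> bounded \<Omega> \<Longrightarrow> compact (g ` closure \<Omega>)"
  by (intro compact_continuous_image metric_continuous) (auto simp: compact_closure)

lemma coeffs_continuous:
  fixes g :: "real^2 \<Rightarrow> real^2^2"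
  assumes "g \<in> riemannian_metrics \<Omega>"
  shows "continuous_on (closure \<Omega>) (\<lambda>x. (vol_density g x, flux g x))"
proof -
  have "continuous_on (closure \<Omega>) (\<lambda>x. coeffs (g x))"
    using continuous_on_compose2[OF continuous_on_coeffs metric_continuous[OF assms]]
      riemannian_metrics_det_pos[OF assms] by blast
  then show ?thesis by (simp add: coeffs_metric)
qed

lemma vol_density_continuous:
  fixes g :: "real^2 \<Rightarrow> real^2^2"
  assumes "g \<in> riemannian_metrics \<Omega>"
  shows "continuous_on (closure \<Omega>) (vol_density g)"
  using continuous_on_fst[OF coeffs_continuous[OF assms]] by simp

lemma flux_continuous:
  assumes "g \<in> riemannian_metrics \<Omega>"
  shows "continuous_on (closure \<Omega>) (flux g)"
  using continuous_on_snd[OF coeffs_continuous[OF assms]] by simp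

lemma coeffs_bounded:
  fixes g :: "real^2 \<Rightarrow> real^2^2"
  assumes g: "g \<in> riemannian_metrics \<Omega>" and \<Omega>: "bounded \<Omega>"
  shows "\<exists>C>0. \<forall>x\<in>closure \<Omega>. vol_density g x \<le> C \<and> norm (flux g x) \<le> C"
proof -
  have "bounded ((\<lambda>x. (vol_density g x, flux g x)) ` closure \<Omega>)"
    using \<Omega> by (intro compact_imp_bounded compact_continuous_image coeffs_continuous[OF g])
      (auto simp: compact_closure)
  then obtain C where C: "0 < C" "\<And>x. x \<in> closure \<Omega> \<Longrightarrow> norm (vol_density g x, flux g x) \<le> C"
    by (auto simp: bounded_pos)
  have "vol_density g x \<le> C \<and> norm (flux g x) \<le> C" if "x \<in> closure \<Omega>" for x
    using C(2)[OF that] norm_fst_le[of "vol_density g x" "flux g x"] norm_snd_le[of "flux g x" "vol_density g x"]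
    by auto
  then show ?thesis using C(1) by blast
qed

lemma vol_density_lower:
  fixes g :: "real^2 \<Rightarrow> real^2^2"
  assumes g: "g \<in> riemannian_metrics \<Omega>" and \<Omega>: "bounded \<Omega>"
  shows "\<exists>c>0. \<forall>x\<in>closure \<Omega>. c \<le> vol_density g x"
proof (cases "\<Omega> = {}")
  case False
  then have "\<exists>x\<in>closure \<Omega>. \<forall>y\<in>closure \<Omega>. vol_density g x \<le> vol_density g y"
    using \<Omega> by (intro continuous_attains_inf vol_density_continuous[OF g]) (auto simp: compact_closure)
  then show ?thesis using vol_density_pos[OF g] by blast
qed (auto intro: exI[of _ 1])

text \<open>The differential operator \<open>-\<Delta>\<^sub>g - \<mu>\<close> acts on a pair consisting of a function and its gradient
  through this zeroth order symmetric bundle map.\<close>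

definition bop :: "(real^2 \<Rightarrow> real^2^2) \<Rightarrow> real \<Rightarrow> real^2 \<Rightarrow> real \<times> (real^2) \<Rightarrow> real \<times> (real^2)" where
  "bop g \<mu> x V = (- \<mu> * vol_density g x * fst V, flux g x *v snd V)"

lemma bop_symmetric:
  "g \<in> riemannian_metrics \<Omega> \<Longrightarrow> x \<in> closure \<Omega> \<Longrightarrow> V \<bullet> bop g \<mu> x W = bop g \<mu> x V \<bullet> W"
  by (simp add: bop_def inner_prod_def flux_symmetric)

text \<open>Stated for arbitrary coefficients \<open>r\<close> and \<open>A\<close>, so that it
  bounds the operator itself as well as the difference of two such operators. The 2 is the dimension
  factor of \<open>norm_matrix_vector_le\<close>.\<close>

lemma bop_bound:
  fixes A :: "real^2^2"
  assumes r: "\<bar>r\<bar> \<le> C" and A: "norm A \<le> C"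
  shows "norm (- \<mu> * r * fst V, A *v snd V) \<le> (\<bar>\<mu>\<bar> + 2) * C * norm V"
proof -
  have f: "\<bar>fst V\<bar> \<le> norm V" using norm_fst_le[of "fst V" "snd V"] by simp
  have s: "norm (snd V) \<le> norm V" using norm_snd_le[of "snd V" "fst V"] by simp
  have C: "0 \<le> C" using A norm_ge_zero order_trans by blast
  have 1: "\<bar>\<mu>\<bar> * \<bar>r\<bar> * \<bar>fst V\<bar> \<le> \<bar>\<mu>\<bar> * C * norm V"
    using r f C by (intro mult_mono) auto
  have "norm (A *v snd V) \<le> 2 * norm A * norm (snd V)"
    using norm_matrix_vector_le[of A "snd V"] by simp
  also have "\<dots> \<le> 2 * C * norm V"
    using A s C by (intro mult_mono) auto
  finally have 2: "norm (A *v snd V) \<le> 2 * C * norm V" .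
  show ?thesis
    using norm_Pair_le[of "- \<mu> * r * fst V" "A *v snd V"] 1 2 by (simp add: abs_mult algebra_simps)
qed

lemma bop_bounded:
  assumes "g \<in> riemannian_metrics \<Omega>" "bounded \<Omega>"
  shows "\<exists>C\<ge>0. \<forall>x\<in>closure \<Omega>. \<forall>V. norm (bop g \<mu> x V) \<le> C * norm V"
proof -
  obtain C where C: "C > 0" "\<forall>x\<in>closure \<Omega>. vol_density g x \<le> C \<and> norm (flux g x) \<le> C"
    using coeffs_bounded[OF assms] by blast
  have "norm (bop g \<mu> x V) \<le> ((\<bar>\<mu>\<bar> + 2) * C) * norm V" if "x \<in> closure \<Omega>" for x V
    unfolding bop_def using C that vol_density_pos[OF assms(1) that] by (intro bop_bound) auto
  moreover have "0 \<le> (\<bar>\<mu>\<bar> + 2) * C" using C by simp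
  ultimately show ?thesis by blast
qed

text \<open>The operator depends on the metric only through \<open>coeffs\<close> at the same point
  and on none of its derivatives. Uniformity in \<open>x\<close> comes from compactness of the image
  of \<open>g\<close>.\<close>

lemma bop_close:
  assumes g: "g \<in> riemannian_metrics \<Omega>" and \<Omega>: "bounded \<Omega>" and e: "0 < e"
  shows "\<exists>d>0. \<forall>h. \<forall>x\<in>\<Omega>. norm (h x - g x) < d \<longrightarrow>
    (\<forall>V. norm (bop g \<mu> x V - bop h \<mu> x V) \<le> e * norm V)"
proof -
  \<comment> \<open>Compensates for the factor that \<open>bop_bound\<close> costs.\<close>
  define e' where "e' = e / (\<bar>\<mu>\<bar> + 2)"
  have e': "0 < e'" "(\<bar>\<mu>\<bar> + 2) * e' = e" using e by (simp_all add: e'_def)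
  have "g ` closure \<Omega> \<subseteq> {G. 0 < det G}" using riemannian_metrics_det_pos[OF g] by blast
  moreover have "open {G :: real^2^2. 0 < det G}"
    by (intro open_Collect_less continuous_on_const continuous_on_det_real2)
  ultimately obtain d where d: "0 < d"
    "\<And>G H. G \<in> g ` closure \<Omega> \<Longrightarrow> dist H G < d \<Longrightarrow> dist (coeffs H) (coeffs G) < e'"
    using compact_continuous_near[OF metric_image_compact[OF g \<Omega>] _ _ continuous_on_coeffs e'(1)]
    by blast
  have "norm (bop g \<mu> x V - bop h \<mu> x V) \<le> e * norm V"
    if x: "x \<in> \<Omega>" and h: "norm (h x - g x) < d" for h x V
  proof -
    have "dist (coeffs (h x)) (coeffs (g x)) < e'"
      using x h closure_subset by (intro d) (auto simp: dist_norm)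
    then have "dist (coeffs (g x)) (coeffs (h x)) < e'" by (simp only: dist_commute)
    then have n: "norm (vol_density g x - vol_density h x, flux g x - flux h x) < e'"
      by (simp add: coeffs_metric dist_norm)
    have "bop g \<mu> x V - bop h \<mu> x V
        = (- \<mu> * (vol_density g x - vol_density h x) * fst V, (flux g x - flux h x) *v snd V)"
      by (simp add: bop_def algebra_simps matrix_vector_mult_diff_rdistrib)
    also have "norm \<dots> \<le> (\<bar>\<mu>\<bar> + 2) * e' * norm V"
      using n norm_fst_le[of "vol_density g x - vol_density h x" "flux g x - flux h x"]
        norm_snd_le[of "flux g x - flux h x" "vol_density g x - vol_density h x"]
      by (intro bop_bound) auto
    finally show ?thesis by (simp add: e')
  qed
  then show ?thesis using d(1) by blast
qed

text \<open>Makes the product of a flux entry and a test function again a test function.\<close>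

lemma smooth_on_flux:
  assumes \<Omega>: "open \<Omega>" and g: "g \<in> riemannian_metrics \<Omega>"
  shows "smooth_on \<Omega> (\<lambda>x. flux g x $ i $ j)"
proof -
  have sg: "smooth_on \<Omega> g" using riemannian_metricsD(3)[OF g] by (simp add: smooth_upto_boundary_def)
  have entry: "smooth_on \<Omega> (\<lambda>x. g x $ k $ l)" for k l
    by (rule smooth_on_bounded_linear_compose[OF \<Omega> sg, of "\<lambda>G. G $ k $ l"])
      (simp add: bounded_linear_vec_nth bounded_linear_compose[of "\<lambda>v. v $ l"])
  have neg: "smooth_on \<Omega> (\<lambda>x. - f x)" if "smooth_on \<Omega> f" for f :: "real^2 \<Rightarrow> real"
    using smooth_on_mult[OF \<Omega> smooth_on_const[OF \<Omega>, of "-1"] that] by simp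
  have det: "smooth_on \<Omega> (\<lambda>x. det (g x))"
    using smooth_on_add[OF \<Omega> smooth_on_mult[OF \<Omega> entry entry] neg[OF smooth_on_mult[OF \<Omega> entry entry]]]
    by (simp add: det_2)
  have adj: "smooth_on \<Omega> (\<lambda>x. adj2 (g x) $ i $ j)"
    using exhaust_2[of i] exhaust_2[of j] entry neg[OF entry] by (auto simp: adj2_components)
  have "smooth_on \<Omega> (\<lambda>x. adj2 (g x) $ i $ j * det (g x) powr (- (1/2)))"
    using riemannian_metrics_det_pos[OF g] closure_subset by (intro smooth_on_mult_powr \<Omega> adj det) auto
  then show ?thesis
  proof (rule smooth_on_cong[OF \<Omega>, rotated])
    fix x assume "x \<in> \<Omega>"
    then have "0 < det (g x)" using riemannian_metrics_det_pos[OF g] closure_subset by blast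
    then have "det (g x) powr (- (1/2)) = 1 / sqrt (det (g x))"
      by (simp only: powr_minus powr_half_sqrt less_imp_le inverse_eq_divide)
    then show "flux g x $ i $ j = adj2 (g x) $ i $ j * det (g x) powr (- (1/2))"
      by (simp add: flux_def)
  qed
qed

subsection \<open>Constant rescaling of a metric\<close>

text \<open>The restriction keeps the result extensional, as membership in
  \<open>riemannian_metrics\<close> demands.\<close>

definition scale_metric :: "(real^'n) set \<Rightarrow> real \<Rightarrow> (real^'n \<Rightarrow> real^'n^'n) \<Rightarrow> real^'n \<Rightarrow> real^'n^'n" where
  "scale_metric \<Omega> c g = restrict (\<lambda>x. c *\<^sub>R g x) (closure \<Omega>)"

lemma scale_metric_apply: "x \<in> closure \<Omega> \<Longrightarrow> scale_metric \<Omega> c g x = c *\<^sub>R g x"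
  by (simp add: scale_metric_def)

lemma partial_derivs_scale_metric:
  assumes \<Omega>: "open \<Omega>" and g: "g \<in> riemannian_metrics \<Omega>" and x: "x \<in> \<Omega>"
  shows "partial_derivs is (scale_metric \<Omega> c g) x = c *\<^sub>R partial_derivs is g x"
proof -
  have "partial_derivs is (scale_metric \<Omega> c g) x = partial_derivs is (\<lambda>x. c *\<^sub>R g x) x"
    using closure_subset[of \<Omega>] by (intro partial_derivs_cong_open[OF \<Omega> _ x]) (auto simp: scale_metric_apply)
  also have "\<dots> = c *\<^sub>R partial_derivs is g x"
    using riemannian_metricsD(3)[OF g]
    by (intro partial_derivs_bounded_linear[OF \<Omega> _ bounded_linear_scaleR_right x])
      (simp add: smooth_upto_boundary_def)
  finally show ?thesis .
qed

lemma scale_metric_mem: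
  assumes \<Omega>: "open \<Omega>" and g: "g \<in> riemannian_metrics \<Omega>" and c: "0 < c"
  shows "scale_metric \<Omega> c g \<in> riemannian_metrics \<Omega>"
proof -
  have sg: "continuous_on (closure \<Omega>) g" "smooth_on \<Omega> g"
    "\<And>is. \<exists>h. continuous_on (closure \<Omega>) h \<and> (\<forall>x\<in>\<Omega>. h x = partial_derivs is g x)"
    using riemannian_metricsD(3)[OF g] unfolding smooth_upto_boundary_def by blast+
  have "continuous_on (closure \<Omega>) (scale_metric \<Omega> c g)"
    using continuous_on_scaleR[OF continuous_on_const sg(1), of c]
    by (rule continuous_on_eq) (simp add: scale_metric_apply)
  moreover have "smooth_on \<Omega> (scale_metric \<Omega> c g)"
    by (rule smooth_on_cong[OF \<Omega> _ smooth_on_bounded_linear_compose[OF \<Omega> sg(2) bounded_linear_scaleR_right, of c]])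
      (use closure_subset[of \<Omega>] in \<open>auto simp: scale_metric_apply\<close>)
  moreover have "\<exists>h. continuous_on (closure \<Omega>) h \<and> (\<forall>x\<in>\<Omega>. h x = partial_derivs is (scale_metric \<Omega> c g) x)" for "is"
  proof -
    obtain h where "continuous_on (closure \<Omega>) h" "\<forall>x\<in>\<Omega>. h x = partial_derivs is g x"
      using sg(3) by blast
    then show ?thesis
      using partial_derivs_scale_metric[OF \<Omega> g]
      by (intro exI[of _ "\<lambda>x. c *\<^sub>R h x"]) (auto intro!: continuous_intros)
  qed
  ultimately have "smooth_upto_boundary \<Omega> (scale_metric \<Omega> c g)"
    by (simp add: smooth_upto_boundary_def)
  moreover have "transpose (c *\<^sub>R g x) = c *\<^sub>R g x" if "x \<in> closure \<Omega>" for x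
    using riemannian_metricsD(1)[OF g that] by (simp add: transpose_scalar)
  moreover have "v \<bullet> ((c *\<^sub>R g x) *v v) > 0" if "x \<in> closure \<Omega>" "v \<noteq> 0" for x v
    using riemannian_metricsD(2)[OF g that] c by (simp add: scaleR_matrix_vector_assoc[symmetric])
  ultimately show ?thesis
    by (simp add: riemannian_metrics_def scale_metric_apply) (simp add: scale_metric_def)
qed

text \<open>Each derivative of \<open>g\<close> extends continuously to the compact closure and is
  therefore bounded; only finitely many of them have order at most \<open>k\<close>, and scaling
  changes each by the factor \<open>c - 1\<close>.\<close>

lemma scale_metric_close:
  assumes \<Omega>: "open \<Omega>" "bounded \<Omega>" and g: "g \<in> riemannian_metrics \<Omega>" and e: "0 < e"
  shows "\<exists>d>0. \<forall>c. \<bar>c - 1\<bar> < d \<longrightarrow> Ck_close \<Omega> k e g (scale_metric \<Omega> c g)"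
proof -
  have "\<exists>B. \<forall>x\<in>\<Omega>. norm (partial_derivs is g x) \<le> B" for "is"
  proof -
    obtain h where h: "continuous_on (closure \<Omega>) h" "\<forall>x\<in>\<Omega>. h x = partial_derivs is g x"
      using riemannian_metricsD(3)[OF g] unfolding smooth_upto_boundary_def by blast+
    have "bounded (h ` closure \<Omega>)"
      using \<Omega>(2) by (intro compact_imp_bounded compact_continuous_image h) (simp add: compact_closure)
    then obtain B where "\<forall>x\<in>closure \<Omega>. norm (h x) \<le> B" by (auto simp: bounded_iff)
    then show ?thesis using h(2) closure_subset[of \<Omega>] by (metis subsetD)
  qed
  then obtain B where B: "\<And>is x. x \<in> \<Omega> \<Longrightarrow> norm (partial_derivs is g x) \<le> B is" by metis
  have fin: "finite {is :: 'a list. length is \<le> k}"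
    using finite_lists_length_le[of "UNIV :: 'a set" k] by simp
  \<comment> \<open>One strict majorant of all these bounds; the summand 1 makes it
    positive.\<close>
  define S where "S = 1 + (\<Sum>is | length is \<le> k. \<bar>B is\<bar>)"
  have S: "\<bar>B is\<bar> < S" if "length is \<le> k" for "is"
    using member_le_sum[of "is" "{is. length is \<le> k}" "\<lambda>is. \<bar>B is\<bar>"] fin that by (simp add: S_def)
  have Spos: "0 < S" using S[of "[]"] by simp
  have "Ck_close \<Omega> k e g (scale_metric \<Omega> c g)" if c: "\<bar>c - 1\<bar> < e / S" for c
    unfolding Ck_close_def
  proof (intro allI impI ballI)
    fix "is" :: "'a list" and x assume len: "length is \<le> k" and x: "x \<in> \<Omega>"
    have "partial_derivs is (scale_metric \<Omega> c g) x - partial_derivs is g x = (c - 1) *\<^sub>R partial_derivs is g x"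
      using partial_derivs_scale_metric[OF \<Omega>(1) g x] by (simp add: algebra_simps)
    moreover have "\<bar>c - 1\<bar> * norm (partial_derivs is g x) \<le> \<bar>c - 1\<bar> * S"
      using B[OF x, of "is"] S[OF len] by (intro mult_left_mono) auto
    moreover have "\<bar>c - 1\<bar> * S < e" using c Spos by (simp add: field_simps)
    ultimately show "norm (partial_derivs is (scale_metric \<Omega> c g) x - partial_derivs is g x) < e"
      by simp
  qed
  then show ?thesis using e Spos by (intro exI[of _ "e / S"]) auto
qed

lemma vol_density_scale_metric:
  fixes g :: "real^2 \<Rightarrow> real^2^2"
  assumes "x \<in> closure \<Omega>" "0 < c"
  shows "vol_density (scale_metric \<Omega> c g) x = c * vol_density g x"
  using assms by (simp add: vol_density_def scale_metric_apply det_scaleR_2 real_sqrt_mult)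

text \<open>In dimension two both the adjugate and the square root of the determinant are
  homogeneous of degree one, so the factor cancels. Constant scaling thus acts on the eigenvalue
  equation through the volume density alone.\<close>

lemma flux_scale_metric:
  assumes "x \<in> closure \<Omega>" "0 < c"
  shows "flux (scale_metric \<Omega> c g) x = flux g x"
  using assms linear_scale[OF linear_adj2]
  by (simp add: flux_def scale_metric_apply det_scaleR_2 real_sqrt_mult)

section \<open>Eigenvalues of the Laplace-Beltrami operator\<close>

subsection \<open>Pairs of a Sobolev function and its gradient\<close>

locale bounded_open_set =
  fixes \<Omega> :: "(real^2) set"
  assumes open_\<Omega>: "open \<Omega>" and bounded_\<Omega>: "bounded \<Omega>"
begin

abbreviation M :: "(real^2) measure" where "M \<equiv> lebesgue_on \<Omega>"

section \<open>Integration over the domain\<close>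

lemma \<Omega>_sets: "\<Omega> \<in> sets lebesgue"
  using open_\<Omega> by (intro sets_completionI_sets) simp

lemma \<Omega>_closure: "x \<in> \<Omega> \<Longrightarrow> x \<in> closure \<Omega>"
  using closure_subset by (rule subsetD)

sublocale finite_measure M
  by (rule finite_measure_lebesgue_on) (rule lmeasurable_open[OF bounded_\<Omega> open_\<Omega>])

lemma space_M: "space M = \<Omega>"
  by simp

lemma set_integral_eq: "(LINT x:\<Omega>|lebesgue. f x) = (\<integral>x. f x \<partial>M)"
  for f :: "real^2 \<Rightarrow> 'b::{banach, second_countable_topology}"
  unfolding set_lebesgue_integral_def by (rule integral_restrict_space[symmetric]) (simp add: \<Omega>_sets)

lemma set_integrable_eq: "set_integrable lebesgue \<Omega> f \<longleftrightarrow> integrable M f"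
  for f :: "real^2 \<Rightarrow> 'b::{banach, second_countable_topology}"
  unfolding set_integrable_def by (rule integrable_restrict_space[symmetric]) (simp add: \<Omega>_sets)

lemma continuous_measurable: "continuous_on \<Omega> f \<Longrightarrow> f \<in> borel_measurable M"
  by (rule continuous_imp_measurable_on_sets_lebesgue[OF _ \<Omega>_sets])

lemma L2_locally_integrable:
  fixes f :: "real^2 \<Rightarrow> 'b::euclidean_space"
  assumes f: "f \<in> L2 M"
  shows "f locally_integrable_on \<Omega>"
  unfolding locally_integrable_on_def
proof (intro allI impI)
  fix K assume K: "compact K \<and> K \<subseteq> \<Omega>"
  have "set_integrable lebesgue \<Omega> f"
    using L2_integrable[OF f] by (simp add: set_integrable_eq)
  moreover have "K \<in> sets lebesgue" using K by (intro sets_completionI_sets) (simp add: compact_imp_closed)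
  ultimately show "f absolutely_integrable_on K"
    using K by (intro set_integrable_subset[of lebesgue \<Omega> f K]) auto
qed

lemma L2_test: "\<phi> \<in> test_functions \<Omega> \<Longrightarrow> \<phi> \<in> L2 M"
proof -
  assume \<phi>: "\<phi> \<in> test_functions \<Omega>"
  obtain B where "\<forall>x. \<bar>\<phi> x\<bar> \<le> B" using test_functions_bounded[OF \<phi>] by blast
  then show ?thesis
    using continuous_on_subset[OF test_functions_continuous[OF \<phi>] subset_UNIV]
    by (intro L2_bounded[of _ B] continuous_measurable) auto
qed

lemma L2_Pair:
  assumes "f \<in> L2 M" "h \<in> L2 M"
  shows "(\<lambda>x. (f x, h x)) \<in> L2 M"
proof -
  have "(\<lambda>x. (f x, h x)) \<in> borel_measurable M"
    using assms by (intro borel_measurable_Pair L2_measurable)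
  moreover have "integrable M (\<lambda>x. (norm (f x))\<^sup>2 + (norm (h x))\<^sup>2)"
    using assms by (simp add: L2_def)
  ultimately show ?thesis by (simp add: L2_def norm_prod_def)
qed

lemma measurable_fst_snd:
  fixes U :: "real^2 \<Rightarrow> 'b::euclidean_space \<times> 'c::euclidean_space"
  assumes "U \<in> borel_measurable M"
  shows "(\<lambda>x. fst (U x)) \<in> borel_measurable M" "(\<lambda>x. snd (U x)) \<in> borel_measurable M"
  using borel_measurable_continuous_on[OF continuous_on_fst[OF continuous_on_id] assms]
    borel_measurable_continuous_on[OF continuous_on_snd[OF continuous_on_id] assms] by simp_all

lemma L2_fst:
  fixes U :: "real^2 \<Rightarrow> 'b::euclidean_space \<times> 'c::euclidean_space"
  assumes "U \<in> L2 M"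
  shows "(\<lambda>x. fst (U x)) \<in> L2 M"
  using measurable_fst_snd(1)[OF L2_measurable[OF assms]]
  by (rule L2_bound[OF assms, of _ 1]) (metis mult_1 norm_fst_le prod.collapse)

lemma L2_snd:
  fixes U :: "real^2 \<Rightarrow> 'b::euclidean_space \<times> 'c::euclidean_space"
  assumes "U \<in> L2 M"
  shows "(\<lambda>x. snd (U x)) \<in> L2 M"
  using measurable_fst_snd(2)[OF L2_measurable[OF assms]]
  by (rule L2_bound[OF assms, of _ 1]) (metis mult_1 norm_snd_le prod.collapse)

lemma L2_vec:
  fixes f :: "real^2 \<Rightarrow> real^2"
  assumes "\<And>i. (\<lambda>x. f x $ i) \<in> L2 M"
  shows "f \<in> L2 M"
proof -
  have "(\<lambda>x. \<Sum>i\<in>UNIV. f x $ i *\<^sub>R (axis i 1 :: real^2)) \<in> L2 M"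
  proof (rule L2_sum)
    fix i :: 2
    show "(\<lambda>x. f x $ i *\<^sub>R (axis i 1 :: real^2)) \<in> L2 M"
      using L2_measurable[OF assms[of i]]
      by (intro L2_bound[OF assms[of i], of _ 1]) auto
  qed
  moreover have "(\<Sum>i\<in>UNIV. f x $ i *\<^sub>R axis i 1) = f x" for x
    using basis_expansion[of "f x"] by (simp add: scalar_mult_eq_scaleR)
  ultimately show ?thesis by simp
qed

text \<open>Pairing a function with its gradient turns the Sobolev norm into a plain square norm of
  one vector valued function.\<close>

definition jet :: "(real^2 \<Rightarrow> real) \<Rightarrow> real^2 \<Rightarrow> real \<times> (real^2)" where
  "jet \<phi> x = (\<phi> x, gradient \<phi> x)"

lemma L2_jet: "\<phi> \<in> test_functions \<Omega> \<Longrightarrow> jet \<phi> \<in> L2 M"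
  unfolding jet_def gradient_def
  by (intro L2_Pair L2_vec) (simp_all add: L2_test test_functions_partial_deriv)

lemma jet_add:
  assumes "\<phi> \<in> test_functions \<Omega>" "\<psi> \<in> test_functions \<Omega>"
  shows "jet (\<lambda>x. c * (\<phi> x + \<psi> x)) x = c *\<^sub>R (jet \<phi> x + jet \<psi> x)"
proof -
  have sm: "smooth_on UNIV \<phi>" "smooth_on UNIV \<psi>" using assms by (auto simp: test_functions_def)
  obtain p q where d: "(\<phi> has_derivative p) (at x)" "(\<psi> has_derivative q) (at x)"
    using sm[THEN smooth_on_differentiable[OF _ open_UNIV UNIV_I]] unfolding differentiable_def by blast
  have "partial_deriv i (\<lambda>x. c * (\<phi> x + \<psi> x)) x = c * (partial_deriv i \<phi> x + partial_deriv i \<psi> x)" for i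
    using partial_deriv_eq[OF has_derivative_mult_right[OF has_derivative_add[OF d], of c], of i]
      d[THEN partial_deriv_eq, of i] by simp
  then show ?thesis by (simp add: jet_def gradient_def vec_eq_iff)
qed

text \<open>Pairing against this field turns the integration by parts formula into an orthogonality relation.\<close>

definition parts_field :: "(real^2 \<Rightarrow> real) \<Rightarrow> 2 \<Rightarrow> real^2 \<Rightarrow> real \<times> (real^2)" where
  "parts_field \<phi> i x = (partial_deriv i \<phi> x, axis i (\<phi> x))"

lemma L2_parts_field:
  assumes "\<phi> \<in> test_functions \<Omega>"
  shows "parts_field \<phi> i \<in> L2 M"
proof -
  have "(\<lambda>x. axis i (\<phi> x) $ j) \<in> L2 M" for j
    by (cases "j = i") (use L2_test[OF assms] L2_zero in \<open>simp_all add: axis_def\<close>)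
  then show ?thesis
    unfolding parts_field_def
    by (intro L2_Pair L2_vec L2_test[OF test_functions_partial_deriv[OF assms]])
qed

text \<open>As a family of orthogonality relations, the weak gradient condition is visibly linear
  and stable under norm limits.\<close>

lemma weak_gradient_iff:
  assumes U: "U \<in> L2 M"
  shows "has_weak_gradient \<Omega> (\<lambda>x. fst (U x)) (\<lambda>x. snd (U x)) \<longleftrightarrow>
    (\<forall>\<phi>\<in>test_functions \<Omega>. \<forall>i. ip M U (parts_field \<phi> i) = 0)"
proof -
  have "ip M U (parts_field \<phi> i) = (\<integral>x. fst (U x) * partial_deriv i \<phi> x \<partial>M) + (\<integral>x. snd (U x) $ i * \<phi> x \<partial>M)"
    if \<phi>: "\<phi> \<in> test_functions \<Omega>" for \<phi> i
  proof -
    have s: "(\<lambda>x. snd (U x) $ i) \<in> L2 M"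
    proof (rule L2_bound[OF L2_snd[OF U], of _ 1])
      show "(\<lambda>x. snd (U x) $ i) \<in> borel_measurable M"
        using borel_measurable_continuous_on[OF _ L2_measurable[OF L2_snd[OF U]], of "\<lambda>v. v $ i"]
        by (simp add: continuous_on_component continuous_on_id)
      show "norm (snd (U x) $ i) \<le> 1 * norm (snd (U x))" for x
        using Finite_Cartesian_Product.norm_nth_le[of "snd (U x)" i] by simp
    qed
    have "integrable M (\<lambda>x. fst (U x) * partial_deriv i \<phi> x)"
      using L2_inner_integrable[OF L2_fst[OF U] L2_test[OF test_functions_partial_deriv[OF \<phi>]]] by simp
    moreover have "integrable M (\<lambda>x. snd (U x) $ i * \<phi> x)"
      using L2_inner_integrable[OF s L2_test[OF \<phi>]] by simp
    moreover have "U x \<bullet> parts_field \<phi> i x = fst (U x) * partial_deriv i \<phi> x + snd (U x) $ i * \<phi> x" for x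
      by (simp add: parts_field_def inner_prod_def inner_axis)
    ultimately show ?thesis by (simp add: ip_def)
  qed
  then show ?thesis
    unfolding has_weak_gradient_def set_integral_eq
    using L2_locally_integrable[OF L2_fst[OF U]] L2_locally_integrable[OF L2_snd[OF U]]
    by (simp add: eq_neg_iff_add_eq_0)
qed

text \<open>Elements of \<open>H10\<close> together with the weak gradient that witnesses
  membership. Carrying the gradient as data makes this a closed subspace of the square integrable
  pairs.\<close>

definition H :: "(real^2 \<Rightarrow> real \<times> (real^2)) set" where
  "H = {U \<in> L2 M. (\<forall>\<phi>\<in>test_functions \<Omega>. \<forall>i. ip M U (parts_field \<phi> i) = 0) \<and>
     (\<forall>\<epsilon>>0. \<exists>\<phi>\<in>test_functions \<Omega>. ip M (\<lambda>x. jet \<phi> x - U x) (\<lambda>x. jet \<phi> x - U x) < \<epsilon>)}"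

lemma H_L2: "U \<in> H \<Longrightarrow> U \<in> L2 M"
  unfolding H_def by blast

lemma H_scale:
  assumes U: "U \<in> H"
  shows "(\<lambda>x. c *\<^sub>R U x) \<in> H"
proof (cases "c = 0")
  case True
  have "jet (\<lambda>x. 0) = (\<lambda>x. 0)"
    using jet_add[OF test_functions_zero test_functions_zero, of 0] by (auto simp: zero_prod_def)
  then have "\<exists>\<phi>\<in>test_functions \<Omega>. ip M (\<lambda>x. jet \<phi> x - 0) (\<lambda>x. jet \<phi> x - 0) < e" if "0 < e" for e
    using that by (intro bexI[of _ "\<lambda>x. 0"] test_functions_zero) (simp add: ip_def)
  then show ?thesis using True by (simp add: H_def L2_zero ip_def)
next
  case False
  have "\<exists>\<phi>\<in>test_functions \<Omega>. ip M (\<lambda>x. jet \<phi> x - c *\<^sub>R U x) (\<lambda>x. jet \<phi> x - c *\<^sub>R U x) < e" if e: "0 < e" for e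
  proof -
    \<comment> \<open>Squared distances scale by \<open>c\<^sup>2\<close>, hence this tolerance and
      the separate case \<open>c = 0\<close>.\<close>
    obtain \<phi> where \<phi>: "\<phi> \<in> test_functions \<Omega>" "ip M (\<lambda>x. jet \<phi> x - U x) (\<lambda>x. jet \<phi> x - U x) < e / c\<^sup>2"
      using U e False unfolding H_def by (auto dest!: spec[of _ "e / c\<^sup>2"])
    have "jet (\<lambda>x. c * \<phi> x) x = c *\<^sub>R jet \<phi> x" for x
      using jet_add[OF \<phi>(1) test_functions_zero, of c x] jet_add[OF test_functions_zero test_functions_zero, of 0 x]
      by (simp add: zero_prod_def[symmetric])
    then have "ip M (\<lambda>x. jet (\<lambda>x. c * \<phi> x) x - c *\<^sub>R U x) (\<lambda>x. jet (\<lambda>x. c * \<phi> x) x - c *\<^sub>R U x)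
        = c\<^sup>2 * ip M (\<lambda>x. jet \<phi> x - U x) (\<lambda>x. jet \<phi> x - U x)"
      by (simp add: scaleR_diff_right[symmetric] ip_scaleR_left ip_scaleR_right power2_eq_square)
    also have "\<dots> < e" using \<phi>(2) False by (simp add: field_simps)
    finally show ?thesis using test_functions_scale[OF \<phi>(1), of c] by blast
  qed
  then show ?thesis using U by (simp add: H_def L2_scaleR ip_scaleR_left)
qed

text \<open>Midpoints are exactly the convexity that \<open>L2_nested_convex\<close> asks
  for.\<close>

lemma H_midpoint:
  assumes U: "U \<in> H" and V: "V \<in> H"
  shows "(\<lambda>x. (1/2) *\<^sub>R (U x + V x)) \<in> H"
proof -
  have UL: "U \<in> L2 M" and VL: "V \<in> L2 M" using U V by (auto intro: H_L2)
  have "\<exists>\<phi>\<in>test_functions \<Omega>. ip M (\<lambda>x. jet \<phi> x - (1/2) *\<^sub>R (U x + V x)) (\<lambda>x. jet \<phi> x - (1/2) *\<^sub>R (U x + V x)) < e"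
    if e: "0 < e" for e
  proof -
    obtain \<phi> where \<phi>: "\<phi> \<in> test_functions \<Omega>" "ip M (\<lambda>x. jet \<phi> x - U x) (\<lambda>x. jet \<phi> x - U x) < e"
      using U e unfolding H_def by blast
    obtain \<psi> where \<psi>: "\<psi> \<in> test_functions \<Omega>" "ip M (\<lambda>x. jet \<psi> x - V x) (\<lambda>x. jet \<psi> x - V x) < e"
      using V e unfolding H_def by blast
    let ?a = "\<lambda>x. jet \<phi> x - U x" and ?b = "\<lambda>x. jet \<psi> x - V x" and ?\<chi> = "\<lambda>x. (1/2) * (\<phi> x + \<psi> x)"
    have "jet ?\<chi> x - (1/2) *\<^sub>R (U x + V x) = (1/2) *\<^sub>R (?a x + ?b x)" for x
      unfolding jet_add[OF \<phi>(1) \<psi>(1)] by (simp only: scaleR_diff_right[symmetric] add_diff_add)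
    then have "ip M (\<lambda>x. jet ?\<chi> x - (1/2) *\<^sub>R (U x + V x)) (\<lambda>x. jet ?\<chi> x - (1/2) *\<^sub>R (U x + V x))
        = (1/4) * ip M (\<lambda>x. ?a x + ?b x) (\<lambda>x. ?a x + ?b x)"
      by (simp only: ip_scaleR_left ip_scaleR_right)
    also have "\<dots> < e"
      using ip_sum_le[OF L2_diff[OF L2_jet[OF \<phi>(1)] UL] L2_diff[OF L2_jet[OF \<psi>(1)] VL]] \<phi>(2) \<psi>(2) by linarith
    finally show ?thesis
      using test_functions_scale[OF test_functions_add[OF \<phi>(1) \<psi>(1)], of "1/2"] by blast
  qed
  moreover have "ip M (\<lambda>x. (1/2) *\<^sub>R (U x + V x)) (parts_field \<phi> i) = 0" if "\<phi> \<in> test_functions \<Omega>" for \<phi> i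
    using U V that unfolding ip_scaleR_left ip_add_left[OF UL VL L2_parts_field[OF that]] by (simp add: H_def)
  ultimately show ?thesis using L2_scaleR[OF L2_add[OF UL VL]] by (simp add: H_def)
qed

lemma H_limit:
  assumes X: "\<And>n. X n \<in> H" and f: "f \<in> L2 M" and lim: "L2_lim M X f"
  shows "f \<in> H"
proof -
  have XL: "X n \<in> L2 M" for n using X by (rule H_L2)
  have "ip M f (parts_field \<phi> i) = 0" if \<phi>: "\<phi> \<in> test_functions \<Omega>" for \<phi> i
  proof -
    have "(\<lambda>n. ip M (X n) (parts_field \<phi> i)) \<longlonglongrightarrow> ip M f (parts_field \<phi> i)"
      using L2_parts_field[OF \<phi>] by (rule L2_lim_ip[OF lim XL f])
    moreover have "ip M (X n) (parts_field \<phi> i) = 0" for n using X[of n] \<phi> unfolding H_def by blast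
    ultimately show ?thesis by (simp add: LIMSEQ_const_iff)
  qed
  moreover have "\<exists>\<phi>\<in>test_functions \<Omega>. ip M (\<lambda>x. jet \<phi> x - f x) (\<lambda>x. jet \<phi> x - f x) < e" if e: "0 < e" for e
  proof -
    have "\<forall>\<^sub>F n in sequentially. ip M (\<lambda>x. X n x - f x) (\<lambda>x. X n x - f x) < e/4"
      using lim e unfolding L2_lim_def by (intro order_tendstoD(2)[of _ 0]) auto
    then obtain n where n: "ip M (\<lambda>x. X n x - f x) (\<lambda>x. X n x - f x) < e/4"
      unfolding eventually_sequentially by blast
    \<comment> \<open>\<open>ip_sum_le\<close> doubles each of the two squared errors, so a quarter
      of \<open>e\<close> for each suffices.\<close>
    have "0 < e/4" using e by simp
    then obtain \<phi> where \<phi>: "\<phi> \<in> test_functions \<Omega>" "ip M (\<lambda>x. jet \<phi> x - X n x) (\<lambda>x. jet \<phi> x - X n x) < e/4"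
      using X[of n] unfolding H_def by blast
    have "ip M (\<lambda>x. (jet \<phi> x - X n x) + (X n x - f x)) (\<lambda>x. (jet \<phi> x - X n x) + (X n x - f x)) < e"
      using ip_sum_le[OF L2_diff[OF L2_jet[OF \<phi>(1)] XL[of n]] L2_diff[OF XL[of n] f]] n \<phi>(2) by linarith
    then show ?thesis using \<phi>(1) by (intro bexI[of _ \<phi>]) simp_all
  qed
  ultimately show ?thesis using f by (simp add: H_def)
qed

lemma H_jet_sequence:
  assumes U: "U \<in> H"
  shows "\<exists>\<phi>. (\<forall>n. \<phi> n \<in> test_functions \<Omega>) \<and> L2_lim M (\<lambda>n. jet (\<phi> n)) U"
proof -
  let ?d = "\<lambda>\<phi>. ip M (\<lambda>x. jet \<phi> x - U x) (\<lambda>x. jet \<phi> x - U x)"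
  have "\<forall>n. \<exists>\<phi>. \<phi> \<in> test_functions \<Omega> \<and> ?d \<phi> < inverse (real (Suc n))"
  proof
    fix n
    have "0 < inverse (real (Suc n))" by simp
    then show "\<exists>\<phi>. \<phi> \<in> test_functions \<Omega> \<and> ?d \<phi> < inverse (real (Suc n))"
      using U unfolding H_def by blast
  qed
  then obtain \<phi> where "\<forall>n. \<phi> n \<in> test_functions \<Omega> \<and> ?d (\<phi> n) < inverse (real (Suc n))"
    by (rule choice[THEN exE])
  then have \<phi>: "\<phi> n \<in> test_functions \<Omega>" "?d (\<phi> n) < inverse (real (Suc n))" for n
    by simp_all
  have "L2_lim M (\<lambda>n. jet (\<phi> n)) U"
    unfolding L2_lim_def
  proof (rule Lim_null_comparison[OF _ LIMSEQ_inverse_real_of_nat], rule always_eventually, rule allI)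
    show "norm (?d (\<phi> n)) \<le> inverse (real (Suc n))" for n
      using \<phi>(2)[of n] ip_nonneg[of M "\<lambda>x. jet (\<phi> n) x - U x"] by simp
  qed
  then show ?thesis using \<phi>(1) by blast
qed

subsection \<open>Eigenvalue pairs\<close>

lemma measurable_matrix_vector:
  fixes A :: "real^2 \<Rightarrow> real^2^2" and v :: "real^2 \<Rightarrow> real^2"
  assumes "A \<in> borel_measurable M" "v \<in> borel_measurable M"
  shows "(\<lambda>x. A x *v v x) \<in> borel_measurable M"
  using assms
proof (rule borel_measurable_continuous_Pair)
  show "continuous_on UNIV (\<lambda>x. fst x *v snd x :: real^2)"
    unfolding matrix_vector_mult_def by (intro continuous_intros)
qed

lemma metric_measurable:
  fixes g :: "real^2 \<Rightarrow> real^2^2"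
  assumes g: "g \<in> riemannian_metrics \<Omega>"
  shows "vol_density g \<in> borel_measurable M" "flux g \<in> borel_measurable M"
  using continuous_on_subset[OF vol_density_continuous[OF g] closure_subset]
    continuous_on_subset[OF flux_continuous[OF g] closure_subset]
  by (auto intro: continuous_measurable)

lemma L2_bop:
  assumes g: "g \<in> riemannian_metrics \<Omega>" and V: "V \<in> L2 M"
  shows "(\<lambda>x. bop g \<mu> x (V x)) \<in> L2 M"
proof -
  obtain C where C: "\<forall>x\<in>closure \<Omega>. \<forall>V. norm (bop g \<mu> x V) \<le> C * norm V"
    using bop_bounded[OF g bounded_\<Omega>] by blast
  show ?thesis
  proof (rule L2_bound[OF V])
    have "(\<lambda>x. - \<mu> * vol_density g x * fst (V x)) \<in> borel_measurable M"
      using metric_measurable(1)[OF g] L2_measurable[OF L2_fst[OF V]]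
      by (intro borel_measurable_times borel_measurable_const)
    moreover have "(\<lambda>x. flux g x *v snd (V x)) \<in> borel_measurable M"
      using metric_measurable(2)[OF g] L2_measurable[OF L2_snd[OF V]]
      by (rule measurable_matrix_vector)
    ultimately show "(\<lambda>x. bop g \<mu> x (V x)) \<in> borel_measurable M"
      unfolding bop_def by (rule borel_measurable_Pair)
    show "norm (bop g \<mu> x (V x)) \<le> C * norm (V x)" if "x \<in> space M" for x
      using C that \<Omega>_closure unfolding space_M by blast
  qed
qed

lemma ip_bop_symmetric:
  assumes g: "g \<in> riemannian_metrics \<Omega>"
  shows "ip M U (\<lambda>x. bop g \<mu> x (V x)) = ip M (\<lambda>x. bop g \<mu> x (U x)) V"
  unfolding ip_def
  by (rule Bochner_Integration.integral_cong[OF refl]) (use bop_symmetric[OF g] \<Omega>_closure in simp)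

lemma ip_bop_swap:
  assumes "g \<in> riemannian_metrics \<Omega>"
  shows "ip M U (\<lambda>x. bop g \<mu> x (V x)) = ip M V (\<lambda>x. bop g \<mu> x (U x))"
  unfolding ip_bop_symmetric[OF assms, of U \<mu> V] by (rule ip_commute)

definition eigenpair :: "(real^2 \<Rightarrow> real^2^2) \<Rightarrow> real \<Rightarrow> (real^2 \<Rightarrow> real \<times> (real^2)) \<Rightarrow> bool" where
  "eigenpair g \<mu> U \<longleftrightarrow> U \<in> H \<and> (\<forall>\<phi>\<in>test_functions \<Omega>. ip M U (\<lambda>x. bop g \<mu> x (jet \<phi> x)) = 0)"

lemma eigenpair_H: "eigenpair g \<mu> U \<Longrightarrow> U \<in> H"
  unfolding eigenpair_def by blast

text \<open>Jets of test functions are dense in \<open>H\<close>. Symmetry moves the operator onto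
  the fixed pair \<open>U\<close>, so only the other factor varies in the limit.\<close>

lemma eigenpair_test:
  assumes g: "g \<in> riemannian_metrics \<Omega>" and U: "eigenpair g \<mu> U" and V: "V \<in> H"
  shows "ip M U (\<lambda>x. bop g \<mu> x (V x)) = 0"
proof -
  obtain \<phi> where \<phi>: "\<And>n. \<phi> n \<in> test_functions \<Omega>" "L2_lim M (\<lambda>n. jet (\<phi> n)) V"
    using H_jet_sequence[OF V] by blast
  let ?W = "\<lambda>x. bop g \<mu> x (U x)"
  have W: "?W \<in> L2 M" using H_L2[OF eigenpair_H[OF U]] by (rule L2_bop[OF g])
  have "(\<lambda>n. ip M (jet (\<phi> n)) ?W) \<longlonglongrightarrow> ip M V ?W"
    by (rule L2_lim_ip[OF \<phi>(2) L2_jet[OF \<phi>(1)] H_L2[OF V] W])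
  moreover have "ip M (jet (\<phi> n)) ?W = 0" for n
    using U \<phi>(1) ip_bop_swap[OF g, of "jet (\<phi> n)" \<mu> U] unfolding eigenpair_def by simp
  ultimately have "ip M V ?W = 0" by (simp add: LIMSEQ_const_iff)
  then show ?thesis using ip_bop_swap[OF g, of V \<mu> U] by simp
qed

lemma L2_weighted:
  fixes f :: "real^2 \<Rightarrow> real"
  assumes g: "g \<in> riemannian_metrics \<Omega>" and f: "f \<in> L2 M"
  shows "(\<lambda>x. vol_density g x * f x) \<in> L2 M" "(\<lambda>x. sqrt (vol_density g x) * f x) \<in> L2 M"
proof -
  obtain C where C: "C > 0" "\<forall>x\<in>closure \<Omega>. vol_density g x \<le> C \<and> norm (flux g x) \<le> C"
    using coeffs_bounded[OF g bounded_\<Omega>] by blast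
  have pos: "0 < vol_density g x" "vol_density g x \<le> C" if "x \<in> space M" for x
    using that vol_density_pos[OF g] C(2) \<Omega>_closure by auto
  show "(\<lambda>x. vol_density g x * f x) \<in> L2 M"
  proof (rule L2_bound[OF f])
    show "(\<lambda>x. vol_density g x * f x) \<in> borel_measurable M"
      using metric_measurable(1)[OF g] L2_measurable[OF f] by (rule borel_measurable_times)
    show "norm (vol_density g x * f x) \<le> C * norm (f x)" if "x \<in> space M" for x
      using pos[OF that] by (simp add: abs_mult mult_right_mono)
  qed
  show "(\<lambda>x. sqrt (vol_density g x) * f x) \<in> L2 M"
  proof (rule L2_bound[OF f])
    show "(\<lambda>x. sqrt (vol_density g x) * f x) \<in> borel_measurable M"
      using borel_measurable_continuous_on[OF continuous_on_real_sqrt[OF continuous_on_id] metric_measurable(1)[OF g]] L2_measurable[OF f] by (rule borel_measurable_times)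
    show "norm (sqrt (vol_density g x) * f x) \<le> sqrt C * norm (f x)" if "x \<in> space M" for x
      using pos[OF that] by (simp add: abs_mult mult_right_mono)
  qed
qed

text \<open>Testing each equation with the other pair and subtracting cancels the gradient terms and
  leaves the difference of the eigenvalues times the weighted inner product. Splitting the weight
  into square roots gives orthogonality in the unweighted sense of
  \<open>orthogonal_card_le\<close>.\<close>

lemma eigenpairs_orthogonal:
  assumes g: "g \<in> riemannian_metrics \<Omega>" and U: "eigenpair g \<mu> U" and V: "eigenpair g \<nu> V" and ne: "\<mu> \<noteq> \<nu>"
  shows "ip M (\<lambda>x. sqrt (vol_density g x) * fst (U x)) (\<lambda>x. sqrt (vol_density g x) * fst (V x)) = 0"
proof -
  have UL: "U \<in> L2 M" and VL: "V \<in> L2 M" using U V by (auto intro: H_L2 eigenpair_H)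
  let ?u = "\<lambda>x. sqrt (vol_density g x) * fst (U x)" and ?v = "\<lambda>x. sqrt (vol_density g x) * fst (V x)"
  have "ip M U (\<lambda>x. bop g \<nu> x (V x)) - ip M U (\<lambda>x. bop g \<mu> x (V x))
      = ip M U (\<lambda>x. bop g \<nu> x (V x) - bop g \<mu> x (V x))"
    using ip_diff_right[OF L2_bop[OF g VL] L2_bop[OF g VL] UL] by simp
  also have "\<dots> = (\<mu> - \<nu>) * ip M ?u ?v"
    unfolding ip_scaleR_left[symmetric] unfolding ip_def
  proof (rule Bochner_Integration.integral_cong[OF refl])
    fix x assume "x \<in> space M"
    then have "0 < vol_density g x" using vol_density_pos[OF g \<Omega>_closure] by simp
    then have "sqrt (vol_density g x) * sqrt (vol_density g x) = vol_density g x" by simp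
    then have key: "(sqrt (vol_density g x) * fst (U x)) * (sqrt (vol_density g x) * fst (V x))
        = vol_density g x * (fst (U x) * fst (V x))" by (metis mult.assoc mult.left_commute)
    have "U x \<bullet> (bop g \<nu> x (V x) - bop g \<mu> x (V x)) = (\<mu> - \<nu>) * (vol_density g x * (fst (U x) * fst (V x)))"
      by (simp add: bop_def inner_prod_def algebra_simps)
    also have "\<dots> = ((\<mu> - \<nu>) *\<^sub>R ?u x) \<bullet> ?v x"
      unfolding key[symmetric] by (simp only: real_scaleR_def inner_real_def mult.assoc)
    finally show "U x \<bullet> (bop g \<nu> x (V x) - bop g \<mu> x (V x)) = ((\<mu> - \<nu>) *\<^sub>R ?u x) \<bullet> ?v x" .
  qed
  also have "ip M U (\<lambda>x. bop g \<nu> x (V x)) = 0"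
    using eigenpair_test[OF g V eigenpair_H[OF U]] ip_bop_swap[OF g, of U \<nu> V] by simp
  also have "ip M U (\<lambda>x. bop g \<mu> x (V x)) = 0"
    by (rule eigenpair_test[OF g U eigenpair_H[OF V]])
  finally show ?thesis using ne by simp
qed

section \<open>Metrics with a normalized eigenpair form a closed set\<close>

text \<open>Unlike a unit norm, unit integral over \<open>B\<close> survives weak limits, which makes this set closed.\<close>

definition eigen_metrics :: "real \<Rightarrow> (real^2) set \<Rightarrow> real \<Rightarrow> (real^2 \<Rightarrow> real^2^2) set" where
  "eigen_metrics \<mu> B K = {g \<in> riemannian_metrics \<Omega>. \<exists>U. eigenpair g \<mu> U \<and> ip M U U \<le> K \<and>
     ip M U (\<lambda>x. (indicator B x, 0)) = 1}"

lemma L2_indicator: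
  assumes "B \<in> sets borel"
  shows "(indicator B :: real^2 \<Rightarrow> real) \<in> L2 M"
proof -
  have "B \<in> sets lebesgue" using assms by (intro sets_completionI_sets) simp
  then have "(indicator B :: real^2 \<Rightarrow> real) \<in> borel_measurable M"
    by (intro measurable_restrict_space1 borel_measurable_indicator)
  then show ?thesis by (intro L2_bounded[of _ 1]) (simp_all add: indicator_def)
qed

text \<open>If \<open>g\<close> had normalized approximate eigenpairs for every tolerance, a norm
  limit would be an exact one. So some tolerance admits none, while any metric of the family close
  enough to \<open>g\<close> would supply one.\<close>

lemma openin_not_eigen_metrics:
  assumes B: "B \<in> sets borel"
  shows "openin (metrics_topology \<Omega>) (riemannian_metrics \<Omega> - eigen_metrics \<mu> B K)"
  unfolding openin_metrics_topology
proof (intro conjI ballI)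
  fix g assume "g \<in> riemannian_metrics \<Omega> - eigen_metrics \<mu> B K"
  then have g: "g \<in> riemannian_metrics \<Omega>" and not: "g \<notin> eigen_metrics \<mu> B K" by auto
  let ?b = "\<lambda>x. (indicator B x :: real, 0 :: real^2)"
  have b: "?b \<in> L2 M" by (rule L2_Pair[OF L2_indicator[OF B] L2_zero])
  define e where "e n = inverse (real (Suc n))" for n
  have epos: "0 < e n" and edec: "e (Suc n) \<le> e n" for n by (simp_all add: e_def)
  \<comment> \<open>Approximate eigenpairs of \<open>g\<close> with tolerance \<open>e n\<close>.
    Every condition is preserved by midpoints, and the right hand side is the bound that
    Cauchy-Schwarz yields below for an eigenpair of a nearby metric.\<close>
  define C where "C n = {U \<in> H. ip M U U \<le> K \<and> ip M U ?b = 1 \<and> (\<forall>\<phi>\<in>test_functions \<Omega>.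
    \<bar>ip M U (\<lambda>x. bop g \<mu> x (jet \<phi> x))\<bar> \<le> e n * (sqrt K * sqrt (ip M (jet \<phi>) (jet \<phi>))))}" for n
  have T: "(\<lambda>x. bop g \<mu> x (jet \<phi> x)) \<in> L2 M" if "\<phi> \<in> test_functions \<Omega>" for \<phi>
    by (rule L2_bop[OF g L2_jet[OF that]])
  have "\<exists>n. C n = {}"
  proof (rule ccontr)
    assume "\<nexists>n. C n = {}"
    then have ne: "C n \<noteq> {}" for n by blast
    have sub: "C n \<subseteq> L2 M" for n unfolding C_def by (auto intro: H_L2)
    \<comment> \<open>The sign of \<open>K\<close> is read off from an element of
      \<open>C 0\<close>; it is needed to compare the tolerances.\<close>
    have K: "0 \<le> K" using ne[of 0] ip_nonneg order_trans unfolding C_def by blast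
    have dec: "C (Suc n) \<subseteq> C n" for n
    proof
      fix U assume U: "U \<in> C (Suc n)"
      have "\<bar>ip M U (\<lambda>x. bop g \<mu> x (jet \<phi> x))\<bar> \<le> e n * (sqrt K * sqrt (ip M (jet \<phi>) (jet \<phi>)))"
        if "\<phi> \<in> test_functions \<Omega>" for \<phi>
      proof -
        have "\<bar>ip M U (\<lambda>x. bop g \<mu> x (jet \<phi> x))\<bar> \<le> e (Suc n) * (sqrt K * sqrt (ip M (jet \<phi>) (jet \<phi>)))"
          using U that unfolding C_def by blast
        also have "\<dots> \<le> e n * (sqrt K * sqrt (ip M (jet \<phi>) (jet \<phi>)))"
          using K ip_nonneg by (intro mult_right_mono[OF edec] mult_nonneg_nonneg real_sqrt_ge_zero)
        finally show ?thesis .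
      qed
      then show "U \<in> C n" using U unfolding C_def by blast
    qed
    have mid: "(\<lambda>x. (1/2) *\<^sub>R (U x + V x)) \<in> C n" if U: "U \<in> C n" and V: "V \<in> C n" for n U V
    proof -
      have UH: "U \<in> H" "V \<in> H" using U V unfolding C_def by auto
      have UL: "U \<in> L2 M" "V \<in> L2 M" using UH by (auto intro: H_L2)
      have avg: "ip M (\<lambda>x. (1/2) *\<^sub>R (U x + V x)) W = (ip M U W + ip M V W) / 2" if "W \<in> L2 M" for W
        unfolding ip_scaleR_left ip_add_left[OF UL that] by simp
      have "ip M (\<lambda>x. (1/2) *\<^sub>R (U x + V x)) (\<lambda>x. (1/2) *\<^sub>R (U x + V x))
          = (1/4) * ip M (\<lambda>x. U x + V x) (\<lambda>x. U x + V x)"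
        unfolding ip_scaleR_left ip_scaleR_right by simp
      also have "\<dots> \<le> K"
        using ip_sum_le[OF UL] U V unfolding C_def by simp
      finally have n: "ip M (\<lambda>x. (1/2) *\<^sub>R (U x + V x)) (\<lambda>x. (1/2) *\<^sub>R (U x + V x)) \<le> K" .
      have p: "ip M (\<lambda>x. (1/2) *\<^sub>R (U x + V x)) ?b = 1"
        unfolding avg[OF b] using U V unfolding C_def by simp
      have "\<bar>ip M (\<lambda>x. (1/2) *\<^sub>R (U x + V x)) (\<lambda>x. bop g \<mu> x (jet \<phi> x))\<bar>
          \<le> e n * (sqrt K * sqrt (ip M (jet \<phi>) (jet \<phi>)))" if \<phi>: "\<phi> \<in> test_functions \<Omega>" for \<phi>
      proof -
        have "\<bar>ip M U (\<lambda>x. bop g \<mu> x (jet \<phi> x))\<bar> \<le> e n * (sqrt K * sqrt (ip M (jet \<phi>) (jet \<phi>)))"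
          "\<bar>ip M V (\<lambda>x. bop g \<mu> x (jet \<phi> x))\<bar> \<le> e n * (sqrt K * sqrt (ip M (jet \<phi>) (jet \<phi>)))"
          using U V \<phi> unfolding C_def by blast+
        moreover have "\<bar>(p + q) / 2\<bar> \<le> t" if "\<bar>p\<bar> \<le> t" "\<bar>q\<bar> \<le> t" for p q t :: real
          using that by (simp add: abs_le_iff)
        ultimately show ?thesis unfolding avg[OF T[OF \<phi>]] by blast
      qed
      then show ?thesis using H_midpoint[OF UH] n p unfolding C_def by blast
    qed
    have bdd: "ip M U U \<le> K" if "U \<in> C n" for n U using that unfolding C_def by blast
    have "\<exists>X. \<exists>f\<in>L2 M. (\<forall>n. X n \<in> C n) \<and> L2_lim M X f"
      by (rule L2_nested_convex[of C K]) (fact sub ne dec mid bdd)+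
    then obtain X U where UL: "U \<in> L2 M" and XC: "\<And>n. X n \<in> C n" and lim: "L2_lim M X U"
      by blast
    have XH: "X n \<in> H" for n using XC[of n] unfolding C_def by blast
    have XL: "X n \<in> L2 M" for n using XH by (rule H_L2)
    have "U \<in> H" by (rule H_limit[OF XH UL lim])
    moreover have "ip M U U \<le> K" by (rule L2_lim_ip_self_le[OF lim XL UL bdd[OF XC]])
    moreover have "ip M U ?b = 1"
    proof -
      have "(\<lambda>n. ip M (X n) ?b) \<longlonglongrightarrow> ip M U ?b" by (rule L2_lim_ip[OF lim XL UL b])
      moreover have "ip M (X n) ?b = 1" for n using XC[of n] unfolding C_def by blast
      ultimately show ?thesis by (simp add: LIMSEQ_const_iff)
    qed
    moreover have "ip M U (\<lambda>x. bop g \<mu> x (jet \<phi> x)) = 0" if \<phi>: "\<phi> \<in> test_functions \<Omega>" for \<phi>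
    proof -
      let ?s = "sqrt K * sqrt (ip M (jet \<phi>) (jet \<phi>))"
      have "(\<lambda>n. ip M (X n) (\<lambda>x. bop g \<mu> x (jet \<phi> x))) \<longlonglongrightarrow> 0"
      proof (rule Lim_null_comparison)
        show "\<forall>\<^sub>F n in sequentially. norm (ip M (X n) (\<lambda>x. bop g \<mu> x (jet \<phi> x))) \<le> e n * ?s"
          using XC \<phi> unfolding C_def by (intro always_eventually allI) simp
        show "(\<lambda>n. e n * ?s) \<longlonglongrightarrow> 0"
          unfolding e_def using tendsto_mult_left_zero[OF LIMSEQ_inverse_real_of_nat, of ?s] .
      qed
      moreover have "(\<lambda>n. ip M (X n) (\<lambda>x. bop g \<mu> x (jet \<phi> x))) \<longlonglongrightarrow> ip M U (\<lambda>x. bop g \<mu> x (jet \<phi> x))"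
        by (rule L2_lim_ip[OF lim XL UL T[OF \<phi>]])
      ultimately show ?thesis using LIMSEQ_unique by blast
    qed
    ultimately have "g \<in> eigen_metrics \<mu> B K"
      unfolding eigen_metrics_def eigenpair_def using g by blast
    then show False using not by blast
  qed
  then obtain n where n: "C n = {}" by blast
  obtain d where d: "0 < d" "\<And>h x V. x \<in> \<Omega> \<Longrightarrow> norm (h x - g x) < d \<Longrightarrow>
      norm (bop g \<mu> x V - bop h \<mu> x V) \<le> e n * norm V"
    using bop_close[OF g bounded_\<Omega> epos[of n], of \<mu>] by blast
  \<comment> \<open>Order zero closeness is enough, since \<open>bop\<close> involves no derivatives
    of the metric.\<close>
  have "h \<notin> eigen_metrics \<mu> B K" if h: "h \<in> riemannian_metrics \<Omega>" and close: "Ck_close \<Omega> 0 d g h" for h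
  proof
    assume "h \<in> eigen_metrics \<mu> B K"
    then obtain U where U: "eigenpair h \<mu> U" "ip M U U \<le> K" "ip M U ?b = 1"
      unfolding eigen_metrics_def by blast
    have UL: "U \<in> L2 M" using U(1) by (intro H_L2 eigenpair_H)
    have nd: "norm (h x - g x) < d" if "x \<in> \<Omega>" for x
      using close that unfolding Ck_close_def by force
    have "\<bar>ip M U (\<lambda>x. bop g \<mu> x (jet \<phi> x))\<bar> \<le> e n * (sqrt K * sqrt (ip M (jet \<phi>) (jet \<phi>)))"
      if \<phi>: "\<phi> \<in> test_functions \<Omega>" for \<phi>
    proof -
      let ?D = "\<lambda>x. bop g \<mu> x (jet \<phi> x) - bop h \<mu> x (jet \<phi> x)"
      have hL: "(\<lambda>x. bop h \<mu> x (jet \<phi> x)) \<in> L2 M" by (rule L2_bop[OF h L2_jet[OF \<phi>]])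
      have D: "?D \<in> L2 M" by (rule L2_diff[OF T[OF \<phi>] hL])
      have "ip M ?D ?D \<le> (e n)\<^sup>2 * ip M (jet \<phi>) (jet \<phi>)"
        using epos[of n] d(2) nd by (intro ip_bound_pointwise[OF D L2_jet[OF \<phi>]]) auto
      then have "sqrt (ip M ?D ?D) \<le> sqrt ((e n)\<^sup>2 * ip M (jet \<phi>) (jet \<phi>))" by (rule real_sqrt_le_mono)
      also have "\<dots> = e n * sqrt (ip M (jet \<phi>) (jet \<phi>))"
        using epos[of n] by (simp add: real_sqrt_mult)
      finally have sD: "sqrt (ip M ?D ?D) \<le> e n * sqrt (ip M (jet \<phi>) (jet \<phi>))" .
      \<comment> \<open>The term with \<open>h\<close> vanishes because \<open>U\<close> solves the
        equation of \<open>h\<close>; the defect for \<open>g\<close> is the pairing with the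
        difference of the operators.\<close>
      have "ip M U ?D = ip M U (\<lambda>x. bop g \<mu> x (jet \<phi> x))"
        using ip_diff_right[OF T[OF \<phi>] hL UL] U(1) \<phi> unfolding eigenpair_def by simp
      then have "\<bar>ip M U (\<lambda>x. bop g \<mu> x (jet \<phi> x))\<bar> \<le> sqrt (ip M U U) * sqrt (ip M ?D ?D)"
        using ip_abs_le[OF UL D] by simp
      also have "\<dots> \<le> sqrt K * (e n * sqrt (ip M (jet \<phi>) (jet \<phi>)))"
        using U(2) sD ip_nonneg[of M U] ip_nonneg[of M ?D]
        by (intro mult_mono) auto
      finally show ?thesis by (simp add: mult.left_commute)
    qed
    then have "U \<in> C n" using U eigenpair_H[OF U(1)] unfolding C_def by blast
    then show False using n by blast
  qed
  then show "\<exists>k. \<exists>\<epsilon>>0. \<forall>h\<in>riemannian_metrics \<Omega>. Ck_close \<Omega> k \<epsilon> g h \<longrightarrow> h \<in> riemannian_metrics \<Omega> - eigen_metrics \<mu> B K"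
    using d(1) by (intro exI[of _ 0] exI[of _ d]) blast
qed blast

subsection \<open>The Dirichlet spectrum\<close>

text \<open>The gradient in the weak Laplacian is only locally integrable, so integrability against
  a test function must come from its compact support.\<close>

lemma locally_integrable_times_test:
  fixes w :: "real^2 \<Rightarrow> real^2"
  assumes w: "w locally_integrable_on \<Omega>" and \<theta>: "\<theta> \<in> test_functions \<Omega>"
  shows "integrable M (\<lambda>x. w x $ i * \<theta> x)"
proof -
  define K where "K = closure {x. \<theta> x \<noteq> 0}"
  have K: "compact K" "K \<subseteq> \<Omega>" using \<theta> by (auto simp: test_functions_def K_def)
  have KL: "K \<in> sets lebesgue" using K(1) by (intro sets_completionI_sets) (simp add: compact_imp_closed)
  have out: "\<theta> x = 0" if "x \<notin> K" for x
    using test_functions_outside[OF \<theta>, of x "[]"] that by (simp add: K_def)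
  obtain B where B: "\<forall>x. \<bar>\<theta> x\<bar> \<le> B" using test_functions_bounded[OF \<theta>] by blast
  have "w absolutely_integrable_on K" using w K unfolding locally_integrable_on_def by blast
  then have "(\<lambda>x. w x \<bullet> axis i 1) absolutely_integrable_on K" by (rule absolutely_integrable_component)
  then have wi: "(\<lambda>x. w x $ i) absolutely_integrable_on K" by (simp add: inner_axis)
  have "\<theta> \<in> borel_measurable (lebesgue_on K)"
    using continuous_on_subset[OF test_functions_continuous[OF \<theta>] subset_UNIV]
    by (intro continuous_imp_measurable_on_sets_lebesgue KL)
  moreover have "bounded (\<theta> ` K)" using B by (auto simp: bounded_iff)
  ultimately have "(\<lambda>x. \<theta> x * w x $ i) absolutely_integrable_on K"
    by (intro absolutely_integrable_bounded_measurable_product[OF bilinear_times _ KL _ wi])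
  moreover have "(\<lambda>x. indicator K x *\<^sub>R (\<theta> x * w x $ i)) = (\<lambda>x. indicator \<Omega> x *\<^sub>R (w x $ i * \<theta> x))"
  proof
    show "indicator K x *\<^sub>R (\<theta> x * w x $ i) = indicator \<Omega> x *\<^sub>R (w x $ i * \<theta> x)" for x
      using out[of x] K(2) by (auto simp: indicator_def)
  qed
  ultimately have "set_integrable lebesgue \<Omega> (\<lambda>x. w x $ i * \<theta> x)"
    unfolding set_integrable_def by (simp only:)
  then show ?thesis by (simp only: set_integrable_eq)
qed

text \<open>The two weak gradients occurring in the definition of the spectrum agree only almost everywhere.
  Testing both with the fields \<open>flux g *v gradient \<phi>\<close> avoids proving this.\<close>

lemma weak_gradient_exchange:
  assumes g: "g \<in> riemannian_metrics \<Omega>" and \<phi>: "\<phi> \<in> test_functions \<Omega>"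
    and w: "has_weak_gradient \<Omega> u w" and w': "has_weak_gradient \<Omega> u w'"
  shows "(\<integral>x. w x \<bullet> (flux g x *v gradient \<phi> x) \<partial>M) = (\<integral>x. w' x \<bullet> (flux g x *v gradient \<phi> x) \<partial>M)"
proof -
  \<comment> \<open>The components of this field are themselves test functions, so each weak
    gradient can be traded for an integral that involves \<open>u\<close> alone.\<close>
  define \<theta> where "\<theta> i x = (\<Sum>j\<in>UNIV. flux g x $ i $ j * partial_deriv j \<phi> x)" for i x
  have \<theta>: "\<theta> i \<in> test_functions \<Omega>" for i
    unfolding \<theta>_def
    by (intro test_functions_sum test_functions_mult[OF open_\<Omega>] test_functions_partial_deriv[OF \<phi>]
        smooth_on_flux[OF open_\<Omega> g])
  have expand: "v \<bullet> (flux g x *v gradient \<phi> x) = (\<Sum>i\<in>UNIV. v $ i * \<theta> i x)" for v x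
    by (simp add: inner_vec_def matrix_vector_mult_def gradient_def \<theta>_def)
  have "(\<integral>x. v x \<bullet> (flux g x *v gradient \<phi> x) \<partial>M) = (\<Sum>i\<in>UNIV. - (\<integral>x. u x * partial_deriv i (\<theta> i) x \<partial>M))"
    if v: "has_weak_gradient \<Omega> u v" for v
  proof -
    have "v locally_integrable_on \<Omega>" using v unfolding has_weak_gradient_def by blast
    then have "(\<integral>x. v x \<bullet> (flux g x *v gradient \<phi> x) \<partial>M) = (\<Sum>i\<in>UNIV. \<integral>x. v x $ i * \<theta> i x \<partial>M)"
      unfolding expand by (intro Bochner_Integration.integral_sum locally_integrable_times_test \<theta>)
    also have "\<dots> = (\<Sum>i\<in>UNIV. - (\<integral>x. u x * partial_deriv i (\<theta> i) x \<partial>M))"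
      using v \<theta> unfolding has_weak_gradient_def set_integral_eq by (intro sum.cong refl) simp
    finally show ?thesis .
  qed
  from this[OF w] this[OF w'] show ?thesis by (rule trans[OF _ sym])
qed

lemma spectrum_imp_eigenpair:
  assumes g: "g \<in> riemannian_metrics \<Omega>" and \<mu>: "\<mu> \<in> dirichlet_spectrum \<Omega> g"
  shows "\<exists>U. eigenpair g \<mu> U \<and> \<not> (AE x in M. fst (U x) = 0)"
proof -
  obtain u where u: "u \<in> H10 \<Omega>" "\<not> (AE x in M. u x = 0)" "has_weak_laplacian \<Omega> g u (\<lambda>x. - \<mu> * u x)"
    using \<mu> unfolding dirichlet_spectrum_def by blast
  obtain w where w: "u square_integrable_on \<Omega>" "w square_integrable_on \<Omega>" "has_weak_gradient \<Omega> u w"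
    and approx: "\<And>\<epsilon>. 0 < \<epsilon> \<Longrightarrow> \<exists>\<phi>\<in>test_functions \<Omega>.
      (LINT x:\<Omega>|lebesgue. (\<phi> x - u x)\<^sup>2 + (norm (gradient \<phi> x - w x))\<^sup>2) < \<epsilon>"
    using u(1) unfolding H10_def by blast
  obtain w' where w': "has_weak_gradient \<Omega> u w'"
    and lap: "has_weak_divergence \<Omega> g (\<lambda>x. matrix_inv (g x) *v w' x) (\<lambda>x. - \<mu> * u x)"
    using u(3) unfolding has_weak_laplacian_def by blast
  define U where "U x = (u x, w x)" for x
  have uL: "u \<in> L2 M" and wL: "w \<in> L2 M" using w(1,2) by (simp_all add: L2_def square_integrable_on_def)
  have UL: "U \<in> L2 M" unfolding U_def by (rule L2_Pair[OF uL wL])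
  have "has_weak_gradient \<Omega> (\<lambda>x. fst (U x)) (\<lambda>x. snd (U x))" using w(3) by (simp add: U_def)
  then have "\<forall>\<phi>\<in>test_functions \<Omega>. \<forall>i. ip M U (parts_field \<phi> i) = 0" by (simp only: weak_gradient_iff[OF UL])
  moreover have "ip M (\<lambda>x. jet \<phi> x - U x) (\<lambda>x. jet \<phi> x - U x)
      = (LINT x:\<Omega>|lebesgue. (\<phi> x - u x)\<^sup>2 + (norm (gradient \<phi> x - w x))\<^sup>2)" for \<phi>
    by (simp add: ip_self set_integral_eq jet_def U_def norm_Pair)
  ultimately have "U \<in> H" using UL approx unfolding H_def by simp
  moreover have "ip M U (\<lambda>x. bop g \<mu> x (jet \<phi> x)) = 0" if \<phi>: "\<phi> \<in> test_functions \<Omega>" for \<phi>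
  proof -
    let ?q = "\<lambda>x. u x * \<phi> x * vol_density g x"
    have fG: "(\<lambda>x. flux g x *v gradient \<phi> x) \<in> L2 M"
      using L2_snd[OF L2_bop[OF g L2_jet[OF \<phi>]]] by (simp add: bop_def jet_def)
    have q: "integrable M ?q"
      using L2_inner_integrable[OF uL L2_weighted(1)[OF g L2_test[OF \<phi>]]] by (simp add: mult_ac)
    \<comment> \<open>\<open>w\<close> comes from membership in \<open>H10\<close> and
      \<open>w'\<close> from the equation; from here on the equation can be used.\<close>
    have "(\<integral>x. w x \<bullet> (flux g x *v gradient \<phi> x) \<partial>M) = (\<integral>x. w' x \<bullet> (flux g x *v gradient \<phi> x) \<partial>M)"
      by (rule weak_gradient_exchange[OF g \<phi> w(3) w'])
    also have "\<dots> = (\<integral>x. ((matrix_inv (g x) *v w' x) \<bullet> gradient \<phi> x) * vol_density g x \<partial>M)"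
    proof (rule Bochner_Integration.integral_cong[OF refl])
      fix x assume "x \<in> space M"
      then have x: "x \<in> closure \<Omega>" using \<Omega>_closure by simp
      have "w' x \<bullet> (flux g x *v gradient \<phi> x) = (flux g x *v w' x) \<bullet> gradient \<phi> x"
        by (rule flux_symmetric[OF g x])
      also have "\<dots> = ((matrix_inv (g x) *v w' x) \<bullet> gradient \<phi> x) * vol_density g x"
        unfolding flux_eq[OF g x] by (simp only: inner_scaleR_left mult.commute)
      finally show "w' x \<bullet> (flux g x *v gradient \<phi> x)
        = ((matrix_inv (g x) *v w' x) \<bullet> gradient \<phi> x) * vol_density g x" .
    qed
    also have "\<dots> = - (\<integral>x. - \<mu> * u x * \<phi> x * vol_density g x \<partial>M)"
      using lap \<phi> unfolding has_weak_divergence_def set_integral_eq by blast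
    also have "\<dots> = \<mu> * (\<integral>x. ?q x \<partial>M)" by (simp add: mult.assoc)
    finally have main: "(\<integral>x. w x \<bullet> (flux g x *v gradient \<phi> x) \<partial>M) = \<mu> * (\<integral>x. ?q x \<partial>M)" .
    have "U x \<bullet> bop g \<mu> x (jet \<phi> x) = - \<mu> * ?q x + w x \<bullet> (flux g x *v gradient \<phi> x)" for x
      by (simp add: U_def bop_def jet_def mult_ac)
    then have "ip M U (\<lambda>x. bop g \<mu> x (jet \<phi> x)) = - \<mu> * (\<integral>x. ?q x \<partial>M) + (\<integral>x. w x \<bullet> (flux g x *v gradient \<phi> x) \<partial>M)"
      unfolding ip_def using q L2_inner_integrable[OF wL fG] by simp
    then show ?thesis using main by simp
  qed
  ultimately have "eigenpair g \<mu> U" unfolding eigenpair_def by blast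
  then show ?thesis using u(2) by (intro exI[of _ U]) (simp add: U_def)
qed

lemma eigenpair_scale:
  assumes "eigenpair g \<mu> U"
  shows "eigenpair g \<mu> (\<lambda>x. c *\<^sub>R U x)"
  using assms H_scale[of U c] unfolding eigenpair_def by (simp add: ip_scaleR_left)

text \<open>A nonzero function has nonzero integral over some set of the generator; dividing by that
  integral normalizes the pair, and some integer exceeds its squared norm.\<close>

lemma eigenpair_in_eigen_metrics:
  assumes g: "g \<in> riemannian_metrics \<Omega>" and U: "eigenpair g \<mu> U" and ne: "\<not> (AE x in M. fst (U x) = 0)"
    and B: "Int_stable \<B>" "UNIV \<in> \<B>" "sets borel = sigma_sets UNIV \<B>"
  shows "\<exists>B\<in>\<B>. \<exists>k::nat. g \<in> eigen_metrics \<mu> B (real k)"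
proof -
  have UL: "U \<in> L2 M" using U by (intro H_L2 eigenpair_H)
  \<comment> \<open>Extension by zero, because the separation result concerns functions on the whole
    space.\<close>
  define v where "v x = indicator \<Omega> x *\<^sub>R fst (U x)" for x
  have v: "integrable lebesgue v"
    unfolding v_def using L2_integrable[OF L2_fst[OF UL]]
    by (simp only: set_integrable_eq[symmetric] set_integrable_def)
  have pair: "(LINT x:A|lebesgue. v x) = ip M U (\<lambda>x. (indicator A x, 0))" for A
  proof -
    have "(LINT x:A|lebesgue. v x) = (LINT x:\<Omega>|lebesgue. fst (U x) * indicator A x)"
      unfolding set_lebesgue_integral_def v_def by (simp add: mult_ac)
    then show ?thesis unfolding set_integral_eq ip_def by (simp add: inner_prod_def)
  qed
  have "\<exists>A\<in>\<B>. (LINT x:A|lebesgue. v x) \<noteq> 0"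
  proof (rule ccontr)
    assume "\<not> ?thesis"
    then have "AE x in lebesgue. v x = 0"
      using AE_zero_of_generator_integrals[OF v B] by blast
    then have "AE x in lebesgue. x \<in> \<Omega> \<longrightarrow> fst (U x) = 0"
      by eventually_elim (auto simp: v_def indicator_def)
    then have "AE x in M. fst (U x) = 0"
      by (subst AE_restrict_space_iff) (simp_all add: \<Omega>_sets)
    then show False using ne by blast
  qed
  then obtain A where A: "A \<in> \<B>" "ip M U (\<lambda>x. (indicator A x, 0)) \<noteq> 0" unfolding pair by blast
  define c where "c = 1 / ip M U (\<lambda>x. (indicator A x, 0))"
  let ?V = "\<lambda>x. c *\<^sub>R U x"
  obtain k :: nat where "ip M ?V ?V \<le> real k" using real_arch_simple by blast
  moreover have "ip M ?V (\<lambda>x. (indicator A x, 0)) = 1"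
    unfolding ip_scaleR_left using A(2) by (simp add: c_def)
  ultimately have "g \<in> eigen_metrics \<mu> A (real k)"
    unfolding eigen_metrics_def using g eigenpair_scale[OF U] by blast
  then show ?thesis using A(1) by blast
qed

text \<open>Choose one normalized eigenpair for each eigenvalue. Weighted by the square root of the
  volume density, their functions are orthogonal, uniformly bounded in norm and pair to one with a
  fixed \<open>z\<close>, so \<open>orthogonal_card_le\<close> limits their number.\<close>

lemma finite_eigen_metrics:
  assumes g: "g \<in> riemannian_metrics \<Omega>" and B: "B \<in> sets borel"
  shows "finite {\<mu>. g \<in> eigen_metrics \<mu> B K}"
proof -
  obtain C where C: "C > 0" "\<forall>x\<in>closure \<Omega>. vol_density g x \<le> C \<and> norm (flux g x) \<le> C"
    using coeffs_bounded[OF g bounded_\<Omega>] by blast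
  obtain c where c: "c > 0" "\<forall>x\<in>closure \<Omega>. c \<le> vol_density g x"
    using vol_density_lower[OF g bounded_\<Omega>] by blast
  have pos: "c \<le> vol_density g x" "vol_density g x \<le> C" if "x \<in> space M" for x
    using that C c \<Omega>_closure by auto
  let ?S = "{\<mu>. g \<in> eigen_metrics \<mu> B K}"
  define P where "P \<mu> U \<longleftrightarrow> eigenpair g \<mu> U \<and> ip M U U \<le> K \<and> ip M U (\<lambda>x. (indicator B x, 0)) = 1" for \<mu> U
  define U where "U \<mu> = (SOME U. P \<mu> U)" for \<mu>
  have "P \<mu> (U \<mu>)" if "\<mu> \<in> ?S" for \<mu>
  proof -
    have "\<exists>U. P \<mu> U" using that unfolding eigen_metrics_def P_def by blast
    then show ?thesis unfolding U_def by (rule someI_ex)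
  qed
  then have U: "eigenpair g \<mu> (U \<mu>)" "ip M (U \<mu>) (U \<mu>) \<le> K" "ip M (U \<mu>) (\<lambda>x. (indicator B x, 0)) = 1"
    if "\<mu> \<in> ?S" for \<mu>
    using that unfolding P_def by blast+
  have UL: "U \<mu> \<in> L2 M" if "\<mu> \<in> ?S" for \<mu> by (rule H_L2[OF eigenpair_H[OF U(1)[OF that]]])
  define y where "y \<mu> x = sqrt (vol_density g x) * fst (U \<mu> x)" for \<mu> x
  \<comment> \<open>The inverse weight cancels the one in \<open>y\<close>, so that the pairing is
    again the plain integral over \<open>B\<close>.\<close>
  define z where "z x = inverse (sqrt (vol_density g x)) * indicator B x" for x
  have yL: "y \<mu> \<in> L2 M" if "\<mu> \<in> ?S" for \<mu>
    unfolding y_def by (rule L2_weighted(2)[OF g L2_fst[OF UL[OF that]]])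
  have zL: "z \<in> L2 M"
  proof (rule L2_bounded[of _ "inverse (sqrt c)"])
    have "(\<lambda>x. sqrt (vol_density g x)) \<in> borel_measurable M"
      using borel_measurable_continuous_on[OF continuous_on_real_sqrt[OF continuous_on_id] metric_measurable(1)[OF g]] .
    then have "(\<lambda>x. inverse (sqrt (vol_density g x))) \<in> borel_measurable M"
      by (rule borel_measurable_inverse)
    then show "z \<in> borel_measurable M"
      unfolding z_def using L2_measurable[OF L2_indicator[OF B]] by (rule borel_measurable_times)
    show "norm (z x) \<le> inverse (sqrt c)" if x: "x \<in> space M" for x
    proof -
      have "sqrt c \<le> sqrt (vol_density g x)" using pos(1)[OF x] by simp
      moreover have "0 < sqrt c" using c(1) by simp
      ultimately have "inverse (sqrt (vol_density g x)) \<le> inverse (sqrt c)" "0 < inverse (sqrt (vol_density g x))"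
        by (auto intro!: le_imp_inverse_le)
      then show ?thesis by (cases "x \<in> B") (use c(1) in \<open>simp_all add: z_def\<close>)
    qed
  qed
  have bound: "ip M (y \<mu>) (y \<mu>) \<le> C * K" if \<mu>: "\<mu> \<in> ?S" for \<mu>
  proof -
    have "norm (y \<mu> x) \<le> sqrt C * norm (U \<mu> x)" if x: "x \<in> space M" for x
    proof -
      have "\<bar>sqrt (vol_density g x)\<bar> \<le> sqrt C" using pos[OF x] c(1) by simp
      moreover have "\<bar>fst (U \<mu> x)\<bar> \<le> norm (U \<mu> x)" using norm_fst_le[of "fst (U \<mu> x)" "snd (U \<mu> x)"] by simp
      ultimately show ?thesis unfolding y_def real_norm_def abs_mult using C(1) by (intro mult_mono) auto
    qed
    then have b: "norm (y \<mu> x) \<le> norm (sqrt C *\<^sub>R U \<mu> x)" if "x \<in> space M" for x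
      using that C(1) by simp
    have "ip M (y \<mu>) (y \<mu>) = (\<integral>x. (norm (y \<mu> x))\<^sup>2 \<partial>M)" by (rule ip_self)
    also have "\<dots> \<le> (\<integral>x. (norm (sqrt C *\<^sub>R U \<mu> x))\<^sup>2 \<partial>M)"
      using b yL[OF \<mu>] L2_scaleR[OF UL[OF \<mu>], of "sqrt C"]
      by (intro integral_mono power_mono) (simp_all add: L2_def)
    also have "\<dots> = C * ip M (U \<mu>) (U \<mu>)"
      using C(1) by (simp add: ip_self power_mult_distrib)
    also have "\<dots> \<le> C * K" using U(2)[OF \<mu>] C(1) by simp
    finally show ?thesis .
  qed
  have pair: "ip M (y \<mu>) z = 1" if \<mu>: "\<mu> \<in> ?S" for \<mu>
  proof -
    have "ip M (y \<mu>) z = ip M (U \<mu>) (\<lambda>x. (indicator B x, 0))"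
      unfolding ip_def
    proof (rule Bochner_Integration.integral_cong[OF refl])
      fix x assume "x \<in> space M"
      then have "sqrt (vol_density g x) \<noteq> 0" using pos(1)[of x] c(1) by simp
      then show "y \<mu> x \<bullet> z x = U \<mu> x \<bullet> (indicator B x, 0)"
        by (simp add: y_def z_def inner_prod_def)
    qed
    then show ?thesis using U(3)[OF \<mu>] by simp
  qed
  have orth: "ip M (y \<mu>) (y \<nu>) = 0" if "\<mu> \<in> ?S" "\<nu> \<in> ?S" "\<mu> \<noteq> \<nu>" for \<mu> \<nu>
    unfolding y_def by (rule eigenpairs_orthogonal[OF g U(1)[OF that(1)] U(1)[OF that(2)] that(3)])
  have "card I \<le> nat \<lceil>C * K * ip M z z\<rceil>" if I: "I \<subseteq> ?S" "finite I" for I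
  proof (cases "I = {}")
    case False
    then obtain \<mu> where "\<mu> \<in> I" by blast
    then have "\<mu> \<in> ?S" using I(1) by (rule rev_subsetD)
    \<comment> \<open>\<open>K\<close> may be negative a priori; a member of \<open>I\<close>
      settles the sign.\<close>
    then have CK: "0 \<le> C * K" by (rule order_trans[OF ip_nonneg bound])
    have IS: "\<mu> \<in> ?S" if "\<mu> \<in> I" for \<mu> using that I(1) by (rule rev_subsetD)
    have "real (card I) \<le> C * K * ip M z z"
      using I(2) yL[OF IS] zL orth[OF IS IS] CK bound[OF IS] pair[OF IS]
      by (rule orthogonal_card_le[where y = y])
    then show ?thesis by linarith
  qed simp
  then show ?thesis using finite_if_finite_subsets_card_bdd by blast
qed

section \<open>Exclusion of the eigenvalue zero\<close>

text \<open>For \<open>\<mu> = 0\<close> the eigenvalue equation kills the gradient. Integration by parts against \<open>x\<^sub>1 \<phi>\<^sub>n\<close>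
  for test functions \<open>\<phi>\<^sub>n\<close> tending to the eigenfunction then shows that its norm vanishes.\<close>

lemma eigenpair_zero:
  assumes g: "g \<in> riemannian_metrics \<Omega>" and U: "eigenpair g 0 U"
  shows "ip M U (\<lambda>x. (fst (U x), 0)) = 0"
proof -
  have UH: "U \<in> H" using U by (rule eigenpair_H)
  have UL: "U \<in> L2 M" using UH by (rule H_L2)
  \<comment> \<open>Tested with itself, the equation for eigenvalue zero says that the Dirichlet
    energy vanishes; its density is nonnegative and positive wherever the gradient is
    nonzero.\<close>
  have "ip M U (\<lambda>x. bop g 0 x (U x)) = 0" by (rule eigenpair_test[OF g U UH])
  moreover have "0 \<le> U x \<bullet> bop g 0 x (U x)" "U x \<bullet> bop g 0 x (U x) = 0 \<Longrightarrow> snd (U x) = 0"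
    if "x \<in> space M" for x
  proof -
    have x: "x \<in> closure \<Omega>" using that \<Omega>_closure by simp
    have eq: "U x \<bullet> bop g 0 x (U x) = snd (U x) \<bullet> (flux g x *v snd (U x))"
      by (simp add: bop_def inner_prod_def)
    show "0 \<le> U x \<bullet> bop g 0 x (U x)" "U x \<bullet> bop g 0 x (U x) = 0 \<Longrightarrow> snd (U x) = 0"
      unfolding eq using flux_pos[OF g x, of "snd (U x)"] by (cases "snd (U x) = 0"; simp)+
  qed
  moreover have "integrable M (\<lambda>x. U x \<bullet> bop g 0 x (U x))"
    by (rule L2_inner_integrable[OF UL L2_bop[OF g UL]])
  ultimately have "AE x in M. U x \<bullet> bop g 0 x (U x) = 0"
    using integral_nonneg_eq_0_iff_AE[of M "\<lambda>x. U x \<bullet> bop g 0 x (U x)"] AE_I2[of M] unfolding ip_def by blast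
  then have grad: "AE x in M. snd (U x) = 0"
  proof (rule AE_mp, intro AE_I2 impI)
    fix x assume "x \<in> space M" "U x \<bullet> bop g 0 x (U x) = 0"
    then show "snd (U x) = 0"
      using \<open>\<And>x. x \<in> space M \<Longrightarrow> U x \<bullet> bop g 0 x (U x) = 0 \<Longrightarrow> snd (U x) = 0\<close> by blast
  qed
  obtain \<phi> where \<phi>: "\<And>n. \<phi> n \<in> test_functions \<Omega>" "L2_lim M (\<lambda>n. jet (\<phi> n)) U"
    using H_jet_sequence[OF UH] by blast
  obtain R where R: "\<And>x. x \<in> \<Omega> \<Longrightarrow> norm x \<le> R" using bounded_\<Omega> unfolding bounded_iff by blast
  \<comment> \<open>Pairing with the jet of \<open>\<phi> n\<close> gives \<open>fst U\<close> times
    the first derivative of \<open>x $ 1 * \<phi> n x\<close>, by the product rule. Pairing with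
    \<open>U\<close> leaves only the square of \<open>fst U\<close>, since the gradient part of
    \<open>U\<close> is zero almost everywhere.\<close>
  define Z where "Z x = (fst (U x), (x $ 1 * fst (U x)) *\<^sub>R axis 1 1 :: real^2)" for x
  have "(\<lambda>x. (x $ 1 * fst (U x)) *\<^sub>R axis 1 1 :: real^2) \<in> L2 M"
  proof (rule L2_bound[OF L2_fst[OF UL], of _ R])
    have "(\<lambda>x. x $ 1) \<in> borel_measurable M"
      by (intro continuous_measurable continuous_on_component continuous_on_id)
    then show "(\<lambda>x. (x $ 1 * fst (U x)) *\<^sub>R axis 1 1 :: real^2) \<in> borel_measurable M"
      using L2_measurable[OF L2_fst[OF UL]]
      by (intro borel_measurable_scaleR borel_measurable_times borel_measurable_const)
    fix x assume "x \<in> space M"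
    then have "\<bar>x $ 1\<bar> \<le> R" using R[of x] component_le_norm_cart[of x 1] by simp
    then show "norm ((x $ 1 * fst (U x)) *\<^sub>R axis 1 1 :: real^2) \<le> R * norm (fst (U x))"
      by (simp add: abs_mult mult_right_mono)
  qed
  then have ZL: "Z \<in> L2 M" unfolding Z_def by (rule L2_Pair[OF L2_fst[OF UL]])
  have zero: "ip M (jet (\<phi> n)) Z = 0" for n
  proof -
    have sm: "smooth_on \<Omega> (\<lambda>x::real^2. x $ 1)"
      by (rule smooth_on_bounded_linear[OF open_\<Omega> bounded_linear_vec_nth])
    let ?\<psi> = "\<lambda>x. x $ 1 * \<phi> n x"
    have \<psi>: "?\<psi> \<in> test_functions \<Omega>" by (rule test_functions_mult[OF open_\<Omega> \<phi>(1) sm])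
    have pd: "partial_deriv 1 ?\<psi> x = \<phi> n x + x $ 1 * partial_deriv 1 (\<phi> n) x" for x
    proof -
      have "\<phi> n differentiable (at x)"
        using \<phi>(1)[of n] by (intro smooth_on_differentiable[of UNIV]) (auto simp: test_functions_def)
      moreover have "(\<lambda>x::real^2. x $ 1) differentiable (at x)"
        by (rule bounded_linear_imp_differentiable[OF bounded_linear_vec_nth])
      moreover have "((\<lambda>x::real^2. x $ 1) has_derivative (\<lambda>x. x $ 1)) (at x)"
        by (rule bounded_linear_imp_has_derivative[OF bounded_linear_vec_nth])
      then have "partial_deriv 1 (\<lambda>x::real^2. x $ 1) x = 1"
        by (simp add: partial_deriv_eq axis_def)
      ultimately show ?thesis by (simp add: partial_deriv_mult)
    qed
    have pt: "jet (\<phi> n) x \<bullet> Z x = fst (U x) * partial_deriv 1 ?\<psi> x" for x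
      unfolding pd by (simp add: jet_def Z_def inner_prod_def gradient_def inner_axis) (simp add: algebra_simps)
    \<comment> \<open>Only the scalar part of the field contributes, as the gradient part of
      \<open>U\<close> is null.\<close>
    have "ip M U (parts_field ?\<psi> 1) = (\<integral>x. fst (U x) * partial_deriv 1 ?\<psi> x \<partial>M)"
      unfolding ip_def
    proof (rule integral_cong_AE)
      show "(\<lambda>x. U x \<bullet> parts_field ?\<psi> 1 x) \<in> borel_measurable M"
        using L2_inner_integrable[OF UL L2_parts_field[OF \<psi>]] by (rule borel_measurable_integrable)
      show "(\<lambda>x. fst (U x) * partial_deriv 1 ?\<psi> x) \<in> borel_measurable M"
        using L2_measurable[OF L2_fst[OF UL]] L2_measurable[OF L2_test[OF test_functions_partial_deriv[OF \<psi>]]]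
        by (rule borel_measurable_times)
      show "AE x in M. U x \<bullet> parts_field ?\<psi> 1 x = fst (U x) * partial_deriv 1 ?\<psi> x"
        using grad by eventually_elim (simp add: parts_field_def inner_prod_def)
    qed
    moreover have "ip M U (parts_field ?\<psi> 1) = 0" using UH \<psi> unfolding H_def by blast
    ultimately show ?thesis unfolding ip_def pt by simp
  qed
  have "(\<lambda>n. ip M (jet (\<phi> n)) Z) \<longlonglongrightarrow> ip M U Z"
    by (rule L2_lim_ip[OF \<phi>(2) L2_jet[OF \<phi>(1)] UL ZL])
  then have "ip M U Z = 0" unfolding zero by (simp add: LIMSEQ_const_iff)
  also have "ip M U Z = ip M U (\<lambda>x. (fst (U x), 0))"
    unfolding ip_def
  proof (rule integral_cong_AE)
    show "(\<lambda>x. U x \<bullet> Z x) \<in> borel_measurable M"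
      using L2_inner_integrable[OF UL ZL] by (rule borel_measurable_integrable)
    show "(\<lambda>x. U x \<bullet> (fst (U x), 0)) \<in> borel_measurable M"
      using L2_inner_integrable[OF UL L2_Pair[OF L2_fst[OF UL] L2_zero]] by (rule borel_measurable_integrable)
    show "AE x in M. U x \<bullet> Z x = U x \<bullet> (fst (U x), 0)"
      using grad by eventually_elim (simp add: Z_def inner_prod_def)
  qed
  finally show "ip M U (\<lambda>x. (fst (U x), 0)) = 0" by simp
qed

text \<open>By Cauchy-Schwarz a function of norm zero cannot have integral one over
  \<open>B\<close>.\<close>

lemma zero_not_eigen:
  assumes B: "B \<in> sets borel"
  shows "eigen_metrics 0 B K = {}"
proof (rule ccontr)
  assume "eigen_metrics 0 B K \<noteq> {}"
  then obtain g U where g: "g \<in> riemannian_metrics \<Omega>" and U: "eigenpair g 0 U"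
    and one: "ip M U (\<lambda>x. (indicator B x, 0)) = 1"
    unfolding eigen_metrics_def by blast
  have fL: "(\<lambda>x. fst (U x)) \<in> L2 M" by (rule L2_fst[OF H_L2[OF eigenpair_H[OF U]]])
  have "ip M (\<lambda>x. fst (U x)) (\<lambda>x. fst (U x)) = 0"
    using eigenpair_zero[OF g U] by (simp add: ip_def inner_prod_def)
  then have "ip M (\<lambda>x. fst (U x)) (indicator B) = 0"
    using ip_Cauchy_Schwarz[OF fL L2_indicator[OF B]] by simp
  then show False using one by (simp add: ip_def inner_prod_def)
qed

section \<open>Density by constant scaling\<close>

lemma scale_metric_eigen:
  assumes g: "g \<in> riemannian_metrics \<Omega>" and c: "0 < c" and e: "scale_metric \<Omega> c g \<in> eigen_metrics \<mu> B K"
  shows "g \<in> eigen_metrics (c * \<mu>) B K"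
proof -
  have "bop (scale_metric \<Omega> c g) \<mu> x V = bop g (c * \<mu>) x V" if "x \<in> space M" for x V
    using that \<Omega>_closure[of x] c
    by (simp add: bop_def vol_density_scale_metric flux_scale_metric mult_ac)
  then have "ip M U (\<lambda>x. bop (scale_metric \<Omega> c g) \<mu> x (W x)) = ip M U (\<lambda>x. bop g (c * \<mu>) x (W x))" for U W
    unfolding ip_def by (intro Bochner_Integration.integral_cong[OF refl]) (simp only:)
  then show ?thesis using e g unfolding eigen_metrics_def eigenpair_def by auto
qed

text \<open>Every interval of factors just above 1 is infinite, whereas only finitely many factors
  keep the scaled metric in the family.\<close>

lemma dense_not_eigen_metrics:
  assumes B: "B \<in> sets borel"
  shows "metrics_topology \<Omega> closure_of (riemannian_metrics \<Omega> - eigen_metrics \<mu> B K) = topspace (metrics_topology \<Omega>)"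
proof (rule subset_antisym[OF closure_of_subset_topspace], rule subsetI)
  fix g assume "g \<in> topspace (metrics_topology \<Omega>)"
  then have g: "g \<in> riemannian_metrics \<Omega>" by (simp add: topspace_metrics_topology)
  have "\<exists>h. h \<in> riemannian_metrics \<Omega> - eigen_metrics \<mu> B K \<and> h \<in> T"
    if T: "g \<in> T" "openin (metrics_topology \<Omega>) T" for T
  proof -
    obtain k e where e: "0 < e" "\<And>h. h \<in> riemannian_metrics \<Omega> \<Longrightarrow> Ck_close \<Omega> k e g h \<Longrightarrow> h \<in> T"
      using T unfolding openin_metrics_topology by blast
    obtain d where d: "0 < d" "\<And>c. \<bar>c - 1\<bar> < d \<Longrightarrow> Ck_close \<Omega> k e g (scale_metric \<Omega> c g)"
      using scale_metric_close[OF open_\<Omega> bounded_\<Omega> g e(1), of k] by blast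
    have "\<exists>c. 1 < c \<and> c < 1 + d \<and> g \<notin> eigen_metrics (c * \<mu>) B K"
    proof (cases "\<mu> = 0")
      case True
      then show ?thesis using d(1) zero_not_eigen[OF B] by (intro exI[of _ "1 + d/2"]) simp
    next
      case False
      \<comment> \<open>The bad factors: \<open>c\<close> is bad only if \<open>c * \<mu>\<close> is
        one of the finitely many values \<open>\<nu>\<close> for \<open>g\<close>.\<close>
      let ?S = "(\<lambda>\<nu>. \<nu> / \<mu>) ` {\<nu>. g \<in> eigen_metrics \<nu> B K}"
      have "finite ?S" using finite_eigen_metrics[OF g B] by (rule finite_imageI)
      moreover have "infinite {1<..<1 + d}" using d(1) by (simp add: infinite_Ioo)
      ultimately have "\<not> {1<..<1 + d} \<subseteq> ?S" using finite_subset by blast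
      then obtain c where "c \<in> {1<..<1 + d}" and c3: "c \<notin> ?S" by blast
      then have c: "1 < c" "c < 1 + d" by simp_all
      have "g \<notin> eigen_metrics (c * \<mu>) B K"
      proof
        assume "g \<in> eigen_metrics (c * \<mu>) B K"
        then have "c * \<mu> / \<mu> \<in> ?S" by blast
        then show False using c3 False by simp
      qed
      then show ?thesis using c by blast
    qed
    then obtain c where c: "1 < c" "c < 1 + d" "g \<notin> eigen_metrics (c * \<mu>) B K" by blast
    have c0: "0 < c" using c(1) by simp
    have "Ck_close \<Omega> k e g (scale_metric \<Omega> c g)" using c by (intro d(2)) simp
    then have "scale_metric \<Omega> c g \<in> T" using e(2) scale_metric_mem[OF open_\<Omega> g c0] by blast
    moreover have "scale_metric \<Omega> c g \<notin> eigen_metrics \<mu> B K"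
      using scale_metric_eigen[OF g c0] c(3) by blast
    ultimately show ?thesis using scale_metric_mem[OF open_\<Omega> g c0] by blast
  qed
  then show "g \<in> metrics_topology \<Omega> closure_of (riemannian_metrics \<Omega> - eigen_metrics \<mu> B K)"
    unfolding in_closure_of using g by (simp add: topspace_metrics_topology)
qed

lemma residual_disjoint_spectrum:
  assumes g0: "g0 \<in> riemannian_metrics \<Omega>"
  shows "residual_in (metrics_topology \<Omega>)
    {g \<in> riemannian_metrics \<Omega>. dirichlet_spectrum \<Omega> g \<inter> dirichlet_spectrum \<Omega> g0 = {}}"
proof -
  obtain \<B> :: "(real^2) set set" where cB: "countable \<B>"
    and B: "Int_stable \<B>" "UNIV \<in> \<B>" "sets borel = sigma_sets UNIV \<B>"
    using countable_generator_exists by blast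
  have borel: "A \<in> sets borel" if "A \<in> \<B>" for A using that B(3) by (simp add: sigma_sets.Basic)
  have cover: "\<exists>A\<in>\<B>. \<exists>k::nat. g \<in> eigen_metrics \<mu> A (real k)"
    if "g \<in> riemannian_metrics \<Omega>" "\<mu> \<in> dirichlet_spectrum \<Omega> g" for g \<mu>
    using spectrum_imp_eigenpair[OF that] eigenpair_in_eigen_metrics[OF that(1) _ _ B] by blast
  have "dirichlet_spectrum \<Omega> g0 \<subseteq> (\<Union>A\<in>\<B>. \<Union>k::nat. {\<mu>. g0 \<in> eigen_metrics \<mu> A (real k)})"
    using cover[OF g0] by blast
  moreover have "countable (\<Union>A\<in>\<B>. \<Union>k::nat. {\<mu>. g0 \<in> eigen_metrics \<mu> A (real k)})"
    by (intro countable_UN cB countableI_type countable_finite finite_eigen_metrics[OF g0 borel])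
  ultimately have cS: "countable (dirichlet_spectrum \<Omega> g0)" by (rule countable_subset)
  \<comment> \<open>One open dense set for each eigenvalue of \<open>g0\<close>, each separating set
    and each integer norm bound. A metric that shares an eigenvalue with \<open>g0\<close> misses at
    least one of them.\<close>
  define \<U> where "\<U> = (\<lambda>(\<mu>, A, k::nat). riemannian_metrics \<Omega> - eigen_metrics \<mu> A (real k))
    ` (dirichlet_spectrum \<Omega> g0 \<times> \<B> \<times> UNIV)"
  have "countable \<U>" unfolding \<U>_def using cS cB by (intro countable_image countable_SIGMA) auto
  moreover have "openin (metrics_topology \<Omega>) V \<and> metrics_topology \<Omega> closure_of V = topspace (metrics_topology \<Omega>)"
    if "V \<in> \<U>" for V
    using that borel openin_not_eigen_metrics dense_not_eigen_metrics unfolding \<U>_def by auto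
  moreover have "dirichlet_spectrum \<Omega> g \<inter> dirichlet_spectrum \<Omega> g0 = {}"
    if g: "g \<in> riemannian_metrics \<Omega>" "g \<in> \<Inter>\<U>" for g
  proof (rule ccontr)
    assume "dirichlet_spectrum \<Omega> g \<inter> dirichlet_spectrum \<Omega> g0 \<noteq> {}"
    then obtain \<mu> where \<mu>: "\<mu> \<in> dirichlet_spectrum \<Omega> g" "\<mu> \<in> dirichlet_spectrum \<Omega> g0" by blast
    obtain A and k :: nat where A: "A \<in> \<B>" "g \<in> eigen_metrics \<mu> A (real k)" using cover[OF g(1) \<mu>(1)] by blast
    have "riemannian_metrics \<Omega> - eigen_metrics \<mu> A (real k) \<in> \<U>"
      unfolding \<U>_def using \<mu>(2) A(1) by force
    then show False using g(2) A(2) by blast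
  qed
  ultimately show ?thesis
    unfolding residual_in_def topspace_metrics_topology by (intro conjI exI[of _ \<U>]) blast+
qed

end

theorem proposition5p12:
  fixes \<Omega> :: "(real^2) set" and g\<^sub>0 :: "real^2 \<Rightarrow> real^2^2"
  assumes "bounded_smooth_domain \<Omega>"
    and "g\<^sub>0 \<in> riemannian_metrics \<Omega>"
  shows "residual_in (metrics_topology \<Omega>)
           {g \<in> riemannian_metrics \<Omega>. dirichlet_spectrum \<Omega> g \<inter> dirichlet_spectrum \<Omega> g\<^sub>0 = {}}"
proof -
  interpret bounded_open_set \<Omega>
    using assms(1) by unfold_locales (auto simp: bounded_smooth_domain_def)
  show ?thesis using assms(2) by (rule residual_disjoint_spectrum)
qed

end
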